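(* Let $(\Omega,\mathcal E,P)$ be a probability space, $\mathcal F$ a $\sigma$-subalgebra of $\mathcal E$, $f:L^\infty(\mathcal E)\to L^\infty(\mathcal F)$ an $L^0(\mathcal F)$-convex $L^\infty$-conditional risk measure, and $\bar f:L^\infty_{\mathcal F}(\mathcal E)\to L^0(\mathcal F)$ the unique $L^\infty_{\mathcal F}(\mathcal E)$-conditional risk measure such that $|\bar f(x)-\bar f(y)|\le|||x-y|||_\infty$ for all $x,y\in L^\infty_{\mathcal F}(\mathcal E)$ and $\bar f|_{L^\infty(\mathcal E)}=f$. Then the following statements are equivalent: (1) $f$ is continuous from above; (2) $f$ has the Fatou property; (3) $f(x)=\bigvee\{E(xy|\mathcal F)-f^*(y): y\in L^1(\mathcal E),\ y\le0\text{ and }E(y|\mathcal F)=-1\}$ for all $x\in L^\infty(\mathcal E)$; (4) $f(x)=\bigvee\{E(xy|\mathcal F)-f^*(y): y\in L^1_{\mathcal F}(\mathcal E),\ y\le0\text{ and }E(y|\mathcal F)=-1\}$ for all $x\in L^\infty(\mathcal E)$; (5) $\bar f(x)=\bigvee\{E(xy|\mathcal F)-\bar f^*(y): y\in L^1_{\mathcal F}(\mathcal E),\ y\le0\text{ and }E(y|\mathcal F)=-1\}$ for all $x\in L^\infty_{\mathcal F}(\mathcal E)$; (6) $\bar f$ is $\sigma_{\varepsilon,\lambda}(L^\infty_{\mathcal F}(\mathcal E),L^1_{\mathcal F}(\mathcal E))$-lower semicontinuous (or, equivalently, $\sigma_c(L^\infty_{\mathcal F}(\mathcal E),L^1_{\mathcal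 F}(\mathcal E))$-lower semicontinuous).
   Context: $L^0(\mathcal E)$, $L^0(\mathcal F)$ are the algebras of (a.s.-equality) equivalence classes of real $\mathcal E$-, respectively $\mathcal F$-, measurable random variables with the a.s. order; $L^0_+(\mathcal F)$, $L^0_{++}(\mathcal F)$ are the elements of $L^0(\mathcal F)$ that are $\ge0$, respectively $>0$, a.s. $\bar L^0(\mathcal F)$ is the complete lattice of classes of $[-\infty,\infty]$-valued $\mathcal F$-measurable functions, $\bar L^0_+(\mathcal F)$ its nonnegative elements; $\bigvee,\bigwedge$ are taken there. $L^\infty(\mathcal E),L^1(\mathcal E),L^\infty(\mathcal F)$ are the usual Lebesgue spaces. For $x\in L^0(\mathcal E)$: $|||x|||_1=E[|x|\,|\mathcal F]$, $|||x|||_\infty=\bigwedge\{\xi\in\bar L^0_+(\mathcal F):|x|\le\xi\}$; $L^p_{\mathcal F}(\mathcal E)=\{x\in L^0(\mathcal E):|||x|||_p\in L^0_+(\mathcal F)\}$ for $p=1,\infty$. For $z\in L^1_{\mathcal F}(\mathcal E)$, $E(z|\mathcal F)=E(z^+|\mathcal F)-E(z^-|\mathcal F)\in L^0(\mathcal F)$. An $L^\infty$-conditional risk measure is a function $f:L^\infty(\mathcal E)\to L^\infty(\mathcal F)$ with $f(x)\le f(y)$ whenever $x\ge y$, and $f(x+y)=f(x)-y$ for $x\in L^\infty(\mathcal E)$, $y\in L^\infty(\mathcal F)$. It is $L^0(\mathcal F)$-convex if $f(\xi x+(1-\xi)y)\le\xi f(x)+(1-\xi)f(y)$ for all $x,y$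 and $\xi\in L^0_+(\mathcal F)$ with $0\le\xi\le1$. An $L^\infty_{\mathcal F}(\mathcal E)$-conditional risk measure with values in $L^0(\mathcal F)$ is a function $\bar f:L^\infty_{\mathcal F}(\mathcal E)\to L^0(\mathcal F)$ with $\bar f(x)\le\bar f(y)$ whenever $x\ge y$, and $\bar f(x+y)=\bar f(x)-y$ for $x\in L^\infty_{\mathcal F}(\mathcal E)$, $y\in L^0(\mathcal F)$. The extension $\bar f$ in the claim exists and is unique. $f$ is continuous from above if $f(x_n)\nearrow f(x)$ whenever $x_n\searrow x$ (a.s., with $x_n,x\in L^\infty(\mathcal E)$). $f$ has the Fatou property if $f(x)\le\liminf_nf(x_n)$ for every bounded sequence $\{x_n\}$ in $L^\infty(\mathcal E)$ converging $P$-a.s. to some $x$. For $y\in L^1_{\mathcal F}(\mathcal E)$: $f^*(y)=\bigvee\{E(xy|\mathcal F)-f(x):x\in L^\infty(\mathcal E)\}$ and $\bar f^*(y)=\bigvee\{E(xy|\mathcal F)-\bar f(x):x\in L^\infty_{\mathcal F}(\mathcal E)\}$. $\sigma_c(L^\infty_{\mathcal F}(\mathcal E),L^1_{\mathcal F}(\mathcal E))$ has local base at $0$ consisting of $\{x:|E(xy_i|\mathcal F)|\le\varepsilon,\ i\le n\}$, $y_1,\dots,y_n\in L^1_{\mathcal F}(\mathcal E)$, $\varepsilon\in L^0_{++}(\mathcal F)$; $\sigma_{\varepsilon,\lambda}(L^\infty_{\mathcal F}(\mathcal E),L^1_{\mathcal F}(\mathcal E))$ is the linear topology with local base at $0$ consisting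 of $\{x:P\{\max_i|E(xy_i|\mathcal F)|<\varepsilon\}>1-\lambda\}$, $y_1,\dots,y_n\in L^1_{\mathcal F}(\mathcal E)$, $\varepsilon>0$, $0<\lambda<1$ real. $\bar f$ is $\sigma_{\varepsilon,\lambda}$-lower semicontinuous if $\{(x,r):r\in L^0(\mathcal F),\bar f(x)\le r\}$ is closed in the product of $\sigma_{\varepsilon,\lambda}(L^\infty_{\mathcal F}(\mathcal E),L^1_{\mathcal F}(\mathcal E))$ and the topology of convergence in probability on $L^0(\mathcal F)$; it is $\sigma_c$-lower semicontinuous if $\{x:\bar f(x)\le r\}$ is $\sigma_c$-closed for every $r\in L^0(\mathcal F)$. *)

theory Defs
  imports "HOL-Probability.Probability"
begin

text \<open>
  Throughout, \<open>M\<close> is the probability space \<open>(\<Omega>, E, P)\<close> and \<open>F\<close> a measure whose \<open>sets\<close> form the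
  sub-sigma-algebra; the measure carried by \<open>F\<close> itself is never used, "almost surely" always
  refers to \<open>M\<close>. As elsewhere in the measure theory library, elements of spaces of random variables
  are measurable functions, and equalities and inequalities between classes are \<open>AE\<close> statements
  about representatives.
\<close>

definition L0 :: "'a measure \<Rightarrow> ('a \<Rightarrow> real) set" where
  "L0 M = borel_measurable M"

definition L1 :: "'a measure \<Rightarrow> ('a \<Rightarrow> real) set" where
  "L1 M = {x. integrable M x}"

text \<open>\<open>Linf M M\<close> is $L^\infty(E)$ and \<open>Linf M F\<close> is $L^\infty(F)$.\<close>

definition Linf :: "'a measure \<Rightarrow> 'a measure \<Rightarrow> ('a \<Rightarrow> real) set" where
  "Linf M F = {x \<in> L0 F. \<exists>C::real. AE \<omega> in M. \<bar>x \<omega>\<bar> \<le> C}"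


text \<open>
  Least upper and greatest lower bounds in the complete lattice of (classes of) extended real valued
  \<open>F\<close>-measurable functions. They are determined only up to \<open>AE\<close>-equality; \<open>cond_Sup\<close> and
  \<open>cond_Inf\<close> choose a representative.
\<close>

definition is_cond_Sup :: "'a measure \<Rightarrow> 'a measure \<Rightarrow> ('a \<Rightarrow> ereal) set \<Rightarrow> ('a \<Rightarrow> ereal) \<Rightarrow> bool" where
  "is_cond_Sup M F A s \<longleftrightarrow> s \<in> borel_measurable F \<and>
     (\<forall>a\<in>A. AE \<omega> in M. a \<omega> \<le> s \<omega>) \<and>
     (\<forall>t\<in>borel_measurable F. (\<forall>a\<in>A. AE \<omega> in M. a \<omega> \<le> t \<omega>) \<longrightarrow> (AE \<omega> in M. s \<omega> \<le> t \<omega>))"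

definition cond_Sup :: "'a measure \<Rightarrow> 'a measure \<Rightarrow> ('a \<Rightarrow> ereal) set \<Rightarrow> ('a \<Rightarrow> ereal)" where
  "cond_Sup M F A = (SOME s. is_cond_Sup M F A s)"

definition is_cond_Inf :: "'a measure \<Rightarrow> 'a measure \<Rightarrow> ('a \<Rightarrow> ereal) set \<Rightarrow> ('a \<Rightarrow> ereal) \<Rightarrow> bool" where
  "is_cond_Inf M F A s \<longleftrightarrow> s \<in> borel_measurable F \<and>
     (\<forall>a\<in>A. AE \<omega> in M. s \<omega> \<le> a \<omega>) \<and>
     (\<forall>t\<in>borel_measurable F. (\<forall>a\<in>A. AE \<omega> in M. t \<omega> \<le> a \<omega>) \<longrightarrow> (AE \<omega> in M. t \<omega> \<le> s \<omega>))"

definition cond_Inf :: "'a measure \<Rightarrow> 'a measure \<Rightarrow> ('a \<Rightarrow> ereal) set \<Rightarrow> ('a \<Rightarrow> ereal)" where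
  "cond_Inf M F A = (SOME s. is_cond_Inf M F A s)"

lemma is_cond_Sup_unique:
  assumes "is_cond_Sup M F A s" "is_cond_Sup M F A t"
  shows "AE \<omega> in M. s \<omega> = t \<omega>"
proof -
  have "AE \<omega> in M. s \<omega> \<le> t \<omega>" "AE \<omega> in M. t \<omega> \<le> s \<omega>"
    using assms unfolding is_cond_Sup_def by blast+
  then show ?thesis by eventually_elim auto
qed

lemma is_cond_Inf_unique:
  assumes "is_cond_Inf M F A s" "is_cond_Inf M F A t"
  shows "AE \<omega> in M. s \<omega> = t \<omega>"
proof -
  have "AE \<omega> in M. s \<omega> \<le> t \<omega>" "AE \<omega> in M. t \<omega> \<le> s \<omega>"
    using assms unfolding is_cond_Inf_def by blast+
  then show ?thesis by eventually_elim auto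
qed


definition cond_norm_1 :: "'a measure \<Rightarrow> 'a measure \<Rightarrow> ('a \<Rightarrow> real) \<Rightarrow> ('a \<Rightarrow> ennreal)" where
  "cond_norm_1 M F x = nn_cond_exp M F (\<lambda>\<omega>. ennreal \<bar>x \<omega>\<bar>)"

definition cond_norm_inf :: "'a measure \<Rightarrow> 'a measure \<Rightarrow> ('a \<Rightarrow> real) \<Rightarrow> ('a \<Rightarrow> ereal)" where
  "cond_norm_inf M F x = cond_Inf M F
     {\<xi> \<in> borel_measurable F. (AE \<omega> in M. 0 \<le> \<xi> \<omega>) \<and> (AE \<omega> in M. ereal \<bar>x \<omega>\<bar> \<le> \<xi> \<omega>)}"

text \<open>
  $L^1_F(E)$ and $L^\infty_F(E)$. For \<open>z \<in> LF1 M F\<close> the library's \<open>real_cond_exp M F z\<close> is, by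
  definition, $E(z^+|F) - E(z^-|F)$, even when \<open>z\<close> is not integrable.
\<close>

definition LF1 :: "'a measure \<Rightarrow> 'a measure \<Rightarrow> ('a \<Rightarrow> real) set" where
  "LF1 M F = {x \<in> L0 M. AE \<omega> in M. cond_norm_1 M F x \<omega> < \<infinity>}"

definition LFinf :: "'a measure \<Rightarrow> 'a measure \<Rightarrow> ('a \<Rightarrow> real) set" where
  "LFinf M F = {x \<in> L0 M. AE \<omega> in M. cond_norm_inf M F x \<omega> < \<infinity>}"

definition cond_pairing :: "'a measure \<Rightarrow> 'a measure \<Rightarrow> ('a \<Rightarrow> real) \<Rightarrow> ('a \<Rightarrow> real) \<Rightarrow> ('a \<Rightarrow> real)" where
  "cond_pairing M F x y = real_cond_exp M F (\<lambda>\<omega>. x \<omega> * y \<omega>)"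


text \<open>
  A conditional risk measure with domain \<open>X\<close>, values in \<open>V\<close> and cash invariance along \<open>V\<close>.
  Applying monotonicity twice shows that \<open>f\<close> respects \<open>AE\<close>-equality, so it is a map between classes.
\<close>

definition cond_risk_measure ::
  "'a measure \<Rightarrow> ('a \<Rightarrow> real) set \<Rightarrow> ('a \<Rightarrow> real) set \<Rightarrow> (('a \<Rightarrow> real) \<Rightarrow> ('a \<Rightarrow> real)) \<Rightarrow> bool" where
  "cond_risk_measure M X V f \<longleftrightarrow>
     (\<forall>x\<in>X. f x \<in> V) \<and>
     (\<forall>x\<in>X. \<forall>y\<in>X. (AE \<omega> in M. x \<omega> \<ge> y \<omega>) \<longrightarrow> (AE \<omega> in M. f x \<omega> \<le> f y \<omega>)) \<and>
     (\<forall>x\<in>X. \<forall>y\<in>V. AE \<omega> in M. f (\<lambda>\<omega>. x \<omega> + y \<omega>) \<omega> = f x \<omega> - y \<omega>)"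

definition Linf_cond_risk_measure ::
  "'a measure \<Rightarrow> 'a measure \<Rightarrow> (('a \<Rightarrow> real) \<Rightarrow> ('a \<Rightarrow> real)) \<Rightarrow> bool" where
  "Linf_cond_risk_measure M F f \<longleftrightarrow> cond_risk_measure M (Linf M M) (Linf M F) f"

definition LFinf_cond_risk_measure ::
  "'a measure \<Rightarrow> 'a measure \<Rightarrow> (('a \<Rightarrow> real) \<Rightarrow> ('a \<Rightarrow> real)) \<Rightarrow> bool" where
  "LFinf_cond_risk_measure M F f \<longleftrightarrow> cond_risk_measure M (LFinf M F) (L0 F) f"

definition L0_convex :: "'a measure \<Rightarrow> 'a measure \<Rightarrow> (('a \<Rightarrow> real) \<Rightarrow> ('a \<Rightarrow> real)) \<Rightarrow> bool" where
  "L0_convex M F f \<longleftrightarrow>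
     (\<forall>x\<in>Linf M M. \<forall>y\<in>Linf M M. \<forall>\<xi>\<in>L0 F. (AE \<omega> in M. 0 \<le> \<xi> \<omega> \<and> \<xi> \<omega> \<le> 1) \<longrightarrow>
        (AE \<omega> in M. f (\<lambda>\<omega>. \<xi> \<omega> * x \<omega> + (1 - \<xi> \<omega>) * y \<omega>) \<omega> \<le> \<xi> \<omega> * f x \<omega> + (1 - \<xi> \<omega>) * f y \<omega>))"

definition continuous_from_above :: "'a measure \<Rightarrow> (('a \<Rightarrow> real) \<Rightarrow> ('a \<Rightarrow> real)) \<Rightarrow> bool" where
  "continuous_from_above M f \<longleftrightarrow>
     (\<forall>X x. (\<forall>n::nat. X n \<in> Linf M M) \<longrightarrow> x \<in> Linf M M \<longrightarrow>
        (AE \<omega> in M. decseq (\<lambda>n. X n \<omega>) \<and> (\<lambda>n. X n \<omega>) \<longlonglongrightarrow> x \<omega>) \<longrightarrow>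
        (AE \<omega> in M. incseq (\<lambda>n. f (X n) \<omega>) \<and> (\<lambda>n. f (X n) \<omega>) \<longlonglongrightarrow> f x \<omega>))"

definition Fatou_property :: "'a measure \<Rightarrow> (('a \<Rightarrow> real) \<Rightarrow> ('a \<Rightarrow> real)) \<Rightarrow> bool" where
  "Fatou_property M f \<longleftrightarrow>
     (\<forall>X x. (\<forall>n::nat. X n \<in> Linf M M) \<longrightarrow> (\<exists>C::real. \<forall>n. AE \<omega> in M. \<bar>X n \<omega>\<bar> \<le> C) \<longrightarrow>
        x \<in> Linf M M \<longrightarrow> (AE \<omega> in M. (\<lambda>n. X n \<omega>) \<longlonglongrightarrow> x \<omega>) \<longrightarrow>
        (AE \<omega> in M. ereal (f x \<omega>) \<le> liminf (\<lambda>n. ereal (f (X n) \<omega>))))"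


text \<open>\<open>cond_conjugate M F X f\<close> is $f^*$ for \<open>X = Linf M M\<close> and $\bar f^*$ for \<open>X = LFinf M F\<close>.\<close>

definition cond_conjugate ::
  "'a measure \<Rightarrow> 'a measure \<Rightarrow> ('a \<Rightarrow> real) set \<Rightarrow> (('a \<Rightarrow> real) \<Rightarrow> ('a \<Rightarrow> real)) \<Rightarrow>
   ('a \<Rightarrow> real) \<Rightarrow> ('a \<Rightarrow> ereal)" where
  "cond_conjugate M F X f y =
     cond_Sup M F {(\<lambda>\<omega>. ereal (cond_pairing M F x y \<omega> - f x \<omega>)) | x. x \<in> X}"

text \<open>
  The representation $f(x) = \bigvee \{E(xy|F) - f^*(y) : y \in Y, y \le 0, E(y|F) = -1\}$ for all
  \<open>x \<in> X\<close>. The conjugate is a.s. different from \<open>-\<infinity>\<close>, so the subtraction is never an undefined one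
  outside a null set.
\<close>

definition dual_representation ::
  "'a measure \<Rightarrow> 'a measure \<Rightarrow> ('a \<Rightarrow> real) set \<Rightarrow> ('a \<Rightarrow> real) set \<Rightarrow>
   (('a \<Rightarrow> real) \<Rightarrow> ('a \<Rightarrow> real)) \<Rightarrow> bool" where
  "dual_representation M F X Y f \<longleftrightarrow>
     (\<forall>x\<in>X. AE \<omega> in M. ereal (f x \<omega>) =
        cond_Sup M F
          {(\<lambda>\<omega>. ereal (cond_pairing M F x y \<omega>) - cond_conjugate M F X f y \<omega>) | y.
             y \<in> Y \<and> (AE \<omega> in M. y \<omega> \<le> 0) \<and> (AE \<omega> in M. real_cond_exp M F y \<omega> = -1)} \<omega>)"


text \<open>
  The translation invariant topology on \<open>X\<close> with local base \<open>B\<close> at 0. Being a topology on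
  representatives rather than classes it is not Hausdorff; for the bases below every open set is
  closed under \<open>AE\<close>-equality, so its open sets are exactly the preimages of the open sets of classes.
\<close>

definition local_base_topology :: "('a \<Rightarrow> real) set \<Rightarrow> ('a \<Rightarrow> real) set set \<Rightarrow> ('a \<Rightarrow> real) topology" where
  "local_base_topology X B =
     topology (\<lambda>U. U \<subseteq> X \<and> (\<forall>x\<in>U. \<exists>N\<in>B. (\<lambda>v \<omega>. x \<omega> + v \<omega>) ` N \<subseteq> U))"

lemma openin_local_base_topology:
  assumes "\<And>N N'. N \<in> B \<Longrightarrow> N' \<in> B \<Longrightarrow> \<exists>N''\<in>B. N'' \<subseteq> N \<inter> N'"
  shows "openin (local_base_topology X B) U \<longleftrightarrow>
     U \<subseteq> X \<and> (\<forall>x\<in>U. \<exists>N\<in>B. (\<lambda>v \<omega>. x \<omega> + v \<omega>) ` N \<subseteq> U)"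
proof -
  have "istopology (\<lambda>U. U \<subseteq> X \<and> (\<forall>x\<in>U. \<exists>N\<in>B. (\<lambda>v \<omega>. x \<omega> + v \<omega>) ` N \<subseteq> U))"
    unfolding istopology_def
  proof (intro conjI allI impI)
    fix S T
    assume S: "S \<subseteq> X \<and> (\<forall>x\<in>S. \<exists>N\<in>B. (\<lambda>v \<omega>. x \<omega> + v \<omega>) ` N \<subseteq> S)"
      and T: "T \<subseteq> X \<and> (\<forall>x\<in>T. \<exists>N\<in>B. (\<lambda>v \<omega>. x \<omega> + v \<omega>) ` N \<subseteq> T)"
    show "S \<inter> T \<subseteq> X" using S by blast
    show "\<forall>x\<in>S \<inter> T. \<exists>N\<in>B. (\<lambda>v \<omega>. x \<omega> + v \<omega>) ` N \<subseteq> S \<inter> T"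
    proof
      fix x assume "x \<in> S \<inter> T"
      then obtain N N' where N: "N \<in> B" "(\<lambda>v \<omega>. x \<omega> + v \<omega>) ` N \<subseteq> S"
          "N' \<in> B" "(\<lambda>v \<omega>. x \<omega> + v \<omega>) ` N' \<subseteq> T"
        using S T by blast
      obtain N'' where N'': "N'' \<in> B" "N'' \<subseteq> N \<inter> N'"
        using assms[OF N(1,3)] by (elim bexE)
      have "(\<lambda>v \<omega>. x \<omega> + v \<omega>) ` N'' \<subseteq> S \<inter> T"
        using image_mono[of N'' N "\<lambda>v \<omega>. x \<omega> + v \<omega>"] image_mono[of N'' N' "\<lambda>v \<omega>. x \<omega> + v \<omega>"]
          N(2,4) N''(2) by (meson Int_subset_iff subset_trans)
      with N''(1) show "\<exists>N\<in>B. (\<lambda>v \<omega>. x \<omega> + v \<omega>) ` N \<subseteq> S \<inter> T" by (rule bexI[rotated])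
    qed
  next
    fix K
    assume K: "\<forall>U\<in>K. U \<subseteq> X \<and> (\<forall>x\<in>U. \<exists>N\<in>B. (\<lambda>v \<omega>. x \<omega> + v \<omega>) ` N \<subseteq> U)"
    then show "\<Union>K \<subseteq> X" by blast
    show "\<forall>x\<in>\<Union>K. \<exists>N\<in>B. (\<lambda>v \<omega>. x \<omega> + v \<omega>) ` N \<subseteq> \<Union>K"
    proof
      fix x assume "x \<in> \<Union>K"
      then obtain U where U: "U \<in> K" "x \<in> U" by blast
      with K obtain N where "N \<in> B" "(\<lambda>v \<omega>. x \<omega> + v \<omega>) ` N \<subseteq> U" by blast
      with Union_upper[OF U(1)] show "\<exists>N\<in>B. (\<lambda>v \<omega>. x \<omega> + v \<omega>) ` N \<subseteq> \<Union>K"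
        by (meson subset_trans)
    qed
  qed
  then show ?thesis
    unfolding local_base_topology_def by (simp add: topology_inverse')
qed

definition sigma_c_base :: "'a measure \<Rightarrow> 'a measure \<Rightarrow> ('a \<Rightarrow> real) set set" where
  "sigma_c_base M F =
     {{x \<in> LFinf M F. \<forall>y\<in>Y. AE \<omega> in M. \<bar>cond_pairing M F x y \<omega>\<bar> \<le> \<epsilon> \<omega>} | Y \<epsilon>.
        finite Y \<and> Y \<noteq> {} \<and> Y \<subseteq> LF1 M F \<and> \<epsilon> \<in> L0 F \<and> (AE \<omega> in M. 0 < \<epsilon> \<omega>)}"

definition sigma_el_base :: "'a measure \<Rightarrow> 'a measure \<Rightarrow> ('a \<Rightarrow> real) set set" where
  "sigma_el_base M F =
     {{x \<in> LFinf M F. measure M {\<omega> \<in> space M. Max ((\<lambda>y. \<bar>cond_pairing M F x y \<omega>\<bar>) ` Y) < \<epsilon>} > 1 - \<delta>}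
        | Y \<epsilon> \<delta>.
        finite Y \<and> Y \<noteq> {} \<and> Y \<subseteq> LF1 M F \<and> 0 < \<epsilon> \<and> 0 < \<delta> \<and> \<delta> < (1::real)}"

definition prob_conv_base :: "'a measure \<Rightarrow> 'a measure \<Rightarrow> ('a \<Rightarrow> real) set set" where
  "prob_conv_base M F =
     {{r \<in> L0 F. measure M {\<omega> \<in> space M. \<bar>r \<omega>\<bar> < \<epsilon>} > 1 - \<delta>} | \<epsilon> \<delta>.
        0 < \<epsilon> \<and> 0 < \<delta> \<and> \<delta> < (1::real)}"

definition sigma_c_topology :: "'a measure \<Rightarrow> 'a measure \<Rightarrow> ('a \<Rightarrow> real) topology" where
  "sigma_c_topology M F = local_base_topology (LFinf M F) (sigma_c_base M F)"

definition sigma_el_topology :: "'a measure \<Rightarrow> 'a measure \<Rightarrow> ('a \<Rightarrow> real) topology" where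
  "sigma_el_topology M F = local_base_topology (LFinf M F) (sigma_el_base M F)"

definition prob_conv_topology :: "'a measure \<Rightarrow> 'a measure \<Rightarrow> ('a \<Rightarrow> real) topology" where
  "prob_conv_topology M F = local_base_topology (L0 F) (prob_conv_base M F)"

lemma sigma_c_base_directed:
  assumes "subalgebra M F" "N \<in> sigma_c_base M F" "N' \<in> sigma_c_base M F"
  shows "\<exists>N''\<in>sigma_c_base M F. N'' \<subseteq> N \<inter> N'"
proof -
  obtain Y \<epsilon> where N: "N = {x \<in> LFinf M F. \<forall>y\<in>Y. AE \<omega> in M. \<bar>cond_pairing M F x y \<omega>\<bar> \<le> \<epsilon> \<omega>}"
      "finite Y" "Y \<noteq> {}" "Y \<subseteq> LF1 M F" "\<epsilon> \<in> L0 F" "AE \<omega> in M. 0 < \<epsilon> \<omega>"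
    using assms(2) unfolding sigma_c_base_def by blast
  obtain Y' \<epsilon>' where N': "N' = {x \<in> LFinf M F. \<forall>y\<in>Y'. AE \<omega> in M. \<bar>cond_pairing M F x y \<omega>\<bar> \<le> \<epsilon>' \<omega>}"
      "finite Y'" "Y' \<noteq> {}" "Y' \<subseteq> LF1 M F" "\<epsilon>' \<in> L0 F" "AE \<omega> in M. 0 < \<epsilon>' \<omega>"
    using assms(3) unfolding sigma_c_base_def by blast
  let ?e = "\<lambda>\<omega>. min (\<epsilon> \<omega>) (\<epsilon>' \<omega>)"
  let ?N = "{x \<in> LFinf M F. \<forall>y\<in>Y \<union> Y'. AE \<omega> in M. \<bar>cond_pairing M F x y \<omega>\<bar> \<le> ?e \<omega>}"
  have 1: "?e \<in> L0 F" using N(5) N'(5) unfolding L0_def by measurable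
  have 2: "AE \<omega> in M. 0 < ?e \<omega>" using N(6) N'(6) by eventually_elim auto
  have "?N \<in> sigma_c_base M F"
    unfolding sigma_c_base_def mem_Collect_eq
    by (intro exI[of _ "Y \<union> Y'"] exI[of _ ?e] conjI refl 1 2)
      (use N(2-4) N'(2-4) in blast)+
  moreover have "?N \<subseteq> N \<inter> N'"
  proof
    fix x assume "x \<in> ?N"
    then have x: "x \<in> LFinf M F"
      and le: "\<And>y. y \<in> Y \<union> Y' \<Longrightarrow> AE \<omega> in M. \<bar>cond_pairing M F x y \<omega>\<bar> \<le> ?e \<omega>" by blast+
    have "AE \<omega> in M. \<bar>cond_pairing M F x y \<omega>\<bar> \<le> \<epsilon> \<omega>" if "y \<in> Y" for y
      using le[OF UnI1[OF that]] by eventually_elim simp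
    moreover have "AE \<omega> in M. \<bar>cond_pairing M F x y \<omega>\<bar> \<le> \<epsilon>' \<omega>" if "y \<in> Y'" for y
      using le[OF UnI2[OF that]] by eventually_elim simp
    ultimately show "x \<in> N \<inter> N'" unfolding N(1) N'(1) using x by blast
  qed
  ultimately show ?thesis by blast
qed

lemma sigma_el_base_directed:
  assumes "prob_space M" "subalgebra M F" "N \<in> sigma_el_base M F" "N' \<in> sigma_el_base M F"
  shows "\<exists>N''\<in>sigma_el_base M F. N'' \<subseteq> N \<inter> N'"
proof -
  interpret prob_space M by fact
  let ?E = "\<lambda>x Y (e::real). {\<omega> \<in> space M. Max ((\<lambda>y. \<bar>cond_pairing M F x y \<omega>\<bar>) ` Y) < e}"
  obtain Y \<epsilon> \<delta> where N: "N = {x \<in> LFinf M F. measure M (?E x Y \<epsilon>) > 1 - \<delta>}"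
      "finite Y" "Y \<noteq> {}" "Y \<subseteq> LF1 M F" "0 < \<epsilon>" "0 < \<delta>" "\<delta> < 1"
    using assms(3) unfolding sigma_el_base_def by blast
  obtain Y' \<epsilon>' \<delta>' where N': "N' = {x \<in> LFinf M F. measure M (?E x Y' \<epsilon>') > 1 - \<delta>'}"
      "finite Y'" "Y' \<noteq> {}" "Y' \<subseteq> LF1 M F" "0 < \<epsilon>'" "0 < \<delta>'" "\<delta>' < 1"
    using assms(4) unfolding sigma_el_base_def by blast
  let ?e = "min \<epsilon> \<epsilon>'" and ?l = "min \<delta> \<delta>'"
  let ?N = "{x \<in> LFinf M F. measure M (?E x (Y \<union> Y') ?e) > 1 - ?l}"
  have E_eq: "?E x Z e = {\<omega> \<in> space M. \<forall>y\<in>Z. \<bar>cond_pairing M F x y \<omega>\<bar> < e}"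
    if "finite Z" "Z \<noteq> {}" for x Z e using that by auto
  have meas: "?E x Z e \<in> sets M" if Z: "finite Z" "Z \<noteq> {}" for x Z e
  proof -
    have [measurable]: "cond_pairing M F x y \<in> borel_measurable M" for y
      unfolding cond_pairing_def by simp
    show ?thesis unfolding E_eq[OF Z] using Z(1) by measurable
  qed
  have 1: "finite (Y \<union> Y')" "Y \<union> Y' \<noteq> {}" "Y \<union> Y' \<subseteq> LF1 M F" "0 < ?e" "0 < ?l" "?l < 1"
    using N(2-) N'(2-) by auto
  have "?N \<in> sigma_el_base M F"
    unfolding sigma_el_base_def mem_Collect_eq
    by (intro exI[of _ "Y \<union> Y'"] exI[of _ ?e] exI[of _ ?l] conjI refl 1)
  moreover have "?N \<subseteq> N \<inter> N'"
  proof
    fix x assume x: "x \<in> ?N"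
    then have x0: "x \<in> LFinf M F" and xm: "1 - ?l < measure M (?E x (Y \<union> Y') ?e)" by blast+
    have "?E x (Y \<union> Y') ?e \<subseteq> ?E x Y \<epsilon>"
      unfolding E_eq[OF 1(1,2)] E_eq[OF N(2,3)] by auto
    then have 2: "measure M (?E x (Y \<union> Y') ?e) \<le> measure M (?E x Y \<epsilon>)"
      by (rule finite_measure_mono[OF _ meas[OF N(2,3)]])
    have "?E x (Y \<union> Y') ?e \<subseteq> ?E x Y' \<epsilon>'"
      unfolding E_eq[OF 1(1,2)] E_eq[OF N'(2,3)] by auto
    then have 3: "measure M (?E x (Y \<union> Y') ?e) \<le> measure M (?E x Y' \<epsilon>')"
      by (rule finite_measure_mono[OF _ meas[OF N'(2,3)]])
    have "1 - \<delta> < measure M (?E x Y \<epsilon>)" "1 - \<delta>' < measure M (?E x Y' \<epsilon>')"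
      using xm 2 3 by linarith+
    with x0 show "x \<in> N \<inter> N'" unfolding N(1) N'(1) by blast
  qed
  ultimately show ?thesis by blast
qed

lemma prob_conv_base_directed:
  assumes "prob_space M" "subalgebra M F" "N \<in> prob_conv_base M F" "N' \<in> prob_conv_base M F"
  shows "\<exists>N''\<in>prob_conv_base M F. N'' \<subseteq> N \<inter> N'"
proof -
  interpret prob_space M by fact
  let ?E = "\<lambda>r (e::real). {\<omega> \<in> space M. \<bar>r \<omega> :: real\<bar> < e}"
  obtain \<epsilon> \<delta> where N: "N = {r \<in> L0 F. measure M (?E r \<epsilon>) > 1 - \<delta>}" "0 < \<epsilon>" "0 < \<delta>" "\<delta> < 1"
    using assms(3) unfolding prob_conv_base_def by blast
  obtain \<epsilon>' \<delta>' where N': "N' = {r \<in> L0 F. measure M (?E r \<epsilon>') > 1 - \<delta>'}" "0 < \<epsilon>'" "0 < \<delta>'" "\<delta>' < 1"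
    using assms(4) unfolding prob_conv_base_def by blast
  let ?e = "min \<epsilon> \<epsilon>'" and ?l = "min \<delta> \<delta>'"
  let ?N = "{r \<in> L0 F. measure M (?E r ?e) > 1 - ?l}"
  have meas: "?E r e \<in> sets M" if "r \<in> L0 F" for r e
  proof -
    have [measurable]: "r \<in> borel_measurable M"
      using measurable_from_subalg[OF assms(2)] that unfolding L0_def by blast
    show ?thesis by measurable
  qed
  have 1: "0 < ?e" "0 < ?l" "?l < 1"
    using N(2-) N'(2-) by auto
  have "?N \<in> prob_conv_base M F"
    unfolding prob_conv_base_def mem_Collect_eq
    by (intro exI[of _ ?e] exI[of _ ?l] conjI refl 1)
  moreover have "?N \<subseteq> N \<inter> N'"
  proof
    fix r assume r: "r \<in> ?N"
    then have r0: "r \<in> L0 F" and rm: "1 - ?l < measure M (?E r ?e)" by blast+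
    have 1: "measure M (?E r ?e) \<le> measure M (?E r \<epsilon>)"
      by (rule finite_measure_mono[OF _ meas[OF r0]]) auto
    have 2: "measure M (?E r ?e) \<le> measure M (?E r \<epsilon>')"
      by (rule finite_measure_mono[OF _ meas[OF r0]]) auto
    have "1 - \<delta> < measure M (?E r \<epsilon>)" "1 - \<delta>' < measure M (?E r \<epsilon>')"
      using rm 1 2 by linarith+
    with r0 show "r \<in> N \<inter> N'" unfolding N(1) N'(1) by blast
  qed
  ultimately show ?thesis by blast
qed

lemmas openin_sigma_c_topology =
  openin_local_base_topology[OF sigma_c_base_directed, folded sigma_c_topology_def]
lemmas openin_sigma_el_topology =
  openin_local_base_topology[OF sigma_el_base_directed, folded sigma_el_topology_def]
lemmas openin_prob_conv_topology =
  openin_local_base_topology[OF prob_conv_base_directed, folded prob_conv_topology_def]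

definition sigma_el_lsc :: "'a measure \<Rightarrow> 'a measure \<Rightarrow> (('a \<Rightarrow> real) \<Rightarrow> ('a \<Rightarrow> real)) \<Rightarrow> bool" where
  "sigma_el_lsc M F f \<longleftrightarrow>
     closedin (prod_topology (sigma_el_topology M F) (prob_conv_topology M F))
       {(x, r). x \<in> LFinf M F \<and> r \<in> L0 F \<and> (AE \<omega> in M. f x \<omega> \<le> r \<omega>)}"

definition sigma_c_lsc :: "'a measure \<Rightarrow> 'a measure \<Rightarrow> (('a \<Rightarrow> real) \<Rightarrow> ('a \<Rightarrow> real)) \<Rightarrow> bool" where
  "sigma_c_lsc M F f \<longleftrightarrow>
     (\<forall>r\<in>L0 F. closedin (sigma_c_topology M F) {x \<in> LFinf M F. AE \<omega> in M. f x \<omega> \<le> r \<omega>})"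

end

theory Submission
  imports Defs
begin

text \<open>
  For the dual representation, \<open>f\<close> is scalarised to \<open>x \<mapsto> E[f(x)]\<close>, whose acceptance set is convex,
  upward closed and closed under bounded almost sure limits. A rejected position has to be separated
  from this set by an element of \<open>L\<^sup>1\<close>. In place of the theorems of Hahn-Banach and
  Krein-Smulian, the separating functional is read off from first order conditions: a convex, smoothly penalised expectation has a
  minimiser over the acceptable positions bounded by \<open>n\<close>, its gradient there is a separating functional
  on these positions, and the gradients can be controlled in \<open>L\<^sup>1\<close> as \<open>n\<close> grows. Cash invariance turns
  the functional into a density \<open>y\<close>, and because \<open>f\<close> is local the supremum defining \<open>f\<^sup>*(y)\<close> is
  directed, so that \<open>E[f\<^sup>*(y)]\<close> is the scalar conjugate.

  The Lipschitz bound makes the extension local too, and elements of \<open>L\<^sup>\<infinity>\<^sub>F(E)\<close> are bounded on the sets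
  of an \<open>F\<close>-measurable exhaustion; this carries the representation over to the extension. Lower
  semicontinuity follows since the extension is an essential supremum of continuous functions.
  Conversely, a decreasing bounded sequence, stopped at an \<open>F\<close>-measurable time, enters any given
  neighbourhood of its limit.
\<close>

section \<open>Minimisation over convex sets of random variables\<close>

text \<open>The obstacle is that an acceptance set is closed only along sequences with a common
  bound. Minima therefore exist only over pieces bounded by a constant, and a functional that
  separates one piece may fail on the next. The separation has two stages for this reason. One
  integrable weight \<open>w\<close> is built whose integral against the positive part of every
  acceptable position is at least 1. The bound is doubled at each step. The correction of the weight
  sits where a minimiser exceeds the old bound \<open>n\<close>; a unit of mass there contributes at
  least \<open>n\<close>, so mass of order \<open>1 / n\<close> suffices, and these masses are
  summable. This integral is still not linear in the position. The second stage keeps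
  \<open>w\<close> and smooths the positive part: the gradients now have the form
  \<open>w * g\<close> with \<open>g\<close> between 0 and 1, whatever the bound on the positions,
  so one limiting \<open>g\<close> serves all bounds.\<close>

lemma (in prob_space) integrable_AE_bounded:
  fixes u :: "'a \<Rightarrow> real"
  assumes "u \<in> borel_measurable M" "AE p in M. \<bar>u p\<bar> \<le> B"
  shows "integrable M u"
  using integrable_const_bound[of u B] assms by auto

lemma (in prob_space) integrable_times_AE_bounded:
  fixes u w :: "'a \<Rightarrow> real"
  assumes "integrable M w" "u \<in> borel_measurable M" "AE p in M. \<bar>u p\<bar> \<le> B"
  shows "integrable M (\<lambda>p. w p * u p)"
proof (rule Bochner_Integration.integrable_bound[where f = "\<lambda>p. B * w p"])
  show "AE p in M. norm (w p * u p) \<le> norm (B * w p)"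
    using assms(3)
  proof eventually_elim
    case (elim p)
    then have "\<bar>w p\<bar> * \<bar>u p\<bar> \<le> \<bar>w p\<bar> * \<bar>B\<bar>" by (intro mult_left_mono) auto
    then show ?case by (simp add: abs_mult mult.commute)
  qed
qed (use assms in auto)

lemma (in prob_space) integral_times_tendsto:
  fixes w :: "'a \<Rightarrow> real"
  assumes w: "integrable M w" and x: "\<And>k. x k \<in> borel_measurable M" and g: "g \<in> borel_measurable M"
    and bnd: "\<And>k. AE p in M. \<bar>x k p\<bar> \<le> B" and lim: "AE p in M. (\<lambda>k. x k p) \<longlonglongrightarrow> g p"
  shows "(\<lambda>k. \<integral>p. w p * x k p \<partial>M) \<longlonglongrightarrow> (\<integral>p. w p * g p \<partial>M)"
proof (rule integral_dominated_convergence[where w = "\<lambda>p. B * \<bar>w p\<bar>"])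
  show "AE p in M. (\<lambda>k. w p * x k p) \<longlonglongrightarrow> w p * g p"
    using lim by eventually_elim (rule tendsto_mult_left)
  show "AE p in M. norm (w p * x k p) \<le> B * \<bar>w p\<bar>" for k
    using bnd[of k]
  proof eventually_elim
    case (elim p)
    then have "\<bar>w p\<bar> * \<bar>x k p\<bar> \<le> \<bar>w p\<bar> * B" by (intro mult_left_mono) auto
    then show ?case by (simp add: abs_mult mult.commute)
  qed
qed (use assms in auto)

lemma AE_abs_le_limit:
  fixes x :: "nat \<Rightarrow> 'a \<Rightarrow> real"
  assumes "\<And>k. AE p in M. \<bar>x k p\<bar> \<le> B" and "AE p in M. (\<lambda>k. x k p) \<longlonglongrightarrow> g p"
  shows "AE p in M. \<bar>g p\<bar> \<le> B"
proof -
  have "AE p in M. \<forall>k. \<bar>x k p\<bar> \<le> B" using assms(1) by (simp add: AE_all_countable)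
  with assms(2) show ?thesis
  proof eventually_elim
    case (elim p)
    show ?case by (rule tendsto_upperbound[OF tendsto_rabs[OF elim(1)]]) (use elim(2) in auto)
  qed
qed

text \<open>A substitute for weak compactness: near-minimisers of the $L^2$ norm form a Cauchy sequence by
  the parallelogram law.\<close>

lemma (in prob_space) decreasing_convex_sets_limit:
  fixes C :: "nat \<Rightarrow> ('a \<Rightarrow> real) set"
  assumes ne: "\<And>k. C k \<noteq> {}" and dec: "decseq C"
    and meas: "\<And>k u. u \<in> C k \<Longrightarrow> u \<in> borel_measurable M"
    and bnd: "\<And>k u. u \<in> C k \<Longrightarrow> AE p in M. \<bar>u p\<bar> \<le> B"
    and mid: "\<And>k u v. u \<in> C k \<Longrightarrow> v \<in> C k \<Longrightarrow> (\<lambda>p. (u p + v p) / 2) \<in> C k"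
  obtains x g where "\<And>k::nat. x k \<in> C k" "g \<in> borel_measurable M" "AE p in M. \<bar>g p\<bar> \<le> B"
    "AE p in M. (\<lambda>k. x k p) \<longlonglongrightarrow> g p"
proof -
  define Q where "Q u = (\<integral>p. (u p)\<^sup>2 \<partial>M)" for u :: "'a \<Rightarrow> real"
  define m where "m k = Inf (Q ` C k)" for k
  have Q0: "0 \<le> Q u" for u unfolding Q_def by simp
  have bdd: "bdd_below (Q ` S)" for S by (rule bdd_belowI2[of _ 0]) (rule Q0)
  have int1: "integrable M u" if "u \<in> C k" for u k
    by (rule integrable_AE_bounded[OF meas[OF that] bnd[OF that]])
  have int: "integrable M (\<lambda>p. u p * v p)" if "u \<in> C k" "v \<in> C l" for u v k l
    by (rule integrable_times_AE_bounded[OF int1[OF that(1)] meas[OF that(2)] bnd[OF that(2)]])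
  have int2: "integrable M (\<lambda>p. (u p)\<^sup>2)" if "u \<in> C k" for u k
    using int[OF that that] by (simp add: power2_eq_square)
  have QB: "Q u \<le> B\<^sup>2" if "u \<in> C k" for u k
  proof -
    have "Q u \<le> (\<integral>p. B\<^sup>2 \<partial>M)" unfolding Q_def
    proof (rule integral_mono_AE)
      show "AE p in M. (u p)\<^sup>2 \<le> B\<^sup>2" using bnd[OF that]
        by eventually_elim (metis abs_ge_zero power2_abs power_mono)
    qed (use int2[OF that] in auto)
    then show ?thesis by (simp add: prob_space)
  qed
  have m_le: "m k \<le> Q u" if "u \<in> C k" for u k
    unfolding m_def by (rule cInf_lower) (use that bdd in auto)
  have mB: "m k \<le> B\<^sup>2" for k using ne[of k] m_le QB by (metis all_not_in_conv order_trans)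
  \<comment> \<open>The infima increase because the sets shrink, and they stay below
    \<open>B\<^sup>2\<close>. Their limit \<open>ml\<close> makes the distance estimate below tend
    to 0.\<close>
  have "incseq m"
    unfolding incseq_def m_def
    by (intro allI impI cInf_superset_mono image_mono) (use ne bdd dec in \<open>auto simp: decseq_def\<close>)
  then obtain ml where ml: "m \<longlonglongrightarrow> ml" "\<And>k. m k \<le> ml"
    using incseq_convergent[of m "B\<^sup>2"] mB by auto
  have "\<exists>u\<in>C k. Q u \<le> m k + 1 / (real k + 1)" for k
  proof -
    have "Inf (Q ` C k) < m k + 1 / (real k + 1)" unfolding m_def by simp
    then obtain q where "q \<in> Q ` C k" "q < m k + 1 / (real k + 1)"
      using cInf_lessD[of "Q ` C k"] ne[of k] by blast
    then show ?thesis by (auto intro!: less_imp_le)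
  qed
  then obtain x where x: "\<And>k. x k \<in> C k" "\<And>k. Q (x k) \<le> m k + 1 / (real k + 1)" by metis
  have sub: "C l \<subseteq> C k" if "k \<le> l" for k l using dec that by (auto simp: decseq_def)
  \<comment> \<open>For \<open>k \<le> l\<close> both points lie in \<open>C k\<close>, so
    \<open>Q\<close> of their midpoint is at least \<open>m k\<close>, while \<open>Q (x k)\<close>
    and \<open>Q (x l)\<close> exceed \<open>m k\<close> and \<open>m l\<close> by little.\<close>
  have cau: "Q (\<lambda>p. x k p - x l p) \<le> 2 * (ml - m k) + 4 / (real k + 1)" if "k \<le> l" for k l
  proof -
    have xl: "x l \<in> C k" using sub[OF that] x by auto
    note i = int2[OF x(1)[of k]] int2[OF xl] int[OF x(1)[of k] xl]
    have "m k \<le> Q (\<lambda>p. (x k p + x l p) / 2)" by (rule m_le[OF mid[OF x(1) xl]])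
    also have "\<dots> = (\<integral>p. (x k p)\<^sup>2 / 4 + (x l p)\<^sup>2 / 4 + (x k p * x l p) / 2 \<partial>M)"
      unfolding Q_def by (rule Bochner_Integration.integral_cong) (auto simp: power2_eq_square field_simps)
    also have "\<dots> = Q (x k) / 4 + Q (x l) / 4 + (\<integral>p. x k p * x l p \<partial>M) / 2"
      using i by (simp add: Q_def)
    finally have 1: "m k \<le> Q (x k) / 4 + Q (x l) / 4 + (\<integral>p. x k p * x l p \<partial>M) / 2" .
    have "Q (\<lambda>p. x k p - x l p) = (\<integral>p. (x k p)\<^sup>2 + (x l p)\<^sup>2 - 2 * (x k p * x l p) \<partial>M)"
      unfolding Q_def by (rule Bochner_Integration.integral_cong) (auto simp: power2_eq_square field_simps)
    also have "\<dots> = Q (x k) + Q (x l) - 2 * (\<integral>p. x k p * x l p \<partial>M)"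
      using i by (simp add: Q_def)
    finally have 2: "Q (\<lambda>p. x k p - x l p) = Q (x k) + Q (x l) - 2 * (\<integral>p. x k p * x l p \<partial>M)" .
    have "1 / (real l + 1) \<le> 1 / (real k + 1)" using that by (simp add: frac_le)
    then show ?thesis using 1 2 x(2)[of k] x(2)[of l] ml(2)[of l] ml(2)[of k] by simp
  qed
  have L1: "\<exists>N. \<forall>i\<ge>N. \<forall>j\<ge>N. (\<integral>p. norm (x i p - x j p) \<partial>M) < e" if e: "0 < e" for e
  proof -
    have "(\<lambda>k. 2 * (ml - m k) + 4 * (1 / (real k + 1))) \<longlonglongrightarrow> 2 * (ml - ml) + 4 * 0"
      using LIMSEQ_inverse_real_of_nat by (intro tendsto_intros ml(1)) (simp add: inverse_eq_divide add.commute)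
    then have "\<forall>\<^sub>F k in sequentially. 2 * (ml - m k) + 4 * (1 / (real k + 1)) < e\<^sup>2"
      by (rule order_tendstoD) (use e in simp)
    then obtain N where N: "\<And>k. k \<ge> N \<Longrightarrow> 2 * (ml - m k) + 4 * (1 / (real k + 1)) < e\<^sup>2"
      by (auto simp: eventually_sequentially)
    have le: "(\<integral>p. norm (x i p - x j p) \<partial>M) < e" if "i \<ge> N" "i \<le> j" for i j
    proof -
      have xj: "x j \<in> C i" using sub[OF that(2)] x by auto
      have i1: "integrable M (\<lambda>p. x i p - x j p)"
        by (intro Bochner_Integration.integrable_diff int1[OF x(1)])
      have "integrable M (\<lambda>p. (x i p)\<^sup>2 + (x j p)\<^sup>2 - 2 * (x i p * x j p))"
        using int2[OF x(1)] int[OF x(1) x(1)] by simp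
      then have i2: "integrable M (\<lambda>p. (x i p - x j p)\<^sup>2)"
        by (rule Bochner_Integration.integrable_cong[THEN iffD1, OF refl, rotated]) (auto simp: power2_eq_square field_simps)
      \<comment> \<open>Nonnegativity of the variance serves as the Cauchy-Schwarz inequality; it
        passes from L^2 to L^1, where Cauchy sequences have subsequences that are Cauchy
        a.e.\<close>
      have "(\<integral>p. norm (x i p - x j p) \<partial>M)\<^sup>2 \<le> (\<integral>p. (norm (x i p - x j p))\<^sup>2 \<partial>M)"
        using variance_positive[of "\<lambda>p. norm (x i p - x j p)"] i1 i2 by (subst (asm) variance_eq) auto
      then have "(\<integral>p. norm (x i p - x j p) \<partial>M)\<^sup>2 < e\<^sup>2"
        using cau[OF that(2)] N[OF that(1)] by (simp add: Q_def)
      then show ?thesis using e by (simp add: power2_less_imp_less)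
    qed
    show ?thesis
    proof (intro exI[of _ N] allI impI)
      fix i j assume ij: "N \<le> i" "N \<le> j"
      show "(\<integral>p. norm (x i p - x j p) \<partial>M) < e"
      proof (cases "i \<le> j")
        case False
        with le[OF ij(2), of i] show ?thesis by (simp add: abs_minus_commute)
      qed (rule le[OF ij(1)])
    qed
  qed
  obtain r where r: "strict_mono r" "AE p in M. Cauchy (\<lambda>k. x (r k) p)"
    by (rule cauchy_L1_AE_cauchy_subseq[of M x, OF _ L1])
      (use int1 x in auto)
  define g where "g p = lim (\<lambda>k. x (r k) p)" for p
  have "x (r k) \<in> borel_measurable M" for k using x meas by blast
  then have [measurable]: "g \<in> borel_measurable M" unfolding g_def by measurable
  have lim: "AE p in M. (\<lambda>k. x (r k) p) \<longlonglongrightarrow> g p"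
    using r(2) by eventually_elim (unfold g_def, rule convergent_LIMSEQ_iff[THEN iffD1, OF Cauchy_convergent])
  \<comment> \<open>\<open>r k\<close> is at least \<open>k\<close>, so the subsequence still meets
    the shrinking sets at the right index.\<close>
  have xr: "x (r k) \<in> C k" for k using sub[OF strict_mono_imp_increasing[OF r(1), of k]] x by auto
  show ?thesis
    by (rule that[of "\<lambda>k. x (r k)" g]) (use xr lim AE_abs_le_limit[OF bnd[OF xr] lim] in auto)
qed

text \<open>The sublevel sets of \<open>J\<close> at \<open>I + 1 / (k + 1)\<close> are nonempty,
  decreasing and midpoint convex, so the preceding lemma selects points of them that converge a.e.
  The assumption \<open>closed\<close> keeps the limit in \<open>K\<close> and carries the values of
  \<open>J\<close> over to it.\<close>

lemma (in prob_space) infimum_attained: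
  fixes J :: "('a \<Rightarrow> real) \<Rightarrow> real"
  assumes meas: "\<And>u. u \<in> K \<Longrightarrow> u \<in> borel_measurable M"
    and bnd: "\<And>u. u \<in> K \<Longrightarrow> AE p in M. \<bar>u p\<bar> \<le> B"
    and mid: "\<And>u v. u \<in> K \<Longrightarrow> v \<in> K \<Longrightarrow>
      (\<lambda>p. (u p + v p) / 2) \<in> K \<and> J (\<lambda>p. (u p + v p) / 2) \<le> (J u + J v) / 2"
    and closed: "\<And>x g. (\<And>k::nat. x k \<in> K) \<Longrightarrow> g \<in> borel_measurable M \<Longrightarrow>
      AE p in M. (\<lambda>k. x k p) \<longlonglongrightarrow> g p \<Longrightarrow> g \<in> K \<and> (\<lambda>k. J (x k)) \<longlonglongrightarrow> J g"
    and approx: "\<And>e. 0 < e \<Longrightarrow> \<exists>u\<in>K. J u \<le> I + e"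
  obtains g where "g \<in> K" "J g \<le> I"
proof -
  define C where "C k = {u \<in> K. J u \<le> I + 1 / (real k + 1)}" for k
  have ne: "C k \<noteq> {}" for k using approx[of "1 / (real k + 1)"] by (auto simp: C_def)
  have dec: "decseq C"
  proof (unfold decseq_def, intro allI impI subsetI)
    fix k k' u assume "k \<le> k'" "u \<in> C k'"
    moreover have "1 / (real k' + 1) \<le> 1 / (real k + 1)" using \<open>k \<le> k'\<close> by (simp add: frac_le)
    ultimately show "u \<in> C k" unfolding C_def by auto
  qed
  have "(\<lambda>p. (u p + v p) / 2) \<in> C k" if "u \<in> C k" "v \<in> C k" for u v k
    using that mid[of u v] by (auto simp: C_def)
  then obtain x g where x: "\<And>k. x k \<in> C k" and g: "g \<in> borel_measurable M"
    and lim: "AE p in M. (\<lambda>k. x k p) \<longlonglongrightarrow> g p"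
    by (rule decreasing_convex_sets_limit[OF ne dec, rotated 2, of B]) (use meas bnd in \<open>auto simp: C_def\<close>)
  have "x k \<in> K" for k using x by (auto simp: C_def)
  from closed[OF this g lim] have gK: "g \<in> K" and J: "(\<lambda>k. J (x k)) \<longlonglongrightarrow> J g" by auto
  have "(\<lambda>k. I + 1 / (real k + 1)) \<longlonglongrightarrow> I + 0"
    using LIMSEQ_inverse_real_of_nat by (intro tendsto_intros) (simp add: inverse_eq_divide add.commute)
  with J have "J g \<le> I + 0"
    by (rule LIMSEQ_le) (use x in \<open>auto simp: C_def\<close>)
  with gK show ?thesis by (intro that) auto
qed

lemma linear_bound_nonneg:
  fixes D R :: real
  assumes "\<And>t. 0 < t \<Longrightarrow> t \<le> 1 \<Longrightarrow> 0 \<le> D + t * R"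
  shows "0 \<le> D"
proof (rule ccontr)
  assume "\<not> 0 \<le> D"
  \<comment> \<open>With this choice \<open>t * (\<bar>R\<bar> - D)\<close> is
    \<open>- D / 2\<close>, so \<open>D + t * R\<close> would be at most \<open>D / 2\<close>, which
    is negative.\<close>
  define t where "t = - D / (2 * (\<bar>R\<bar> - D))"
  have pos: "0 < \<bar>R\<bar> - D" using \<open>\<not> 0 \<le> D\<close> by simp
  have t: "0 < t" "t \<le> 1" using \<open>\<not> 0 \<le> D\<close> pos by (auto simp: t_def field_simps)
  have "t * R \<le> t * (\<bar>R\<bar> - D)" using t \<open>\<not> 0 \<le> D\<close> by (intro mult_left_mono) auto
  also have "\<dots> = - D / 2" using pos by (simp add: t_def field_simps)
  finally show False using assms[OF t] \<open>\<not> 0 \<le> D\<close> by simp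
qed

text \<open>\<open>\<psi>\<close> acts as the derivative of the convex function
  \<open>\<phi>\<close>. The subgradient inequality \<open>sub\<close> gives midpoint convexity and
  with it a minimiser \<open>z\<close>. On the segment from \<open>z\<close> to \<open>u\<close> the
  bound \<open>quad\<close> makes the remainder of the linear expansion quadratic in
  \<open>t\<close>, which takes the place of differentiation under the integral; dividing by
  \<open>t\<close> leaves the variational inequality.\<close>

lemma (in prob_space) first_order_minimizer:
  fixes \<phi> \<psi> :: "real \<Rightarrow> real" and l w :: "'a \<Rightarrow> real" and K :: "('a \<Rightarrow> real) set"
  defines "J \<equiv> \<lambda>u. (\<integral>p. l p * u p \<partial>M) + (\<integral>p. w p * \<phi> (u p) \<partial>M)"
  assumes ne: "K \<noteq> {}"
    and meas: "\<And>u. u \<in> K \<Longrightarrow> u \<in> borel_measurable M"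
    and bnd: "\<And>u. u \<in> K \<Longrightarrow> AE p in M. \<bar>u p\<bar> \<le> B"
    and conv: "\<And>u v t. u \<in> K \<Longrightarrow> v \<in> K \<Longrightarrow> 0 \<le> t \<Longrightarrow> t \<le> 1 \<Longrightarrow> (\<lambda>p. (1 - t) * u p + t * v p) \<in> K"
    and closed: "\<And>x g. (\<And>k::nat. x k \<in> K) \<Longrightarrow> g \<in> borel_measurable M \<Longrightarrow>
      AE p in M. (\<lambda>k. x k p) \<longlonglongrightarrow> g p \<Longrightarrow> g \<in> K"
    and l: "integrable M l" and w: "integrable M w" "AE p in M. 0 \<le> w p"
    and cont: "continuous_on UNIV \<phi>" "continuous_on UNIV \<psi>"
    and nonneg: "\<And>a. 0 \<le> \<phi> a"
    and sub: "\<And>a b. \<phi> a + \<psi> a * (b - a) \<le> \<phi> b"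
    and quad: "\<And>a b. \<phi> b \<le> \<phi> a + \<psi> a * (b - a) + L * (b - a)\<^sup>2"
  obtains z where "z \<in> K" "\<forall>u\<in>K. J z \<le> J u"
    "\<forall>u\<in>K. 0 \<le> (\<integral>p. (l p + w p * \<psi> (z p)) * (u p - z p) \<partial>M)"
proof -
  have [measurable]: "\<phi> \<in> borel_measurable borel" "\<psi> \<in> borel_measurable borel"
    using cont by (auto intro: borel_measurable_continuous_onI)
  have bdd: "\<exists>C. \<forall>a. \<bar>a\<bar> \<le> B \<longrightarrow> \<bar>h a\<bar> \<le> C" if "continuous_on UNIV h" for h :: "real \<Rightarrow> real"
  proof -
    have "bounded (h ` {-B..B})"
      by (intro compact_imp_bounded compact_continuous_image continuous_on_subset[OF that]) auto
    then obtain C where C: "\<And>y. y \<in> h ` {-B..B} \<Longrightarrow> norm y \<le> C"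
      unfolding bounded_iff by blast
    show ?thesis
    proof (intro exI allI impI)
      fix a :: real assume "\<bar>a\<bar> \<le> B"
      then have "a \<in> {-B..B}" by auto
      then show "\<bar>h a\<bar> \<le> C" using C[of "h a"] by auto
    qed
  qed
  from bdd[OF cont(1)] bdd[OF cont(2)] obtain C\<phi> C\<psi>
    where C: "\<forall>a. \<bar>a\<bar> \<le> B \<longrightarrow> \<bar>\<phi> a\<bar> \<le> C\<phi>" "\<forall>a. \<bar>a\<bar> \<le> B \<longrightarrow> \<bar>\<psi> a\<bar> \<le> C\<psi>"
    by (elim exE)
  have phi_bnd: "AE p in M. \<bar>\<phi> (u p)\<bar> \<le> C\<phi>" if "u \<in> K" for u
    using bnd[OF that] by eventually_elim (simp add: C)
  have psi_bnd: "AE p in M. \<bar>\<psi> (u p)\<bar> \<le> C\<psi>" if "u \<in> K" for u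
    using bnd[OF that] by eventually_elim (simp add: C)
  have phi_meas: "(\<lambda>p. \<phi> (u p)) \<in> borel_measurable M"
    and psi_meas: "(\<lambda>p. \<psi> (u p)) \<in> borel_measurable M" if "u \<in> K" for u
    using meas[OF that] by measurable
  have il: "integrable M (\<lambda>p. l p * u p)" if "u \<in> K" for u
    by (rule integrable_times_AE_bounded[OF l meas[OF that] bnd[OF that]])
  have iphi: "integrable M (\<lambda>p. w p * \<phi> (u p))" if "u \<in> K" for u
    by (rule integrable_times_AE_bounded[OF w(1) phi_meas[OF that] phi_bnd[OF that]])
  have ipsi: "integrable M (\<lambda>p. w p * \<psi> (u p))" if "u \<in> K" for u
    by (rule integrable_times_AE_bounded[OF w(1) psi_meas[OF that] psi_bnd[OF that]])
  have J_low: "- (\<integral>p. \<bar>l p\<bar> * B \<partial>M) \<le> J u" if "u \<in> K" for u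
  proof -
    have "(\<integral>p. - (\<bar>l p\<bar> * B) \<partial>M) \<le> (\<integral>p. l p * u p \<partial>M)"
    proof (rule integral_mono_AE)
      show "AE p in M. - (\<bar>l p\<bar> * B) \<le> l p * u p" using bnd[OF that]
      proof eventually_elim
        case (elim p)
        then have "\<bar>l p\<bar> * \<bar>u p\<bar> \<le> \<bar>l p\<bar> * B" by (intro mult_left_mono) auto
        then show ?case using abs_ge_minus_self[of "l p * u p"] by (simp add: abs_mult)
      qed
    qed (use l il[OF that] in auto)
    moreover have "0 \<le> (\<integral>p. w p * \<phi> (u p) \<partial>M)"
      using w(2) by (intro integral_nonneg_AE) (auto simp: nonneg)
    ultimately show ?thesis unfolding J_def by simp
  qed
  define I where "I = Inf (J ` K)"
  have bb: "bdd_below (J ` K)" by (rule bdd_belowI2[OF J_low])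
  have I_le: "I \<le> J u" if "u \<in> K" for u
    unfolding I_def by (rule cInf_lower) (use that bb in auto)
  have approx: "\<exists>u\<in>K. J u \<le> I + e" if "0 < e" for e
    using cInf_lessD[of "J ` K" "I + e"] ne that by (auto simp: I_def intro: less_imp_le)
  have mid: "(\<lambda>p. (u p + v p) / 2) \<in> K \<and> J (\<lambda>p. (u p + v p) / 2) \<le> (J u + J v) / 2"
    if uvK: "u \<in> K" "v \<in> K" for u v
  proof -
    have mK: "(\<lambda>p. (u p + v p) / 2) \<in> K"
      using conv[OF uvK, of "1/2"] by (simp add: field_simps)
    have "(\<integral>p. w p * \<phi> ((u p + v p) / 2) \<partial>M) \<le> (\<integral>p. (w p * \<phi> (u p) + w p * \<phi> (v p)) / 2 \<partial>M)"
    proof (rule integral_mono_AE)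
      show "AE p in M. w p * \<phi> ((u p + v p) / 2) \<le> (w p * \<phi> (u p) + w p * \<phi> (v p)) / 2"
        using w(2)
      proof eventually_elim
        case (elim p)
        define m where "m = (u p + v p) / 2"
        have "\<phi> m + \<psi> m * (u p - m) \<le> \<phi> (u p)" "\<phi> m + \<psi> m * (v p - m) \<le> \<phi> (v p)" by (rule sub)+
        moreover have "\<psi> m * (u p - m) + \<psi> m * (v p - m) = 0"
          unfolding distrib_left[symmetric] m_def by simp
        ultimately have "\<phi> m \<le> (\<phi> (u p) + \<phi> (v p)) / 2" by simp
        then have "w p * \<phi> m \<le> w p * ((\<phi> (u p) + \<phi> (v p)) / 2)" by (rule mult_left_mono[OF _ elim])
        then show ?case by (simp add: m_def distrib_left)
      qed
    qed (use iphi[OF mK] iphi[OF uvK(1)] iphi[OF uvK(2)] in auto)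
    also have "\<dots> = ((\<integral>p. w p * \<phi> (u p) \<partial>M) + (\<integral>p. w p * \<phi> (v p) \<partial>M)) / 2"
      using iphi[OF uvK(1)] iphi[OF uvK(2)] by simp
    finally have 1: "(\<integral>p. w p * \<phi> ((u p + v p) / 2) \<partial>M) \<le> \<dots>" .
    have "(\<integral>p. l p * ((u p + v p) / 2) \<partial>M) = (\<integral>p. (l p * u p + l p * v p) / 2 \<partial>M)"
      by (simp add: distrib_left)
    also have "\<dots> = ((\<integral>p. l p * u p \<partial>M) + (\<integral>p. l p * v p \<partial>M)) / 2"
      using il[OF uvK(1)] il[OF uvK(2)] by simp
    finally have "J (\<lambda>p. (u p + v p) / 2) \<le> (J u + J v) / 2" using 1 by (simp add: J_def field_simps)
    then show ?thesis using mK by blast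
  qed
  have J_cont: "g \<in> K \<and> (\<lambda>k. J (x k)) \<longlonglongrightarrow> J g"
    if xK: "\<And>k::nat. x k \<in> K" and g: "g \<in> borel_measurable M" and lim: "AE p in M. (\<lambda>k. x k p) \<longlonglongrightarrow> g p" for x g
  proof
    show gK: "g \<in> K" by (rule closed[OF xK g lim])
    have "AE p in M. (\<lambda>k. \<phi> (x k p)) \<longlonglongrightarrow> \<phi> (g p)"
      using lim by eventually_elim (rule continuous_on_tendsto_compose[OF cont(1)], auto)
    then show "(\<lambda>k. J (x k)) \<longlonglongrightarrow> J g"
      unfolding J_def
      by (intro tendsto_add integral_times_tendsto[OF l meas[OF xK] g bnd[OF xK] lim]
          integral_times_tendsto[OF w(1) phi_meas[OF xK] phi_meas[OF gK] phi_bnd[OF xK]])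
  qed
  obtain z where z: "z \<in> K" and zI: "J z \<le> I"
    by (rule infimum_attained[OF meas bnd mid J_cont approx])
  have [measurable]: "z \<in> borel_measurable M" by (rule meas[OF z])
  have min: "J z \<le> J u" if "u \<in> K" for u using zI I_le[OF that] by simp
  have first: "0 \<le> (\<integral>p. (l p + w p * \<psi> (z p)) * (u p - z p) \<partial>M)" if u: "u \<in> K" for u
  proof (rule linear_bound_nonneg)
    fix t :: real assume t: "0 < t" "t \<le> 1"
    define v where "v p = (1 - t) * z p + t * u p" for p
    have v: "v \<in> K" unfolding v_def using conv[OF z u] t by simp
    have [measurable]: "u \<in> borel_measurable M" by (rule meas[OF u])
    have d_bnd: "AE p in M. \<bar>u p - z p\<bar> \<le> 2 * B"
      using bnd[OF u] bnd[OF z] by eventually_elim simp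
    then have d2_bnd: "AE p in M. \<bar>(u p - z p)\<^sup>2\<bar> \<le> (2 * B)\<^sup>2"
    proof eventually_elim
      case (elim p)
      then have "\<bar>u p - z p\<bar>\<^sup>2 \<le> (2 * B)\<^sup>2" by (rule power_mono) simp
      then show ?case by simp
    qed
    have i1: "integrable M (\<lambda>p. (l p + w p * \<psi> (z p)) * (u p - z p))"
      by (rule integrable_times_AE_bounded[OF _ _ d_bnd]) (use l ipsi[OF z] in auto)
    have i2: "integrable M (\<lambda>p. w p * (u p - z p)\<^sup>2)"
      by (rule integrable_times_AE_bounded[OF w(1) _ d2_bnd]) simp
    have "J z \<le> J v" by (rule min[OF v])
    also have "J v = (\<integral>p. l p * v p + w p * \<phi> (v p) \<partial>M)"
      unfolding J_def using il[OF v] iphi[OF v] by simp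
    also have "\<dots> \<le> (\<integral>p. (l p * z p + w p * \<phi> (z p)) + t * ((l p + w p * \<psi> (z p)) * (u p - z p))
        + (t * t * L) * (w p * (u p - z p)\<^sup>2) \<partial>M)"
    proof (rule integral_mono_AE)
      show "AE p in M. l p * v p + w p * \<phi> (v p) \<le> (l p * z p + w p * \<phi> (z p))
        + t * ((l p + w p * \<psi> (z p)) * (u p - z p)) + (t * t * L) * (w p * (u p - z p)\<^sup>2)"
        using w(2)
      proof eventually_elim
        case (elim p)
        have vz: "v p = z p + t * (u p - z p)" by (simp add: v_def algebra_simps)
        have "w p * \<phi> (v p) \<le> w p * (\<phi> (z p) + \<psi> (z p) * (v p - z p) + L * (v p - z p)\<^sup>2)"
          by (rule mult_left_mono[OF quad elim])
        then show ?case unfolding vz by (simp add: algebra_simps power2_eq_square)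
      qed
    qed (use i1 i2 il[OF z] iphi[OF z] il[OF v] iphi[OF v] in auto)
    also have "\<dots> = J z + t * (\<integral>p. (l p + w p * \<psi> (z p)) * (u p - z p) \<partial>M)
        + (t * t * L) * (\<integral>p. w p * (u p - z p)\<^sup>2 \<partial>M)"
      unfolding J_def using i1 i2 il[OF z] iphi[OF z] by simp
    finally have "0 \<le> t * ((\<integral>p. (l p + w p * \<psi> (z p)) * (u p - z p) \<partial>M)
        + t * (L * (\<integral>p. w p * (u p - z p)\<^sup>2 \<partial>M)))" by (simp add: algebra_simps)
    then show "0 \<le> (\<integral>p. (l p + w p * \<psi> (z p)) * (u p - z p) \<partial>M)
        + t * (L * (\<integral>p. w p * (u p - z p)\<^sup>2 \<partial>M))" using t(1) by (simp add: zero_le_mult_iff)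
  qed
  show ?thesis by (rule that[OF z]) (use min first in auto)
qed

section \<open>Separation from acceptance sets\<close>

text \<open>The constant \<open>c\<close> keeps the set nonempty and sets the scale:
  \<open>upward\<close> and \<open>zero\<close> force it to be positive. The axiom
  \<open>closed\<close> is the condition that a Krein-Smulian theorem would turn into weak-star
  closedness.\<close>

locale acceptance_set = prob_space M for M :: "'a measure" +
  fixes A :: "('a \<Rightarrow> real) set" and c :: real
  assumes bounded: "A \<subseteq> Linf M M"
    and convex: "x \<in> A \<Longrightarrow> y \<in> A \<Longrightarrow> 0 \<le> t \<Longrightarrow> t \<le> 1 \<Longrightarrow> (\<lambda>p. (1 - t) * x p + t * y p) \<in> A"
    and upward: "x \<in> A \<Longrightarrow> y \<in> Linf M M \<Longrightarrow> AE p in M. x p \<le> y p \<Longrightarrow> y \<in> A"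
    and closed: "(\<And>k::nat. X k \<in> A) \<Longrightarrow> (\<And>k. AE p in M. \<bar>X k p\<bar> \<le> C) \<Longrightarrow> x \<in> borel_measurable M \<Longrightarrow>
      AE p in M. (\<lambda>k. X k p) \<longlonglongrightarrow> x p \<Longrightarrow> x \<in> A"
    and const: "(\<lambda>_. c) \<in> A"
    and zero: "(\<lambda>_. 0) \<notin> A"
begin

text \<open>The upper bound makes the minimisation lemmas applicable; the lower bound 0 makes
  integrals against nonnegative weights nonnegative.\<close>

definition U :: "real \<Rightarrow> ('a \<Rightarrow> real) set" where
  "U n = {u \<in> A. AE p in M. 0 \<le> u p \<and> u p \<le> n}"

lemma meas: "u \<in> A \<Longrightarrow> u \<in> borel_measurable M"
  using bounded by (auto simp: Linf_def L0_def)

lemma not_nonpos: "u \<in> A \<Longrightarrow> \<not> (AE p in M. u p \<le> 0)"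
  using upward[of u "\<lambda>_. 0"] zero by (auto simp: Linf_def L0_def)

lemma c_pos: "0 < c"
  using not_nonpos[OF const] by (simp add: AE_const prob_space not_le)

lemma U_A: "u \<in> U n \<Longrightarrow> u \<in> A" by (simp add: U_def)

lemma U_meas: "u \<in> U n \<Longrightarrow> u \<in> borel_measurable M" by (simp add: U_def meas)

lemma U_nonneg: "u \<in> U n \<Longrightarrow> AE p in M. 0 \<le> u p" by (auto simp: U_def)

lemma U_bnd: "u \<in> U n \<Longrightarrow> AE p in M. \<bar>u p\<bar> \<le> n" by (auto simp: U_def)

lemma U_const: "c \<le> n \<Longrightarrow> (\<lambda>_. c) \<in> U n"
  using const c_pos by (simp add: U_def)

lemma U_convex:
  assumes "u \<in> U n" "v \<in> U n" "0 \<le> t" "t \<le> 1"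
  shows "(\<lambda>p. (1 - t) * u p + t * v p) \<in> U n"
proof -
  have "AE p in M. 0 \<le> u p \<and> u p \<le> n" "AE p in M. 0 \<le> v p \<and> v p \<le> n"
    using assms by (auto simp: U_def)
  then have "AE p in M. 0 \<le> (1 - t) * u p + t * v p \<and> (1 - t) * u p + t * v p \<le> n"
  proof eventually_elim
    case (elim p)
    have "(1 - t) * u p + t * v p \<le> (1 - t) * n + t * n"
      using elim assms by (intro add_mono mult_left_mono) auto
    moreover have "0 \<le> (1 - t) * u p + t * v p" using elim assms by simp
    ultimately show ?case by (simp add: algebra_simps)
  qed
  then show ?thesis using assms convex by (simp add: U_def)
qed

lemma U_closed:
  assumes "\<And>k::nat. x k \<in> U n" "g \<in> borel_measurable M" "AE p in M. (\<lambda>k. x k p) \<longlonglongrightarrow> g p"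
  shows "g \<in> U n"
proof -
  have "g \<in> A" by (rule closed[OF U_A[OF assms(1)] U_bnd[OF assms(1)] assms(2,3)])
  have "AE p in M. \<forall>k. 0 \<le> x k p \<and> x k p \<le> n"
    using assms(1) by (auto simp: AE_all_countable U_def)
  with assms(3) have "AE p in M. 0 \<le> g p \<and> g p \<le> n"
    by eventually_elim (auto intro: tendsto_lowerbound tendsto_upperbound)
  then show ?thesis using \<open>g \<in> A\<close> by (simp add: U_def)
qed

lemma U_integrable: "integrable M w \<Longrightarrow> u \<in> U n \<Longrightarrow> integrable M (\<lambda>p. w p * u p)"
  by (rule integrable_times_AE_bounded[OF _ U_meas U_bnd])

lemma U_integral_nonneg:
  assumes "\<And>p. 0 \<le> w p" "u \<in> U n"
  shows "0 \<le> (\<integral>p. w p * u p \<partial>M)"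
  using U_nonneg[OF assms(2)] by (intro integral_nonneg_AE) (auto simp: assms(1))

lemma U_mid: "u \<in> U n \<Longrightarrow> v \<in> U n \<Longrightarrow> (\<lambda>p. (u p + v p) / 2) \<in> U n"
  using U_convex[of u n v "1/2"] by (simp add: field_simps)

lemma U_mid_integral_le:
  assumes "integrable M w" "u \<in> U n" "v \<in> U n"
  shows "(\<lambda>p. (u p + v p) / 2) \<in> U n \<and>
    (\<integral>p. w p * ((u p + v p) / 2) \<partial>M) \<le> ((\<integral>p. w p * u p \<partial>M) + (\<integral>p. w p * v p \<partial>M)) / 2"
  using U_mid[OF assms(2,3)] U_integrable[OF assms(1,2)] U_integrable[OF assms(1,3)]
  by (simp add: distrib_left)

lemma U_closed_integral:
  assumes "integrable M w" "\<And>k::nat. x k \<in> U n" "g \<in> borel_measurable M" "AE p in M. (\<lambda>k. x k p) \<longlonglongrightarrow> g p"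
  shows "g \<in> U n \<and> (\<lambda>k. \<integral>p. w p * x k p \<partial>M) \<longlonglongrightarrow> (\<integral>p. w p * g p \<partial>M)"
  by (rule conjI[OF U_closed[OF assms(2-4)]])
    (rule integral_times_tendsto[OF assms(1) U_meas[OF assms(2)] assms(3) U_bnd[OF assms(2)] assms(4)])

text \<open>Otherwise the expectation attains the infimum 0 on \<open>U n\<close>. The minimiser is
  nonnegative with mean 0, so it vanishes a.e., but no accepted position is nonpositive.\<close>

lemma integral_bounded_below_U:
  assumes "c \<le> n"
  shows "\<exists>d>0. \<forall>u\<in>U n. d \<le> expectation u"
proof (rule ccontr)
  assume "\<not> ?thesis"
  then have H: "\<exists>u\<in>U n. expectation u < d" if "0 < d" for d using that by (auto simp: not_le)
  have approx: "\<exists>u\<in>U n. (\<integral>p. 1 * u p \<partial>M) \<le> 0 + e" if "0 < e" for e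
    using H[OF that] by (auto intro: less_imp_le)
  obtain g where gU: "g \<in> U n" and "(\<integral>p. 1 * g p \<partial>M) \<le> 0"
    by (rule infimum_attained[OF U_meas U_bnd U_mid_integral_le[OF integrable_const] U_closed_integral[OF integrable_const] approx])
  then have "expectation g = 0"
    using integral_nonneg_AE[OF U_nonneg[OF gU]] by simp
  then have "AE p in M. g p = 0"
    using integral_nonneg_eq_0_iff_AE[OF _ U_nonneg[OF gU]] integrable_AE_bounded[OF U_meas[OF gU] U_bnd[OF gU]] by simp
  then have "AE p in M. g p \<le> 0" by eventually_elim simp
  with not_nonpos[OF U_A[OF gU]] show False by simp
qed

text \<open>One step of the Krein-Smulian argument: enlarging the bound from \<open>n\<close> to \<open>N\<close> costs only a
  perturbation of the weight of \<open>L\<^sup>1\<close> norm about \<open>1 / n\<close>. The perturbation is the gradient of a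
  quadratic penalty for exceeding \<open>n\<close>.\<close>

lemma weight_step:
  assumes n: "c \<le> n" "n \<le> N" and w: "integrable M w" "\<And>p. 0 \<le> w p"
    and low: "\<And>u. u \<in> U n \<Longrightarrow> b \<le> (\<integral>p. w p * u p \<partial>M)"
    and b': "b' < b" and e: "0 < e" "b' \<le> e * n"
  obtains v where "integrable M v" "\<And>p. 0 \<le> v p" "expectation v \<le> e"
    "\<And>u. u \<in> U N \<Longrightarrow> b' \<le> (\<integral>p. (w p + v p) * u p \<partial>M)"
proof (rule ccontr)
  assume none: "\<not> thesis"
  note result = that
  \<comment> \<open>The penalty is free exactly up to \<open>n\<close>, and \<open>\<psi>\<close> is
    its derivative.\<close>
  define \<phi> \<psi> :: "real \<Rightarrow> real" where "\<phi> a = (max 0 (a - n))\<^sup>2 / 2" and "\<psi> a = max 0 (a - n)" for a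
  have cont: "continuous_on UNIV \<phi>" "continuous_on UNIV \<psi>"
    unfolding \<phi>_def \<psi>_def by (auto intro!: continuous_intros)
  then have [measurable]: "\<phi> \<in> borel_measurable borel" "\<psi> \<in> borel_measurable borel"
    by (auto intro: borel_measurable_continuous_onI)
  have sub: "\<phi> a + \<psi> a * (d - a) \<le> \<phi> d" for a d
  proof -
    \<comment> \<open>\<open>a - n\<close> is the sum of its positive part \<open>\<psi> a\<close>
      and the nonpositive rest \<open>a - n - \<psi> a\<close>, and the product of the two is 0.
      This inequality and the quadratic bound are algebra with that splitting.\<close>
    have "0 \<le> (\<psi> d - \<psi> a)\<^sup>2 / 2" by simp
    moreover have "\<psi> a * (d - n - \<psi> d) \<le> 0" "\<psi> a * (a - n - \<psi> a) = 0" unfolding \<psi>_def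
      by (auto simp: max_def mult_nonneg_nonpos)
    ultimately show ?thesis unfolding \<phi>_def \<psi>_def[symmetric]
      by (simp add: power2_eq_square algebra_simps)
  qed
  have quad: "\<phi> d \<le> \<phi> a + \<psi> a * (d - a) + (1/2) * (d - a)\<^sup>2" for a d
  proof -
    have "\<psi> d * (d - n - \<psi> d) = 0" "\<psi> a * (a - n - \<psi> a) = 0" "(a - n - \<psi> a) * (\<psi> d) \<le> 0"
      unfolding \<psi>_def by (auto simp: max_def mult_nonpos_nonneg)
    moreover have "0 \<le> ((d - n - \<psi> d) - (a - n - \<psi> a))\<^sup>2" "0 \<le> - ((d - n - \<psi> d) * \<psi> a)"
      unfolding \<psi>_def by (auto simp: max_def mult_nonpos_nonneg)
    ultimately show ?thesis unfolding \<phi>_def \<psi>_def[symmetric]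
      by (simp add: power2_eq_square algebra_simps)
  qed
  have phi0: "0 \<le> \<phi> a" for a by (simp add: \<phi>_def)
  have \<psi>_bnd: "AE p in M. \<bar>\<psi> (u p)\<bar> \<le> N + \<bar>n\<bar>" if "u \<in> U N" for u
    using U_bnd[OF that] by eventually_elim (auto simp: \<psi>_def)
  have \<phi>_bnd: "AE p in M. \<bar>\<phi> (u p)\<bar> \<le> (N + \<bar>n\<bar>)\<^sup>2" if "u \<in> U N" for u
    using \<psi>_bnd[OF that]
  proof eventually_elim
    case (elim p)
    have "\<bar>\<psi> (u p)\<bar>\<^sup>2 \<le> (N + \<bar>n\<bar>)\<^sup>2" by (rule power_mono[OF elim]) simp
    moreover have "\<bar>\<phi> (u p)\<bar> = \<bar>\<psi> (u p)\<bar>\<^sup>2 / 2" by (simp add: \<phi>_def \<psi>_def)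
    ultimately show ?case using zero_le_power2[of "N + \<bar>n\<bar>"] by linarith
  qed
  have \<phi>_int: "integrable M (\<lambda>p. \<phi> (u p))" and \<psi>_int: "integrable M (\<lambda>p. \<psi> (u p))" if "u \<in> U N" for u
    using U_meas[OF that] by (auto intro: integrable_AE_bounded[OF _ \<phi>_bnd[OF that]] integrable_AE_bounded[OF _ \<psi>_bnd[OF that]])
  have cU: "(\<lambda>_. c) \<in> U N" using n by (intro U_const) simp
  define R where "R = (\<integral>p. w p * c \<partial>M)"
  have R0: "0 \<le> R" unfolding R_def using U_integral_nonneg[where w = w, OF w(2) cU] by simp
  have z: "\<exists>z\<in>U N. (\<integral>p. w p * z p \<partial>M) \<le> b' \<and> (\<integral>p. \<phi> (z p) \<partial>M) \<le> 0 + \<eta>"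
    if \<eta>: "0 < \<eta>" for \<eta>
  proof -
    \<comment> \<open>Comparing the minimiser with the constant \<open>c\<close>, which is not
      penalised because \<open>c \<le> n\<close>, bounds \<open>s\<close> times its penalty by
      \<open>R\<close>. This \<open>s\<close> brings the penalty below \<open>\<eta>\<close>, and
      the summand 1 keeps it positive.\<close>
    define s where "s = (R + 1) / \<eta>"
    have s: "0 < s" using \<eta> R0 by (simp add: s_def)
    have Une: "U N \<noteq> {}" and ws: "integrable M (\<lambda>_. s)" "AE p in M. 0 \<le> s" using cU s by auto
    obtain z where z: "z \<in> U N" and min: "\<forall>u\<in>U N.
        (\<integral>p. w p * z p \<partial>M) + (\<integral>p. s * \<phi> (z p) \<partial>M) \<le> (\<integral>p. w p * u p \<partial>M) + (\<integral>p. s * \<phi> (u p) \<partial>M)"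
      and first: "\<forall>u\<in>U N. 0 \<le> (\<integral>p. (w p + s * \<psi> (z p)) * (u p - z p) \<partial>M)"
      by (rule first_order_minimizer[of "U N" N w "\<lambda>_. s" \<phi> \<psi> "1/2",
            OF Une U_meas U_bnd U_convex U_closed w(1) ws cont phi0 sub quad])
    define v where "v p = s * \<psi> (z p)" for p
    have v: "integrable M v" "\<And>p. 0 \<le> v p"
      using \<psi>_int[OF z] s by (auto simp: v_def[abs_def] \<psi>_def)
    \<comment> \<open>\<open>v\<close> vanishes wherever \<open>z\<close> does not exceed
      \<open>n\<close>.\<close>
    have vz: "v p * n \<le> v p * z p" for p
      using s by (cases "z p \<le> n") (auto simp: v_def \<psi>_def intro!: mult_left_mono)
    define r where "r = expectation v"
    have iz: "integrable M (\<lambda>p. w p * z p)" "integrable M (\<lambda>p. v p * z p)"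
      using U_integrable[OF w(1) z] U_integrable[OF v(1) z] .
    have rn: "r * n \<le> (\<integral>p. v p * z p \<partial>M)"
      unfolding r_def integral_mult_left_zero[symmetric]
      by (rule integral_mono_AE) (use v iz vz in auto)
    have low_u: "(\<integral>p. w p * z p \<partial>M) + r * n \<le> (\<integral>p. w p * u p \<partial>M) + (\<integral>p. v p * u p \<partial>M)"
      if u: "u \<in> U N" for u
    proof -
      have iu: "integrable M (\<lambda>p. w p * u p)" "integrable M (\<lambda>p. v p * u p)"
        using U_integrable[OF w(1) u] U_integrable[OF v(1) u] .
      have "0 \<le> (\<integral>p. (w p + v p) * (u p - z p) \<partial>M)" using bspec[OF first u] by (simp add: v_def)
      also have "\<dots> = (\<integral>p. (w p * u p + v p * u p) - (w p * z p + v p * z p) \<partial>M)"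
        by (simp add: algebra_simps)
      also have "\<dots> = (\<integral>p. w p * u p \<partial>M) + (\<integral>p. v p * u p \<partial>M)
          - ((\<integral>p. w p * z p \<partial>M) + (\<integral>p. v p * z p \<partial>M))"
        using iu iz by simp
      finally show ?thesis using rn by simp
    qed
    have r0: "0 \<le> r" unfolding r_def by (rule integral_nonneg_AE) (simp add: v)
    have "r \<le> e"
    proof (rule ccontr)
      assume "\<not> r \<le> e"
      \<comment> \<open>A heavier \<open>v\<close> could be scaled down to mass exactly
        \<open>e\<close>. Since \<open>e * n\<close> is at least \<open>b'\<close>, the scaled
        perturbation would already satisfy the claim, which is assumed to be impossible.\<close>
      define \<theta> where "\<theta> = e / r"
      have \<theta>: "0 \<le> \<theta>" "\<theta> \<le> 1" "\<theta> * r = e" using \<open>\<not> r \<le> e\<close> e(1) by (auto simp: \<theta>_def)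
      have "b' \<le> (\<integral>p. (w p + \<theta> * v p) * u p \<partial>M)" if u: "u \<in> U N" for u
      proof -
        have iu: "integrable M (\<lambda>p. w p * u p)" "integrable M (\<lambda>p. v p * u p)"
          using U_integrable[OF w(1) u] U_integrable[OF v(1) u] .
        have "(\<integral>p. (w p + \<theta> * v p) * u p \<partial>M) = (\<integral>p. w p * u p + \<theta> * (v p * u p) \<partial>M)"
          by (simp add: algebra_simps)
        also have "\<dots> = (1 - \<theta>) * (\<integral>p. w p * u p \<partial>M) + \<theta> * ((\<integral>p. w p * u p \<partial>M) + (\<integral>p. v p * u p \<partial>M))"
          using iu by (simp add: algebra_simps)
        finally have eq: "(\<integral>p. (w p + \<theta> * v p) * u p \<partial>M) = \<dots>" .
        have "0 \<le> (1 - \<theta>) * (\<integral>p. w p * u p \<partial>M)"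
          using U_integral_nonneg[where w = w, OF w(2) u] \<theta> by simp
        moreover have "r * n \<le> (\<integral>p. w p * u p \<partial>M) + (\<integral>p. v p * u p \<partial>M)"
          using low_u[OF u] U_integral_nonneg[where w = w, OF w(2) z] by simp
        then have "\<theta> * (r * n) \<le> \<theta> * ((\<integral>p. w p * u p \<partial>M) + (\<integral>p. v p * u p \<partial>M))"
          by (rule mult_left_mono) (rule \<theta>(1))
        moreover have "b' \<le> \<theta> * (r * n)" using e(2) \<theta>(3) by (simp add: mult.assoc[symmetric])
        ultimately show ?thesis unfolding eq by linarith
      qed
      moreover have "(\<integral>p. \<theta> * v p \<partial>M) \<le> e" using \<theta>(3) by (simp add: r_def)
      ultimately show False using none result[of "\<lambda>p. \<theta> * v p"] v \<theta>(1) by auto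
    qed
    moreover have "(\<integral>p. w p * z p \<partial>M) \<le> b'"
    proof (rule ccontr)
      \<comment> \<open>In this case \<open>v\<close> itself, whose mass is now known to be at most
        \<open>e\<close>, would satisfy the claim.\<close>
      assume H: "\<not> (\<integral>p. w p * z p \<partial>M) \<le> b'"
      have "b' \<le> (\<integral>p. (w p + v p) * u p \<partial>M)" if u: "u \<in> U N" for u
      proof -
        have "(\<integral>p. (w p + v p) * u p \<partial>M) = (\<integral>p. w p * u p \<partial>M) + (\<integral>p. v p * u p \<partial>M)"
          using U_integrable[OF w(1) u] U_integrable[OF v(1) u] by (simp add: distrib_right)
        moreover have "0 \<le> r * n" using r0 n c_pos by simp
        ultimately show ?thesis using low_u[OF u] H by simp
      qed
      then show False using none result[of v] v \<open>r \<le> e\<close> by (auto simp: r_def)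
    qed
    moreover have "s * (\<integral>p. \<phi> (z p) \<partial>M) \<le> R"
      using bspec[OF min cU] U_integral_nonneg[where w = w, OF w(2) z] n by (simp add: R_def \<phi>_def)
    moreover have "R \<le> s * \<eta>" using \<eta> by (simp add: s_def)
    ultimately have "s * (\<integral>p. \<phi> (z p) \<partial>M) \<le> s * \<eta>" by simp
    then show ?thesis using z s \<open>(\<integral>p. w p * z p \<partial>M) \<le> b'\<close> by auto
  qed
  \<comment> \<open>As \<open>\<eta>\<close> tends to 0, the infimum of the penalty over
    \<open>K\<close> is 0, and it is attained. The point attaining it does not exceed
    \<open>n\<close>, so it belongs to \<open>U n\<close> while its \<open>w\<close>-integral is at
    most \<open>b'\<close>; this contradicts \<open>low\<close>.\<close>
  define K where "K = {u \<in> U N. (\<integral>p. w p * u p \<partial>M) \<le> b'}"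
  have mid: "(\<lambda>p. (u p + v p) / 2) \<in> K \<and>
      (\<integral>p. \<phi> ((u p + v p) / 2) \<partial>M) \<le> ((\<integral>p. \<phi> (u p) \<partial>M) + (\<integral>p. \<phi> (v p) \<partial>M)) / 2"
    if uv: "u \<in> K" "v \<in> K" for u v
  proof -
    have uvU: "u \<in> U N" "v \<in> U N" using uv by (auto simp: K_def)
    have "(\<integral>p. \<phi> ((u p + v p) / 2) \<partial>M) \<le> (\<integral>p. (\<phi> (u p) + \<phi> (v p)) / 2 \<partial>M)"
    proof (rule integral_mono_AE)
      show "AE p in M. \<phi> ((u p + v p) / 2) \<le> (\<phi> (u p) + \<phi> (v p)) / 2"
      proof (rule AE_I2)
        fix p
        define m where "m = (u p + v p) / 2"
        have "\<phi> m + \<psi> m * (u p - m) \<le> \<phi> (u p)" "\<phi> m + \<psi> m * (v p - m) \<le> \<phi> (v p)" by (rule sub)+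
        moreover have "\<psi> m * (u p - m) + \<psi> m * (v p - m) = 0"
          unfolding distrib_left[symmetric] m_def by simp
        ultimately show "\<phi> ((u p + v p) / 2) \<le> (\<phi> (u p) + \<phi> (v p)) / 2" by (simp add: m_def)
      qed
    qed (use \<phi>_int[OF U_mid[OF uvU]] \<phi>_int[OF uvU(1)] \<phi>_int[OF uvU(2)] in auto)
    also have "\<dots> = ((\<integral>p. \<phi> (u p) \<partial>M) + (\<integral>p. \<phi> (v p) \<partial>M)) / 2"
      using \<phi>_int[OF uvU(1)] \<phi>_int[OF uvU(2)] by simp
    finally show ?thesis
      using uv U_mid_integral_le[OF w(1) uvU] by (auto simp: K_def)
  qed
  have clos: "g \<in> K \<and> (\<lambda>k. \<integral>p. \<phi> (x k p) \<partial>M) \<longlonglongrightarrow> (\<integral>p. \<phi> (g p) \<partial>M)"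
    if x: "\<And>k::nat. x k \<in> K" and g[measurable]: "g \<in> borel_measurable M"
      and lim: "AE p in M. (\<lambda>k. x k p) \<longlonglongrightarrow> g p" for x g
  proof
    have xU: "x k \<in> U N" for k using x by (simp add: K_def)
    note cl = U_closed_integral[OF w(1) xU g lim]
    have "(\<integral>p. w p * g p \<partial>M) \<le> b'"
      by (intro LIMSEQ_le_const2[OF conjunct2[OF cl]]) (use x in \<open>auto simp: K_def\<close>)
    with cl show "g \<in> K" by (simp add: K_def)
    have "(\<lambda>k. \<integral>p. 1 * \<phi> (x k p) \<partial>M) \<longlonglongrightarrow> (\<integral>p. 1 * \<phi> (g p) \<partial>M)"
    proof (rule integral_times_tendsto)
      show "AE p in M. (\<lambda>k. \<phi> (x k p)) \<longlonglongrightarrow> \<phi> (g p)"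
        using lim by eventually_elim (rule continuous_on_tendsto_compose[OF cont(1)], auto)
      show "AE p in M. \<bar>\<phi> (x k p)\<bar> \<le> (N + \<bar>n\<bar>)\<^sup>2" for k by (rule \<phi>_bnd[OF xU])
      show "(\<lambda>p. \<phi> (x k p)) \<in> borel_measurable M" for k using U_meas[OF xU[of k]] by measurable
    qed auto
    then show "(\<lambda>k. \<integral>p. \<phi> (x k p) \<partial>M) \<longlonglongrightarrow> (\<integral>p. \<phi> (g p) \<partial>M)" by simp
  qed
  have approx: "\<exists>z\<in>K. (\<integral>p. \<phi> (z p) \<partial>M) \<le> 0 + \<eta>" if "0 < \<eta>" for \<eta>
    using z[OF that] by (auto simp: K_def)
  obtain g where g: "g \<in> K" and "(\<integral>p. \<phi> (g p) \<partial>M) \<le> 0"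
    by (rule infimum_attained[where K = K and B = N and J = "\<lambda>u. \<integral>p. \<phi> (u p) \<partial>M", OF _ _ mid clos approx])
      (auto simp: K_def U_meas intro: U_bnd)
  have gU: "g \<in> U N" and wg: "(\<integral>p. w p * g p \<partial>M) \<le> b'" using g by (auto simp: K_def)
  have "0 \<le> (\<integral>p. \<phi> (g p) \<partial>M)" by (rule integral_nonneg_AE) (simp add: phi0)
  with \<open>(\<integral>p. \<phi> (g p) \<partial>M) \<le> 0\<close> have "(\<integral>p. \<phi> (g p) \<partial>M) = 0" by simp
  then have "AE p in M. \<phi> (g p) = 0"
    using integral_nonneg_eq_0_iff_AE[OF \<phi>_int[OF gU]] by (simp add: phi0)
  then have "AE p in M. g p \<le> n" by eventually_elim (auto simp: \<phi>_def max_def split: if_splits)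
  with U_nonneg[OF gU] have "AE p in M. 0 \<le> g p \<and> g p \<le> n" by eventually_elim simp
  then have "g \<in> U n" using U_A[OF gU] by (simp add: U_def)
  from low[OF this] wg b' show False by simp
qed

end

text \<open>Monotone convergence bounds the integral of the pointwise supremum by \<open>R\<close>,
  so the supremum is finite a.e. \<open>enn2real\<close> replaces it by 0 where it is infinite,
  which is why the majorant dominates only a.e.\<close>

lemma (in finite_measure) integrable_majorant_incseq:
  fixes W :: "nat \<Rightarrow> 'a \<Rightarrow> real"
  assumes int: "\<And>k. integrable M (W k)" and nn: "\<And>k p. 0 \<le> W k p" and inc: "incseq W"
    and bnd: "\<And>k. (\<integral>p. W k p \<partial>M) \<le> R"
  obtains w where "integrable M w" "\<forall>p. 0 \<le> w p" "\<forall>k. AE p in M. W k p \<le> w p"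
proof -
  define g where "g p = (SUP k. ennreal (W k p))" for p
  have [measurable]: "W k \<in> borel_measurable M" for k using int by auto
  have [measurable]: "g \<in> borel_measurable M" unfolding g_def by measurable
  have "(\<integral>\<^sup>+p. g p \<partial>M) = (SUP k. \<integral>\<^sup>+p. ennreal (W k p) \<partial>M)"
    unfolding g_def
    by (rule nn_integral_monotone_convergence_SUP)
      (use inc in \<open>auto simp: incseq_def le_fun_def intro!: ennreal_leI\<close>)
  also have "\<dots> \<le> ennreal R"
    by (rule SUP_least) (simp add: nn_integral_eq_integral int nn bnd ennreal_leI)
  finally have fin: "(\<integral>\<^sup>+p. g p \<partial>M) < \<infinity>" by (simp add: order_le_less_trans)
  have AEfin: "AE p in M. g p \<noteq> \<infinity>"
    by (rule nn_integral_PInf_AE) (use fin in auto)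
  have "integrable M (\<lambda>p. enn2real (g p))"
  proof (rule integrableI_nonneg)
    have "(\<integral>\<^sup>+p. ennreal (enn2real (g p)) \<partial>M) = (\<integral>\<^sup>+p. g p \<partial>M)"
      by (rule nn_integral_cong_AE) (use AEfin in eventually_elim, simp add: less_top)
    with fin show "(\<integral>\<^sup>+p. ennreal (enn2real (g p)) \<partial>M) < \<infinity>" by simp
  qed auto
  moreover have "AE p in M. W k p \<le> enn2real (g p)" for k
    using AEfin
  proof eventually_elim
    case (elim p)
    have "ennreal (W k p) \<le> g p" unfolding g_def by (rule SUP_upper) simp
    then have "enn2real (ennreal (W k p)) \<le> enn2real (g p)"
      by (rule enn2real_mono) (use elim in \<open>simp add: less_top\<close>)
    then show ?case using nn by simp
  qed
  ultimately show ?thesis by (intro that[of "\<lambda>p. enn2real (g p)"]) auto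
qed

context acceptance_set
begin

text \<open>\<open>weight_step\<close> is iterated with the bounds \<open>c * 2 ^ k\<close>. The
  levels \<open>1 + (1/2) ^ k\<close> decrease strictly, as each step requires, but stay above 1,
  and the added masses have the finite sum \<open>4 / c\<close>. The positive part enters because it
  is the positive part of an accepted position that lies in some \<open>U n\<close>.\<close>

lemma weight:
  obtains w where "integrable M w" "\<forall>p. 0 \<le> w p" "\<forall>x\<in>A. 1 \<le> (\<integral>p. w p * max 0 (x p) \<partial>M)"
proof -
  define P where "P k W \<longleftrightarrow> integrable M W \<and> (\<forall>p. 0 \<le> W p) \<and>
      (\<forall>u\<in>U (c * 2 ^ k). 1 + (1/2) ^ k \<le> (\<integral>p. W p * u p \<partial>M))" for k and W :: "'a \<Rightarrow> real"
  define Q where "Q k W W' \<longleftrightarrow> (\<forall>p. W p \<le> W' p) \<and> (\<integral>p. W' p \<partial>M) \<le> expectation W + 2 / (c * 2 ^ k)"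
    for k :: nat and W W' :: "'a \<Rightarrow> real"
  have "\<exists>W. \<forall>k. P k (W k) \<and> Q k (W k) (W (Suc k))"
  proof (rule dependent_nat_choice)
    obtain d where d: "0 < d" "\<forall>u\<in>U c. d \<le> expectation u"
      using integral_bounded_below_U[of c] by auto
    have "2 \<le> (\<integral>p. 2 / d * u p \<partial>M)" if "u \<in> U c" for u
      using d that by (simp add: field_simps)
    then have "P 0 (\<lambda>_. 2 / d)" using d(1) by (simp add: P_def)
    then show "\<exists>W. P 0 W" by blast
  next
    fix W k assume W: "P k W"
    obtain v where v: "integrable M v" "\<And>p. 0 \<le> v p" "expectation v \<le> 2 / (c * 2 ^ k)"
      and low: "\<And>u. u \<in> U (c * 2 ^ Suc k) \<Longrightarrow> 1 + (1/2) ^ Suc k \<le> (\<integral>p. (W p + v p) * u p \<partial>M)"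
    proof (rule weight_step[of "c * 2 ^ k" "c * 2 ^ Suc k" W "1 + (1/2) ^ k" "1 + (1/2) ^ Suc k" "2 / (c * 2 ^ k)"])
      show "1 + (1/2) ^ Suc k < 1 + (1/2::real) ^ k" by simp
      \<comment> \<open>Mass times bound must reach the next level. Here the product is 2, which is
        at least every \<open>1 + (1/2) ^ Suc k\<close>.\<close>
      have "(1/2::real) ^ Suc k \<le> 1" by (rule power_le_one) auto
      then show "1 + (1/2) ^ Suc k \<le> 2 / (c * 2 ^ k) * (c * 2 ^ k)" using c_pos by simp
      show "c \<le> c * 2 ^ k" "c * 2 ^ k \<le> c * 2 ^ Suc k" using c_pos by auto
      show "integrable M W" "\<And>p. 0 \<le> W p"
        "\<And>u. u \<in> U (c * 2 ^ k) \<Longrightarrow> 1 + (1/2) ^ k \<le> (\<integral>p. W p * u p \<partial>M)"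
        using W by (auto simp: P_def)
    qed (use c_pos in auto)
    show "\<exists>W'. P (Suc k) W' \<and> Q k W W'"
      by (rule exI[of _ "\<lambda>p. W p + v p"]) (use W v low in \<open>auto simp: P_def Q_def\<close>)
  qed
  then obtain W where W: "\<And>k. P k (W k)" "\<And>k. Q k (W k) (W (Suc k))" by blast
  have int: "integrable M (W k)" and nn: "0 \<le> W k p"
    and low: "u \<in> U (c * 2 ^ k) \<Longrightarrow> 1 + (1/2) ^ k \<le> (\<integral>p. W k p * u p \<partial>M)" for k p u
    using W(1)[of k] by (auto simp: P_def)
  have inc: "incseq W" by (rule incseq_SucI) (use W(2) in \<open>auto simp: Q_def le_fun_def\<close>)
  \<comment> \<open>The second summand is the partial geometric sum of the masses
    \<open>2 / (c * 2 ^ i)\<close> over \<open>i < k\<close>.\<close>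
  have "(\<integral>p. W k p \<partial>M) \<le> (\<integral>p. W 0 p \<partial>M) + (4 / c) * (1 - (1/2) ^ k)" for k
  proof (induction k)
    case (Suc k)
    have "(\<integral>p. W (Suc k) p \<partial>M) \<le> (\<integral>p. W k p \<partial>M) + 2 / (c * 2 ^ k)" using W(2)[of k] by (simp add: Q_def)
    moreover define h where "h = (1/2) ^ k / c"
    moreover have "2 / (c * 2 ^ k) = 2 * h" "4 / c * (1 - (1/2) ^ k) = 4 / c - 4 * h"
      "4 / c * (1 - (1/2) ^ Suc k) = 4 / c - 2 * h"
      using c_pos by (simp_all add: h_def field_simps power_one_over)
    ultimately show ?case using Suc by linarith
  qed simp
  then have bnd: "(\<integral>p. W k p \<partial>M) \<le> (\<integral>p. W 0 p \<partial>M) + 4 / c" for k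
  proof (rule order_trans)
    have "(4 / c) * (1 - (1/2) ^ k) \<le> (4 / c) * 1" using c_pos by (intro mult_left_mono) auto
    then show "(\<integral>p. W 0 p \<partial>M) + 4 / c * (1 - (1 / 2) ^ k) \<le> (\<integral>p. W 0 p \<partial>M) + 4 / c" by simp
  qed
  obtain w where w': "integrable M w" "\<forall>p. 0 \<le> w p" and Ww': "\<forall>k. AE p in M. W k p \<le> w p"
    by (rule integrable_majorant_incseq[OF int nn inc bnd])
  note w = w'(1) w'(2)[rule_format] and Ww = Ww'[rule_format]
  have "1 \<le> (\<integral>p. w p * max 0 (x p) \<partial>M)" if x: "x \<in> A" for x
  proof -
    have [measurable]: "x \<in> borel_measurable M" by (rule meas[OF x])
    obtain C where C: "AE p in M. \<bar>x p\<bar> \<le> C" using x bounded by (auto simp: Linf_def)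
    obtain k where "C / c < 2 ^ k" using real_arch_pow[of 2 "C / c"] by auto
    then have k: "C \<le> c * 2 ^ k" using c_pos by (simp add: field_simps)
    have *: "AE p in M. 0 \<le> max 0 (x p) \<and> max 0 (x p) \<le> c * 2 ^ k"
      using C by eventually_elim (use k c_pos in auto)
    then have "AE p in M. \<bar>max 0 (x p)\<bar> \<le> c * 2 ^ k" by eventually_elim simp
    then have "(\<lambda>p. max 0 (x p)) \<in> A"
      by (intro upward[OF x]) (auto simp: Linf_def L0_def)
    then have u: "(\<lambda>p. max 0 (x p)) \<in> U (c * 2 ^ k)" using * by (simp add: U_def)
    have "1 + (1/2) ^ k \<le> (\<integral>p. W k p * max 0 (x p) \<partial>M)" by (rule low[OF u])
    also have "\<dots> \<le> (\<integral>p. w p * max 0 (x p) \<partial>M)"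
    proof (rule integral_mono_AE)
      show "AE p in M. W k p * max 0 (x p) \<le> w p * max 0 (x p)"
        using Ww[of k] by eventually_elim (intro mult_right_mono, auto)
    qed (intro U_integrable[OF _ u] int w)+
    finally have "1 + (1/2) ^ k \<le> (\<integral>p. w p * max 0 (x p) \<partial>M)" .
    moreover have "(1::real) \<le> 1 + (1/2) ^ k" by simp
    ultimately show ?thesis by (rule order_trans[rotated])
  qed
  with w show ?thesis by (intro that[of w]) auto
qed

end

text \<open>A ramp from 0 to 1 over the interval from 0 to \<open>c\<close>: a continuous substitute
  for the derivative of the positive part, with values in a fixed order interval.\<close>

definition clip :: "real \<Rightarrow> real \<Rightarrow> real" where
  "clip c a = max 0 (min 1 (a / c))"

text \<open>The primitive of \<open>clip c\<close>; it approximates the positive part.\<close>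

definition huber :: "real \<Rightarrow> real \<Rightarrow> real" where
  "huber c a = clip c a * a - c * (clip c a)\<^sup>2 / 2"

lemma clip_bounds: "0 \<le> clip c a" "clip c a \<le> 1"
  by (auto simp: clip_def)

lemma continuous_clip: "continuous_on UNIV (clip c)"
  unfolding clip_def by (cases "c = 0") (auto intro!: continuous_intros)

lemma continuous_huber: "continuous_on UNIV (huber c)"
  unfolding huber_def by (intro continuous_intros continuous_on_compose2[OF continuous_clip]) auto

lemma clip_cases:
  assumes "0 < c"
  obtains "a \<le> 0" "clip c a = 0" | "0 \<le> a" "a \<le> c" "c * clip c a = a" | "c \<le> a" "clip c a = 1"
proof -
  consider "a \<le> 0" | "0 \<le> a" "a \<le> c" | "c \<le> a" by linarith
  then show ?thesis
  proof cases
    case 1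
    then show ?thesis using assms that(1) by (simp add: clip_def divide_nonpos_pos)
  next
    case 2
    then show ?thesis using assms that(2) by (simp add: clip_def)
  next
    case 3
    then show ?thesis using assms that(3) by (simp add: clip_def)
  qed
qed

text \<open>\<open>huber c a\<close> is the maximum of \<open>p * a - c * p\<^sup>2 / 2\<close> over
  \<open>p\<close> between 0 and 1, attained at \<open>clip c a\<close>; the inequality is the first
  order optimality condition there. Taking \<open>p\<close> to be 0, 1 or another value of
  \<open>clip\<close> yields \<open>huber_nonneg\<close>, \<open>huber_ge\<close> and
  \<open>huber_subgradient\<close>.\<close>

lemma clip_mono_ineq:
  assumes "0 < c" "0 \<le> p" "p \<le> 1"
  shows "(p - clip c a) * (a - c * clip c a) \<le> 0"
  using assms(1) by (cases rule: clip_cases[of c a]) (use assms in \<open>auto simp: mult_nonneg_nonpos mult_nonpos_nonneg\<close>)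

lemma huber_nonneg:
  assumes "0 < c"
  shows "0 \<le> huber c a"
proof -
  have "0 \<le> c * (clip c a * clip c a)" using assms by simp
  moreover have "(0 - clip c a) * (a - c * clip c a) \<le> 0" by (rule clip_mono_ineq[OF assms]) auto
  ultimately show ?thesis by (simp add: huber_def power2_eq_square algebra_simps)
qed

lemma huber_subgradient:
  assumes "0 < c"
  shows "huber c a + clip c a * (b - a) \<le> huber c b"
proof -
  have "0 \<le> c * ((clip c b - clip c a) * (clip c b - clip c a))" using assms by simp
  moreover have "(clip c a - clip c b) * (b - c * clip c b) \<le> 0"
    by (rule clip_mono_ineq[OF assms clip_bounds])
  ultimately show ?thesis unfolding huber_def power2_eq_square by (simp add: algebra_simps del: mult_le_cancel_left_pos)
qed

lemma huber_ge:
  assumes "0 < c"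
  shows "max 0 a - c / 2 \<le> huber c a"
proof -
  have "0 \<le> c * ((1 - clip c a) * (1 - clip c a))" using assms by simp
  moreover have "(1 - clip c a) * (a - c * clip c a) \<le> 0" by (rule clip_mono_ineq[OF assms]) auto
  ultimately have "a - c / 2 \<le> huber c a" unfolding huber_def power2_eq_square by (simp add: algebra_simps)
  then show ?thesis using huber_nonneg[OF assms, of a] assms by simp
qed

lemma huber_le: "0 < c \<Longrightarrow> huber c a \<le> clip c a * a"
  by (simp add: huber_def)

text \<open>The derivative \<open>clip c\<close> is Lipschitz with constant \<open>1 / c\<close>.
  The proof completes a square in \<open>d - c * (q - p)\<close> and estimates the rest by
  \<open>clip_mono_ineq\<close>.\<close>

lemma huber_quadratic:
  assumes "0 < c"
  shows "huber c b \<le> huber c a + clip c a * (b - a) + 1 / (2 * c) * (b - a)\<^sup>2"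
proof -
  define p q d R where "p = clip c a" and "q = clip c b" and "d = b - a" and "R = 1 / (2 * c) * (b - a)\<^sup>2"
  have "0 \<le> (d - c * (q - p))\<^sup>2 / (2 * c)" using assms by simp
  also have "\<dots> = R - d * (q - p) + c * (q - p)\<^sup>2 / 2"
    using assms unfolding R_def d_def by (simp add: field_simps power2_eq_square)
  finally have "0 \<le> \<dots>" .
  moreover have "(q - p) * (a - c * p) \<le> 0"
    unfolding p_def q_def by (rule clip_mono_ineq[OF assms clip_bounds])
  moreover have "d * (q - p) - c * (q - p)\<^sup>2 / 2 + (q - p) * (a - c * p)
      = (q * b - c * q\<^sup>2 / 2) - (p * a - c * p\<^sup>2 / 2) - p * (b - a)"
    unfolding d_def by (simp add: field_simps power2_eq_square)
  ultimately have "(q * b - c * q\<^sup>2 / 2) - (p * a - c * p\<^sup>2 / 2) - p * (b - a) \<le> R" by linarith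
  then show ?thesis unfolding huber_def p_def q_def R_def by linarith
qed

context acceptance_set
begin

text \<open>Let \<open>z\<close> minimise the \<open>w\<close>-integral of
  \<open>huber \<kappa>\<close> over the accepted positions bounded by \<open>N\<close>. By the
  first order condition the linear functional with weight \<open>w * clip \<kappa> (z)\<close> is
  smallest at \<open>z\<close>, and there it dominates the integral of the smoothed positive part,
  which \<open>weight\<close> bounds from below. The multipliers \<open>clip \<kappa> (z)\<close>
  stay between 0 and 1 for all \<open>N\<close>, so a single limit works for every bound.\<close>

theorem separation:
  obtains y \<delta> where "integrable M y" "\<forall>p. 0 \<le> y p" "0 < \<delta>" "\<forall>a\<in>A. \<delta> \<le> (\<integral>p. y p * a p \<partial>M)"
proof -
  obtain w where w': "integrable M w" "\<forall>p. 0 \<le> w p"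
    and w1': "\<forall>x\<in>A. 1 \<le> (\<integral>p. w p * max 0 (x p) \<partial>M)" by (rule weight)
  note w = w'(1) w'(2)[rule_format] and w1 = w1'[rule_format]
  define W where "W = expectation w"
  have W0: "0 \<le> W" unfolding W_def by (rule integral_nonneg_AE) (simp add: w)
  \<comment> \<open>The smoothing costs at most \<open>\<kappa> / 2\<close> pointwise, hence at most
    \<open>1/2\<close> after integration against \<open>w\<close>; half of the lower bound 1
    survives.\<close>
  define \<kappa> where "\<kappa> = 1 / (W + 1)"
  have \<kappa>: "0 < \<kappa>" "\<kappa> * W \<le> 1" using W0 by (auto simp: \<kappa>_def field_simps)
  have [measurable]: "clip \<kappa> \<in> borel_measurable borel" "huber \<kappa> \<in> borel_measurable borel"
    using continuous_clip continuous_huber by (auto intro: borel_measurable_continuous_onI)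
  define Z where "Z N = {z \<in> A. AE p in M. \<bar>z p\<bar> \<le> N}" for N :: real
  have ZA: "z \<in> A" and Zm: "z \<in> borel_measurable M" and Zb: "AE p in M. \<bar>z p\<bar> \<le> N" if "z \<in> Z N" for z N
    using that meas by (auto simp: Z_def)
  have Zc: "(\<lambda>_. c) \<in> Z N" if "c \<le> N" for N using that const c_pos by (auto simp: Z_def)
  have Zconv: "(\<lambda>p. (1 - t) * u p + t * v p) \<in> Z N" if "u \<in> Z N" "v \<in> Z N" "0 \<le> t" "t \<le> 1" for u v t N
  proof -
    have "AE p in M. \<bar>(1 - t) * u p + t * v p\<bar> \<le> N" using Zb[OF that(1)] Zb[OF that(2)]
    proof eventually_elim
      case (elim p)
      have "\<bar>(1 - t) * u p + t * v p\<bar> \<le> \<bar>(1 - t) * u p\<bar> + \<bar>t * v p\<bar>" by (rule abs_triangle_ineq)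
      also have "\<dots> \<le> (1 - t) * N + t * N"
        unfolding abs_mult using elim that by (intro add_mono mult_mono) auto
      finally show ?case by (simp add: algebra_simps)
    qed
    then show ?thesis using convex that by (auto simp: Z_def)
  qed
  have Zclosed: "g \<in> Z N" if "\<And>k::nat. x k \<in> Z N" "g \<in> borel_measurable M" "AE p in M. (\<lambda>k. x k p) \<longlonglongrightarrow> g p" for x g N
    using closed[OF ZA Zb, OF that(1) that(1) that(2,3)] AE_abs_le_limit[OF Zb[OF that(1)] that(3)]
    by (simp add: Z_def)
  have cont: "continuous_on UNIV (clip \<kappa>)" "continuous_on UNIV (huber \<kappa>)"
    by (rule continuous_clip continuous_huber)+
  have wg: "integrable M (\<lambda>p. w p * g p)"
    if "g \<in> borel_measurable M" "AE p in M. \<bar>g p\<bar> \<le> 1" for g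
    by (rule integrable_times_AE_bounded[OF w(1) that])
  \<comment> \<open>For each \<open>k\<close> the multipliers that work for positions bounded by
    \<open>c + k\<close> form a midpoint convex set. It shrinks as \<open>k\<close> grows, so
    \<open>decreasing_convex_sets_limit\<close> applies once more.\<close>
  define D where "D k = {g \<in> borel_measurable M. (AE p in M. 0 \<le> g p \<and> g p \<le> 1) \<and>
      (\<forall>z\<in>Z (c + real k). 1/2 \<le> (\<integral>p. w p * g p * z p \<partial>M))}" for k :: nat
  have D_bnd: "AE p in M. \<bar>g p\<bar> \<le> 1" and D_meas: "g \<in> borel_measurable M" if "g \<in> D k" for g k
    using that by (auto simp: D_def)
  have int: "integrable M (\<lambda>p. w p * g p * z p)" if "g \<in> D k" "z \<in> Z N" for g k z N
    by (rule integrable_times_AE_bounded[OF wg[OF D_meas D_bnd] Zm Zb]) (use that in auto)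
  have ne: "D k \<noteq> {}" for k
  proof -
    define N where "N = c + real k"
    have Nc: "(\<lambda>_. c) \<in> Z N" by (rule Zc) (simp add: N_def)
    then have Zne: "Z N \<noteq> {}" by auto
    have wAE: "AE p in M. 0 \<le> w p" by (simp add: w)
    obtain z where z: "z \<in> Z N"
      and first: "\<forall>u\<in>Z N. 0 \<le> (\<integral>p. (0 + w p * clip \<kappa> (z p)) * (u p - z p) \<partial>M)"
      by (rule first_order_minimizer[of "Z N" N "\<lambda>_. 0" w "huber \<kappa>" "clip \<kappa>" "1 / (2 * \<kappa>)",
            OF Zne Zm Zb Zconv Zclosed integrable_zero w(1) wAE cont(2,1) huber_nonneg[OF \<kappa>(1)]
              huber_subgradient[OF \<kappa>(1)] huber_quadratic[OF \<kappa>(1)]])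
    have [measurable]: "z \<in> borel_measurable M" by (rule Zm[OF z])
    define g where "g p = clip \<kappa> (z p)" for p
    have [measurable]: "g \<in> borel_measurable M" unfolding g_def by measurable
    have g01: "0 \<le> g p" "g p \<le> 1" for p by (auto simp: g_def clip_bounds)
    have gi: "integrable M (\<lambda>p. w p * g p * u p)" if "u \<in> Z N" for u
      by (rule integrable_times_AE_bounded[OF wg Zm[OF that] Zb[OF that]]) (use g01 in auto)
    have "AE p in M. \<bar>max 0 (z p)\<bar> \<le> N" using Zb[OF z] by eventually_elim auto
    then have iwm: "integrable M (\<lambda>p. w p * max 0 (z p))"
      by (intro integrable_times_AE_bounded[OF w(1)]) auto
    have "(\<integral>p. w p * max 0 (z p) - \<kappa> / 2 * w p \<partial>M) \<le> (\<integral>p. w p * g p * z p \<partial>M)"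
    proof (rule integral_mono_AE)
      show "integrable M (\<lambda>p. w p * max 0 (z p) - \<kappa> / 2 * w p)"
        using iwm w(1) by simp
      show "AE p in M. w p * max 0 (z p) - \<kappa> / 2 * w p \<le> w p * g p * z p"
      proof (rule AE_I2)
        fix p
        have "w p * (max 0 (z p) - \<kappa> / 2) \<le> w p * (g p * z p)"
          unfolding g_def by (rule mult_left_mono[OF order_trans[OF huber_ge huber_le] w(2)]) (rule \<kappa>(1))+
        then show "w p * max 0 (z p) - \<kappa> / 2 * w p \<le> w p * g p * z p" by (simp add: algebra_simps)
      qed
    qed (rule gi[OF z])
    moreover have "(\<integral>p. w p * max 0 (z p) - \<kappa> / 2 * w p \<partial>M) = (\<integral>p. w p * max 0 (z p) \<partial>M) - \<kappa> / 2 * W"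
      using iwm w(1) by (simp add: W_def)
    ultimately have low: "1/2 \<le> (\<integral>p. w p * g p * z p \<partial>M)" using w1[OF ZA[OF z]] \<kappa>(2) by simp
    have "1/2 \<le> (\<integral>p. w p * g p * u p \<partial>M)" if u: "u \<in> Z N" for u
    proof -
      have "0 \<le> (\<integral>p. w p * g p * u p - w p * g p * z p \<partial>M)"
        using bspec[OF first u] by (simp add: g_def algebra_simps)
      also have "\<dots> = (\<integral>p. w p * g p * u p \<partial>M) - (\<integral>p. w p * g p * z p \<partial>M)"
        using gi[OF u] gi[OF z] by simp
      finally show ?thesis using low by simp
    qed
    then have "g \<in> D k" using g01 by (simp add: D_def N_def)
    then show ?thesis by auto
  qed
  have dec: "decseq D"
  proof (unfold decseq_def, intro allI impI subsetI)
    fix k k' g assume kk: "k \<le> k'" and g: "g \<in> D k'"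
    have "z \<in> Z (c + real k')" if "z \<in> Z (c + real k)" for z
      using that kk by (auto simp: Z_def elim!: eventually_mono)
    with g show "g \<in> D k" unfolding D_def by auto
  qed
  have mid: "(\<lambda>p. (g p + h p) / 2) \<in> D k" if gh: "g \<in> D k" "h \<in> D k" for g h k
  proof -
    have [measurable]: "g \<in> borel_measurable M" "h \<in> borel_measurable M" using gh by (auto simp: D_def)
    have "AE p in M. 0 \<le> g p \<and> g p \<le> 1" "AE p in M. 0 \<le> h p \<and> h p \<le> 1" using gh by (auto simp: D_def)
    then have "AE p in M. 0 \<le> (g p + h p) / 2 \<and> (g p + h p) / 2 \<le> 1" by eventually_elim auto
    moreover have "1/2 \<le> (\<integral>p. w p * ((g p + h p) / 2) * z p \<partial>M)" if z: "z \<in> Z (c + real k)" for z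
    proof -
      have "(\<integral>p. w p * ((g p + h p) / 2) * z p \<partial>M) = (\<integral>p. (w p * g p * z p + w p * h p * z p) / 2 \<partial>M)"
        by (simp add: algebra_simps add_divide_distrib)
      also have "\<dots> = ((\<integral>p. w p * g p * z p \<partial>M) + (\<integral>p. w p * h p * z p \<partial>M)) / 2"
        using int[OF gh(1) z] int[OF gh(2) z] by simp
      finally have eq: "(\<integral>p. w p * ((g p + h p) / 2) * z p \<partial>M) = \<dots>" .
      have "1/2 \<le> (\<integral>p. w p * g p * z p \<partial>M)" "1/2 \<le> (\<integral>p. w p * h p * z p \<partial>M)"
        using gh z unfolding D_def by blast+
      from add_mono[OF this] show ?thesis unfolding eq by simp
    qed
    ultimately show ?thesis by (simp add: D_def)
  qed
  obtain x g where x: "\<And>k::nat. x k \<in> D k" and g[measurable]: "g \<in> borel_measurable M" "AE p in M. \<bar>g p\<bar> \<le> 1"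
    and lim: "AE p in M. (\<lambda>k. x k p) \<longlonglongrightarrow> g p"
    by (rule decreasing_convex_sets_limit[OF ne dec D_meas _ mid]) (auto intro: D_bnd)
  have "AE p in M. \<forall>k. 0 \<le> x k p" using x by (auto simp: AE_all_countable D_def)
  with lim have g0: "AE p in M. 0 \<le> g p" by eventually_elim (auto intro: tendsto_lowerbound)
  \<comment> \<open>The limit \<open>g\<close> is nonnegative only a.e., whereas the separating
    weight is to be nonnegative everywhere.\<close>
  define y where "y p = w p * max 0 (g p)" for p
  have "AE p in M. \<bar>max 0 (g p)\<bar> \<le> 1" using g(2) by eventually_elim auto
  then have "integrable M y" unfolding y_def by (intro wg) auto
  moreover have "0 \<le> y p" for p by (simp add: y_def w)
  moreover have "1/2 \<le> (\<integral>p. y p * a p \<partial>M)" if a: "a \<in> A" for a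
  proof -
    have am[measurable]: "a \<in> borel_measurable M" by (rule meas[OF a])
    obtain C where C: "AE p in M. \<bar>a p\<bar> \<le> C" using a bounded by (auto simp: Linf_def)
    obtain k0 :: nat where k0: "C \<le> real k0" using real_arch_simple by blast
    have aZ: "a \<in> Z (c + real k)" if "k0 \<le> k" for k
    proof -
      have "C \<le> c + real k" using k0 that c_pos by simp
      then have "AE p in M. \<bar>a p\<bar> \<le> c + real k" using C by (auto elim!: eventually_mono)
      then show ?thesis using a by (simp add: Z_def)
    qed
    have wa: "integrable M (\<lambda>p. w p * a p)" by (rule integrable_times_AE_bounded[OF w(1) am C])
    have "(\<lambda>k. \<integral>p. w p * a p * x k p \<partial>M) \<longlonglongrightarrow> (\<integral>p. w p * a p * g p \<partial>M)"
      by (rule integral_times_tendsto[OF wa D_meas[OF x] g(1) D_bnd[OF x] lim])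
    moreover have "\<exists>N. \<forall>k\<ge>N. 1/2 \<le> (\<integral>p. w p * a p * x k p \<partial>M)"
    proof (intro exI[of _ k0] allI impI)
      fix k assume "k0 \<le> k"
      from aZ[OF this] x[of k] show "1/2 \<le> (\<integral>p. w p * a p * x k p \<partial>M)"
        by (auto simp: D_def ac_simps)
    qed
    ultimately have "1/2 \<le> (\<integral>p. w p * a p * g p \<partial>M)" by (rule LIMSEQ_le_const)
    also have "\<dots> = (\<integral>p. y p * a p \<partial>M)"
    proof (rule integral_cong_AE)
      have [measurable]: "w \<in> borel_measurable M" using w(1) by auto
      show "(\<lambda>p. w p * a p * g p) \<in> borel_measurable M" "(\<lambda>p. y p * a p) \<in> borel_measurable M"
        unfolding y_def by measurable
      show "AE p in M. w p * a p * g p = y p * a p" using g0 by eventually_elim (simp add: y_def)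
    qed
    finally show ?thesis .
  qed
  ultimately show ?thesis by (intro that[of y "1/2"]) auto
qed

end

section \<open>Essential suprema and conditional expectations\<close>

text \<open>Exhaustion: a countable subfamily is chosen whose union has the largest possible
  measure. Adding any further \<open>S i\<close> cannot increase that measure, so \<open>S i\<close>
  is covered up to a null set.\<close>

lemma (in finite_measure) countable_essential_union:
  assumes S: "\<And>i. i \<in> I \<Longrightarrow> S i \<in> sets M"
  shows "\<exists>J\<subseteq>I. countable J \<and> (\<forall>i\<in>I. AE p in M. p \<in> S i \<longrightarrow> p \<in> (\<Union>j\<in>J. S j))"
proof -
  define \<J> where "\<J> = {J. J \<subseteq> I \<and> countable J}"
  define m where "m J = measure M (\<Union>j\<in>J. S j)" for J
  have US: "(\<Union>j\<in>J. S j) \<in> sets M" if "J \<in> \<J>" for J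
    using that S by (intro sets.countable_UN'') (auto simp: \<J>_def)
  define s where "s = Sup (m ` \<J>)"
  have bdd: "bdd_above (m ` \<J>)" by (rule bdd_aboveI2[of _ _ "measure M (space M)"]) (simp add: m_def bounded_measure)
  have le: "m J \<le> s" if "J \<in> \<J>" for J unfolding s_def by (rule cSup_upper) (use that bdd in auto)
  have "\<exists>J\<in>\<J>. s - 1 / (real n + 1) < m J" for n
  proof -
    have "{} \<in> \<J>" by (simp add: \<J>_def)
    then obtain y where "y \<in> m ` \<J>" "s - 1 / (real n + 1) < y"
      using less_cSupD[of "m ` \<J>" "s - 1 / (real n + 1)"] unfolding s_def by auto
    then show ?thesis by auto
  qed
  then obtain Jn where Jn: "\<And>n. Jn n \<in> \<J>" "\<And>n. s - 1 / (real n + 1) < m (Jn n)" by metis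
  define J where "J = (\<Union>n. Jn n)"
  have J: "J \<in> \<J>" using Jn(1) by (auto simp: \<J>_def J_def)
  have "s - 1 / (real n + 1) \<le> m J" for n
  proof -
    have "m (Jn n) \<le> m J" unfolding m_def by (rule finite_measure_mono[OF _ US[OF J]]) (auto simp: J_def)
    then show ?thesis using Jn(2)[of n] by simp
  qed
  moreover have "(\<lambda>n. s - 1 / (real n + 1)) \<longlonglongrightarrow> s - 0"
    using LIMSEQ_inverse_real_of_nat by (intro tendsto_intros) (simp add: inverse_eq_divide add.commute)
  ultimately have sJ: "s \<le> m J" using LIMSEQ_le_const2 by fastforce
  have "AE p in M. p \<in> S i \<longrightarrow> p \<in> (\<Union>j\<in>J. S j)" if i: "i \<in> I" for i
  proof -
    have iJ: "insert i J \<in> \<J>" using i J by (auto simp: \<J>_def)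
    have "measure M (S i \<union> (\<Union>j\<in>J. S j)) \<le> measure M (\<Union>j\<in>J. S j)"
      using le[OF iJ] sJ by (simp add: m_def)
    moreover have "measure M (S i \<union> (\<Union>j\<in>J. S j)) = measure M (S i - (\<Union>j\<in>J. S j)) + measure M (\<Union>j\<in>J. S j)"
      using finite_measure_Union[of "S i - (\<Union>j\<in>J. S j)" "\<Union>j\<in>J. S j"] S[OF i] US[OF J] by auto
    ultimately have "measure M (S i - (\<Union>j\<in>J. S j)) = 0" by (simp add: measure_le_0_iff)
    then have "AE p in M. p \<notin> S i - (\<Union>j\<in>J. S j)"
      using S[OF i] US[OF J] by (intro AE_not_in) (auto simp: null_sets_def emeasure_eq_measure)
    then show ?thesis by eventually_elim auto
  qed
  then show ?thesis using J by (auto simp: \<J>_def)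
qed

lemma indicator_nn_integral_0_AE:
  assumes "A \<in> sets M" "h \<in> borel_measurable M" "(\<integral>\<^sup>+p. indicator A p * h p \<partial>M) = 0"
  shows "AE p in M. p \<in> A \<longrightarrow> h p = (0 :: ennreal)"
proof -
  have "AE p in M. indicator A p * h p = 0"
    using assms by (subst (asm) nn_integral_0_iff_AE) auto
  then show ?thesis by eventually_elim (auto simp: indicator_def)
qed

locale prob_subalgebra = prob_space M for M :: "'a measure" +
  fixes F :: "'a measure"
  assumes subalg: "subalgebra M F"

sublocale prob_subalgebra \<subseteq> finite_measure_subalgebra M F
  by unfold_locales (rule subalg)

context prob_subalgebra
begin

lemma F_M: "h \<in> measurable F N \<Longrightarrow> h \<in> measurable M N"
  by (rule measurable_from_subalg[OF subalg])

lemma F_sets: "A \<in> sets F \<Longrightarrow> A \<in> sets M"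
  using subalg by (auto simp: subalgebra_def)

lemma space_F: "space F = space M"
  using subalg by (simp add: subalgebra_def)

text \<open>If \<open>a p\<close> exceeds the supremum of the countable family, a rational
  \<open>q\<close> lies strictly between the two. It is therefore enough to cover, for each
  \<open>q\<close>, the sets where a member exceeds \<open>q\<close> by countably many sets of the
  same kind.\<close>

lemma ex_is_cond_Sup:
  assumes A: "A \<subseteq> borel_measurable F"
  shows "\<exists>B\<subseteq>A. countable B \<and> is_cond_Sup M F A (\<lambda>p. SUP b\<in>B. b p)"
proof -
  define S where "S q a = {p \<in> space M. ereal (real_of_rat q) < a p}" for q and a :: "'a \<Rightarrow> ereal"
  have "\<exists>J\<subseteq>A. countable J \<and> (\<forall>a\<in>A. AE p in M. p \<in> S q a \<longrightarrow> p \<in> (\<Union>j\<in>J. S q j))" for q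
  proof (rule countable_essential_union)
    fix a assume "a \<in> A"
    then have [measurable]: "a \<in> borel_measurable M" using A F_M by auto
    show "S q a \<in> sets M" unfolding S_def by measurable
  qed
  then obtain J where J: "\<And>q. J q \<subseteq> A" "\<And>q. countable (J q)"
    "\<And>q a. a \<in> A \<Longrightarrow> AE p in M. p \<in> S q a \<longrightarrow> p \<in> (\<Union>j\<in>J q. S q j)" by metis
  define B where "B = (\<Union>q. J q)"
  have B: "B \<subseteq> A" "countable B" using J by (auto simp: B_def)
  have "is_cond_Sup M F A (\<lambda>p. SUP b\<in>B. b p)"
    unfolding is_cond_Sup_def
  proof (intro conjI ballI impI)
    show "(\<lambda>p. SUP b\<in>B. b p) \<in> borel_measurable F"
      by (rule borel_measurable_SUP) (use A B in auto)
  next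
    fix a assume a: "a \<in> A"
    have "AE p in M. \<forall>q. p \<in> S q a \<longrightarrow> p \<in> (\<Union>j\<in>J q. S q j)"
      using J(3)[OF a] by (simp add: AE_all_countable)
    moreover have "AE p in M. p \<in> space M" by simp
    ultimately show "AE p in M. a p \<le> (SUP b\<in>B. b p)"
    proof eventually_elim
      case (elim p)
      show ?case
      proof (rule ccontr)
        assume "\<not> ?case"
        then obtain q where q: "(SUP b\<in>B. b p) < ereal (real_of_rat q)" "ereal (real_of_rat q) < a p"
          using ereal_dense3[of "SUP b\<in>B. b p" "a p"] by (auto simp: not_le)
        then have "p \<in> S q a" using elim(2) by (simp add: S_def)
        with elim(1) obtain j where "j \<in> J q" "ereal (real_of_rat q) < j p" by (auto simp: S_def)
        moreover have "j p \<le> (SUP b\<in>B. b p)" using \<open>j \<in> J q\<close> by (intro SUP_upper) (auto simp: B_def)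
        ultimately show False using q(1) by (meson less_le_trans less_asym)
      qed
    qed
  next
    fix t assume "t \<in> borel_measurable F" and t: "\<forall>a\<in>A. AE p in M. a p \<le> t p"
    have "AE p in M. \<forall>b\<in>B. b p \<le> t p"
      using t B by (subst AE_ball_countable) auto
    then show "AE p in M. (SUP b\<in>B. b p) \<le> t p"
      by eventually_elim (auto intro: SUP_least)
  qed
  with B show ?thesis by blast
qed

lemma is_cond_Sup_cond_Sup:
  assumes "A \<subseteq> borel_measurable F"
  shows "is_cond_Sup M F A (cond_Sup M F A)"
proof -
  obtain s where "is_cond_Sup M F A s" using ex_is_cond_Sup[OF assms] by auto
  then show ?thesis unfolding cond_Sup_def by (rule someI[of "is_cond_Sup M F A"])
qed

lemma cond_Sup_measurable: "A \<subseteq> borel_measurable F \<Longrightarrow> cond_Sup M F A \<in> borel_measurable F"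
  using is_cond_Sup_cond_Sup by (auto simp: is_cond_Sup_def)

lemma cond_Sup_upper: "A \<subseteq> borel_measurable F \<Longrightarrow> a \<in> A \<Longrightarrow> AE p in M. a p \<le> cond_Sup M F A p"
  using is_cond_Sup_cond_Sup by (auto simp: is_cond_Sup_def)

lemma cond_Sup_least:
  "A \<subseteq> borel_measurable F \<Longrightarrow> t \<in> borel_measurable F \<Longrightarrow> (\<And>a. a \<in> A \<Longrightarrow> AE p in M. a p \<le> t p) \<Longrightarrow>
    AE p in M. cond_Sup M F A p \<le> t p"
  using is_cond_Sup_cond_Sup by (auto simp: is_cond_Sup_def)

lemma cond_Sup_countable:
  assumes "A \<subseteq> borel_measurable F"
  obtains B where "B \<subseteq> A" "countable B" "AE p in M. cond_Sup M F A p = (SUP b\<in>B. b p)"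
proof -
  obtain B where "B \<subseteq> A" "countable B" "is_cond_Sup M F A (\<lambda>p. SUP b\<in>B. b p)"
    using ex_is_cond_Sup[OF assms] by blast
  then show ?thesis by (intro that[of B] is_cond_Sup_unique[OF is_cond_Sup_cond_Sup[OF assms]])
qed

lemma ex_is_cond_Inf:
  assumes A: "A \<subseteq> borel_measurable F"
  shows "\<exists>B\<subseteq>A. countable B \<and> is_cond_Inf M F A (\<lambda>p. INF b\<in>B. b p)"
proof -
  define A' where "A' = (\<lambda>a p. - a p) ` A"
  have "A' \<subseteq> borel_measurable F" using A by (auto simp: A'_def)
  then obtain B' where B': "B' \<subseteq> A'" "countable B'" "is_cond_Sup M F A' (\<lambda>p. SUP b\<in>B'. b p)"
    using ex_is_cond_Sup by blast
  obtain B where B: "B \<subseteq> A" "B' = (\<lambda>a p. - a p) ` B" "countable B"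
    using B'(1,2) unfolding A'_def by (metis countable_subset_image)
  have INF: "(INF b\<in>B. b p) = - (SUP b\<in>B'. b p)" for p
    unfolding B(2) image_image ereal_SUP_uminus_eq by simp
  have "is_cond_Inf M F A (\<lambda>p. INF b\<in>B. b p)"
    unfolding is_cond_Inf_def
  proof (intro conjI ballI impI)
    show "(\<lambda>p. INF b\<in>B. b p) \<in> borel_measurable F"
      by (rule borel_measurable_INF) (use A B in auto)
  next
    fix a assume "a \<in> A"
    then have "AE p in M. - a p \<le> (SUP b\<in>B'. b p)"
      using B'(3) by (auto simp: is_cond_Sup_def A'_def)
    then show "AE p in M. (INF b\<in>B. b p) \<le> a p"
      unfolding INF by eventually_elim (simp add: ereal_uminus_le_reorder)
  next
    fix t assume t: "t \<in> borel_measurable F" "\<forall>a\<in>A. AE p in M. t p \<le> a p"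
    then have "(\<lambda>p. - t p) \<in> borel_measurable F" "\<forall>a\<in>A'. AE p in M. a p \<le> - t p"
      by (auto simp: A'_def)
    then have "AE p in M. (SUP b\<in>B'. b p) \<le> - t p"
      using B'(3) by (auto simp: is_cond_Sup_def)
    then show "AE p in M. t p \<le> (INF b\<in>B. b p)"
      unfolding INF by eventually_elim (metis ereal_minus_le_minus ereal_uminus_uminus)
  qed
  with B show ?thesis by blast
qed

section \<open>Conditional norms, locality of conditional expectations, and the pairing\<close>

lemma cond_norm_inf_countable:
  obtains B where "countable B" "B \<subseteq> {\<xi> \<in> borel_measurable F. (AE p in M. 0 \<le> \<xi> p) \<and> (AE p in M. ereal \<bar>x p\<bar> \<le> \<xi> p)}"
    "is_cond_Inf M F {\<xi> \<in> borel_measurable F. (AE p in M. 0 \<le> \<xi> p) \<and> (AE p in M. ereal \<bar>x p\<bar> \<le> \<xi> p)} (cond_norm_inf M F x)"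
    "AE p in M. cond_norm_inf M F x p = (INF b\<in>B. b p)"
proof -
  let ?A = "{\<xi> \<in> borel_measurable F. (AE p in M. 0 \<le> \<xi> p) \<and> (AE p in M. ereal \<bar>x p\<bar> \<le> \<xi> p)}"
  obtain B where B: "B \<subseteq> ?A" "countable B" "is_cond_Inf M F ?A (\<lambda>p. INF b\<in>B. b p)"
    using ex_is_cond_Inf[of ?A] by blast
  have "is_cond_Inf M F ?A (cond_norm_inf M F x)"
    unfolding cond_norm_inf_def cond_Inf_def by (rule someI[of "is_cond_Inf M F ?A", OF B(3)])
  with B show ?thesis by (intro that[OF B(2,1)] is_cond_Inf_unique)
qed

lemma cond_norm_inf_le:
  assumes "\<xi> \<in> borel_measurable F" "AE p in M. 0 \<le> \<xi> p" "AE p in M. ereal \<bar>x p\<bar> \<le> \<xi> p"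
  shows "AE p in M. cond_norm_inf M F x p \<le> \<xi> p"
  by (rule cond_norm_inf_countable[of x]) (use assms in \<open>auto simp: is_cond_Inf_def\<close>)

lemma cond_norm_inf_ge: "AE p in M. ereal \<bar>x p\<bar> \<le> cond_norm_inf M F x p"
proof -
  obtain B where B: "countable B" "\<And>b. b \<in> B \<Longrightarrow> AE p in M. ereal \<bar>x p\<bar> \<le> b p"
    "AE p in M. cond_norm_inf M F x p = (INF b\<in>B. b p)"
    by (rule cond_norm_inf_countable[of x]) blast
  have "AE p in M. \<forall>b\<in>B. ereal \<bar>x p\<bar> \<le> b p" using B by (subst AE_ball_countable) auto
  with B(3) show ?thesis by eventually_elim (auto intro: INF_greatest)
qed

lemma cond_norm_inf_measurable: "cond_norm_inf M F x \<in> borel_measurable F"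
  by (rule cond_norm_inf_countable[of x]) (simp add: is_cond_Inf_def)

text \<open>The conditional norm is itself an \<open>F\<close>-measurable majorant by
  \<open>cond_norm_inf_ge\<close>, and it becomes real valued where it is finite; conversely, every
  real majorant bounds the norm.\<close>

lemma LFinf_iff: "x \<in> LFinf M F \<longleftrightarrow> x \<in> borel_measurable M \<and> (\<exists>\<xi>\<in>borel_measurable F. AE p in M. \<bar>x p\<bar> \<le> \<xi> p)"
proof
  assume x: "x \<in> LFinf M F"
  have "AE p in M. \<bar>x p\<bar> \<le> real_of_ereal (cond_norm_inf M F x p)"
  proof -
    have "AE p in M. cond_norm_inf M F x p < \<infinity>" using x by (simp add: LFinf_def)
    with cond_norm_inf_ge[of x] show ?thesis
    proof eventually_elim
      case (elim p)
      then show ?case by (cases "cond_norm_inf M F x p") auto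
    qed
  qed
  then show "x \<in> borel_measurable M \<and> (\<exists>\<xi>\<in>borel_measurable F. AE p in M. \<bar>x p\<bar> \<le> \<xi> p)"
    using x cond_norm_inf_measurable[of x]
    by (auto simp: LFinf_def L0_def intro!: bexI[of _ "\<lambda>p. real_of_ereal (cond_norm_inf M F x p)"])
next
  assume "x \<in> borel_measurable M \<and> (\<exists>\<xi>\<in>borel_measurable F. AE p in M. \<bar>x p\<bar> \<le> \<xi> p)"
  then obtain \<xi> where x: "x \<in> borel_measurable M" and \<xi>: "\<xi> \<in> borel_measurable F" "AE p in M. \<bar>x p\<bar> \<le> \<xi> p" by auto
  have "AE p in M. cond_norm_inf M F x p \<le> ereal (\<xi> p)"
    by (rule cond_norm_inf_le) (use \<xi> in \<open>auto elim!: eventually_mono\<close>)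
  then have "AE p in M. cond_norm_inf M F x p < \<infinity>" by eventually_elim auto
  with x show "x \<in> LFinf M F" by (simp add: LFinf_def L0_def)
qed

lemma Linf_subset_LFinf: "Linf M M \<subseteq> LFinf M F"
proof
  fix x assume "x \<in> Linf M M"
  then obtain C where "x \<in> borel_measurable M" "AE p in M. \<bar>x p\<bar> \<le> C" by (auto simp: Linf_def L0_def)
  then show "x \<in> LFinf M F" by (auto simp: LFinf_iff intro!: bexI[of _ "\<lambda>_. C"])
qed

lemma LF1_iff: "y \<in> LF1 M F \<longleftrightarrow> y \<in> borel_measurable M \<and> (AE p in M. nn_cond_exp M F (\<lambda>p. ennreal \<bar>y p\<bar>) p < \<infinity>)"
  by (simp add: LF1_def cond_norm_1_def L0_def)

text \<open>The indicator of a set of \<open>F\<close> can be taken out of the conditional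
  expectation, and \<open>g\<close> and \<open>h\<close> agree a.e. once multiplied by it. The
  locality of the pairing rests on this.\<close>

lemma nn_cond_exp_local:
  assumes A: "A \<in> sets F" and [measurable]: "g \<in> borel_measurable M" "h \<in> borel_measurable M"
    and eq: "AE p in M. p \<in> A \<longrightarrow> g p = h p"
  shows "AE p in M. p \<in> A \<longrightarrow> nn_cond_exp M F g p = nn_cond_exp M F h p"
proof -
  have [measurable]: "A \<in> sets M" "A \<in> sets F" using A F_sets by auto
  have 1: "AE p in M. indicator A p * nn_cond_exp M F u p = nn_cond_exp M F (\<lambda>p. indicator A p * u p) p"
    if "u \<in> borel_measurable M" for u
    by (rule nn_cond_exp_prod) (use that in auto)
  have "AE p in M. nn_cond_exp M F (\<lambda>p. indicator A p * g p) p = nn_cond_exp M F (\<lambda>p. indicator A p * h p) p"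
    by (rule nn_cond_exp_cong) (use eq in \<open>auto simp: indicator_def elim!: eventually_mono\<close>)
  with 1[of g, simplified] 1[of h, simplified] show ?thesis
    by eventually_elim (auto simp: indicator_def)
qed

lemma real_cond_exp_local:
  assumes A: "A \<in> sets F" and [measurable]: "g \<in> borel_measurable M" "h \<in> borel_measurable M"
    and eq: "AE p in M. p \<in> A \<longrightarrow> g p = h p"
  shows "AE p in M. p \<in> A \<longrightarrow> real_cond_exp M F g p = real_cond_exp M F h p"
proof -
  have "AE p in M. p \<in> A \<longrightarrow> nn_cond_exp M F (\<lambda>p. ennreal (g p)) p = nn_cond_exp M F (\<lambda>p. ennreal (h p)) p"
    by (rule nn_cond_exp_local[OF A]) (use eq in \<open>auto elim!: eventually_mono\<close>)
  moreover have "AE p in M. p \<in> A \<longrightarrow> nn_cond_exp M F (\<lambda>p. ennreal (- g p)) p = nn_cond_exp M F (\<lambda>p. ennreal (- h p)) p"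
    by (rule nn_cond_exp_local[OF A]) (use eq in \<open>auto elim!: eventually_mono\<close>)
  ultimately show ?thesis unfolding real_cond_exp_def by eventually_elim auto
qed

lemma L1_subset_LF1: "L1 M \<subseteq> LF1 M F"
proof
  fix y assume "y \<in> L1 M"
  then have y: "integrable M y" by (simp add: L1_def)
  then have [measurable]: "y \<in> borel_measurable M" by auto
  have "(\<integral>\<^sup>+p. nn_cond_exp M F (\<lambda>p. ennreal \<bar>y p\<bar>) p \<partial>M) = (\<integral>\<^sup>+p. ennreal \<bar>y p\<bar> \<partial>M)"
    using nn_cond_exp_intg[of "\<lambda>_. 1" "\<lambda>p. ennreal \<bar>y p\<bar>"] by simp
  also have "\<dots> < \<infinity>" using y by (simp add: integrable_iff_bounded)
  finally have "AE p in M. nn_cond_exp M F (\<lambda>p. ennreal \<bar>y p\<bar>) p \<noteq> \<infinity>"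
    by (intro nn_integral_PInf_AE) auto
  then show "y \<in> LF1 M F" by (simp add: LF1_iff less_top)
qed

text \<open>The conditional expectation of \<open>\<bar>y\<bar>\<close> has the same integral as
  \<open>\<bar>y\<bar>\<close> over every set of \<open>F\<close>, in particular over the set where
  it is at most \<open>k\<close>. Statements about \<open>LF1 M F\<close> reduce in this way to
  integrable variables.\<close>

lemma LF1_exhaust:
  assumes "y \<in> LF1 M F"
  obtains A :: "nat \<Rightarrow> 'a set" where "\<forall>k. A k \<in> sets F" "\<forall>k. integrable M (\<lambda>p. indicator (A k) p * y p)"
    "incseq A" "AE p in M. \<exists>k. p \<in> A k"
proof -
  define N where "N = nn_cond_exp M F (\<lambda>p. ennreal \<bar>y p\<bar>)"
  define A where "A k = {p \<in> space F. N p \<le> of_nat k}" for k :: nat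
  have [measurable]: "N \<in> borel_measurable F" unfolding N_def by simp
  have y[measurable]: "y \<in> borel_measurable M" using assms by (simp add: LF1_iff)
  have AF[measurable]: "A k \<in> sets F" for k unfolding A_def by measurable
  have AM[measurable]: "A k \<in> sets M" for k using AF F_sets by blast
  have "integrable M (\<lambda>p. indicator (A k) p * y p)" for k
  proof (rule integrableI_bounded)
    have "(\<integral>\<^sup>+p. ennreal (norm (indicator (A k) p * y p)) \<partial>M) = (\<integral>\<^sup>+p. indicator (A k) p * ennreal \<bar>y p\<bar> \<partial>M)"
      by (rule nn_integral_cong) (auto simp: indicator_def)
    also have "\<dots> = (\<integral>\<^sup>+p. indicator (A k) p * N p \<partial>M)"
      unfolding N_def by (rule nn_cond_exp_intg[symmetric]) auto
    also have "\<dots> \<le> (\<integral>\<^sup>+p. of_nat k \<partial>M)"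
      by (rule nn_integral_mono) (auto simp: indicator_def A_def)
    also have "\<dots> < \<infinity>" by (simp add: emeasure_space_1 ennreal_of_nat_eq_real_of_nat[symmetric] of_nat_less_top)
    finally show "(\<integral>\<^sup>+p. ennreal (norm (indicator (A k) p * y p)) \<partial>M) < \<infinity>" .
  qed auto
  moreover have "incseq A"
  proof (unfold incseq_def, intro allI impI subsetI)
    fix m n :: nat and p assume "m \<le> n" "p \<in> A m"
    then have "N p \<le> of_nat m" "(of_nat m :: ennreal) \<le> of_nat n" by (auto simp: A_def intro: of_nat_mono)
    then have "N p \<le> of_nat n" by (rule order_trans)
    then show "p \<in> A n" using \<open>p \<in> A m\<close> by (simp add: A_def)
  qed
  moreover have "AE p in M. \<exists>k. p \<in> A k"
  proof -
    have "AE p in M. N p < \<infinity>" using assms by (simp add: LF1_iff N_def)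
    moreover have "AE p in M. p \<in> space M" by simp
    ultimately show ?thesis
    proof eventually_elim
      case (elim p)
      then obtain k :: nat where "N p \<le> of_nat k" using ennreal_Ex_less_of_nat by (metis infinity_ennreal_def less_imp_le)
      then show ?case using elim by (auto simp: A_def space_F)
    qed
  qed
  ultimately show ?thesis using AF by (intro that[of A]) auto
qed

text \<open>Linearity holds for the integrable truncations; locality transfers it to the sets
  \<open>A k \<inter> B l\<close>, which cover almost everything.\<close>

lemma real_cond_exp_diff_LF1:
  assumes "y \<in> LF1 M F" "z \<in> LF1 M F"
  shows "AE p in M. real_cond_exp M F (\<lambda>p. y p - z p) p = real_cond_exp M F y p - real_cond_exp M F z p"
proof -
  obtain A :: "nat \<Rightarrow> 'a set" where A: "\<forall>k. A k \<in> sets F" "\<forall>k. integrable M (\<lambda>p. indicator (A k) p * y p)"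
    "incseq A" "AE p in M. \<exists>k. p \<in> A k" by (rule LF1_exhaust[OF assms(1)])
  obtain B :: "nat \<Rightarrow> 'a set" where B: "\<forall>k. B k \<in> sets F" "\<forall>k. integrable M (\<lambda>p. indicator (B k) p * z p)"
    "incseq B" "AE p in M. \<exists>k. p \<in> B k" by (rule LF1_exhaust[OF assms(2)])
  have [measurable]: "y \<in> borel_measurable M" "z \<in> borel_measurable M" using assms by (auto simp: LF1_iff)
  have C[measurable]: "A k \<in> sets M" "B k \<in> sets M" for k using A B F_sets by auto
  have loc: "AE p in M. p \<in> A k \<inter> B l \<longrightarrow>
      real_cond_exp M F (\<lambda>p. y p - z p) p = real_cond_exp M F y p - real_cond_exp M F z p" for k l
  proof -
    let ?y = "\<lambda>p. indicator (A k) p * y p" and ?z = "\<lambda>p. indicator (B l) p * z p"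
    have AB: "A k \<inter> B l \<in> sets F" using A B by auto
    have "AE p in M. real_cond_exp M F (\<lambda>p. ?y p - ?z p) p = real_cond_exp M F ?y p - real_cond_exp M F ?z p"
      by (rule real_cond_exp_diff) (use A B in auto)
    moreover have "AE p in M. p \<in> A k \<inter> B l \<longrightarrow> real_cond_exp M F (\<lambda>p. ?y p - ?z p) p = real_cond_exp M F (\<lambda>p. y p - z p) p"
      by (rule real_cond_exp_local[OF AB]) auto
    moreover have "AE p in M. p \<in> A k \<inter> B l \<longrightarrow> real_cond_exp M F ?y p = real_cond_exp M F y p"
      by (rule real_cond_exp_local[OF AB]) auto
    moreover have "AE p in M. p \<in> A k \<inter> B l \<longrightarrow> real_cond_exp M F ?z p = real_cond_exp M F z p"
      by (rule real_cond_exp_local[OF AB]) auto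
    ultimately show ?thesis by eventually_elim auto
  qed
  have "AE p in M. \<forall>k l. p \<in> A k \<inter> B l \<longrightarrow>
      real_cond_exp M F (\<lambda>p. y p - z p) p = real_cond_exp M F y p - real_cond_exp M F z p"
    unfolding AE_all_countable using loc by blast
  with A(4) B(4) show ?thesis by eventually_elim auto
qed

lemma LFinf_times_LF1:
  assumes "x \<in> LFinf M F" "y \<in> LF1 M F"
  shows "(\<lambda>p. x p * y p) \<in> LF1 M F"
proof -
  obtain \<xi> where x[measurable]: "x \<in> borel_measurable M" and \<xi>[measurable]: "\<xi> \<in> borel_measurable F"
    and le: "AE p in M. \<bar>x p\<bar> \<le> \<xi> p" using assms(1) by (auto simp: LFinf_iff)
  have y[measurable]: "y \<in> borel_measurable M" and fin: "AE p in M. nn_cond_exp M F (\<lambda>p. ennreal \<bar>y p\<bar>) p < \<infinity>"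
    using assms(2) by (auto simp: LF1_iff)
  have [measurable]: "\<xi> \<in> borel_measurable M" by (rule F_M[OF \<xi>])
  have "AE p in M. nn_cond_exp M F (\<lambda>p. ennreal \<bar>x p * y p\<bar>) p \<le> nn_cond_exp M F (\<lambda>p. ennreal (\<xi> p) * ennreal \<bar>y p\<bar>) p"
  proof (rule nn_cond_exp_mono)
    show "AE p in M. ennreal \<bar>x p * y p\<bar> \<le> ennreal (\<xi> p) * ennreal \<bar>y p\<bar>"
      using le by eventually_elim (auto simp: abs_mult ennreal_mult''[symmetric] intro!: ennreal_leI mult_right_mono)
  qed auto
  moreover have "AE p in M. ennreal (\<xi> p) * nn_cond_exp M F (\<lambda>p. ennreal \<bar>y p\<bar>) p = nn_cond_exp M F (\<lambda>p. ennreal (\<xi> p) * ennreal \<bar>y p\<bar>) p"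
    by (rule nn_cond_exp_prod) auto
  ultimately have "AE p in M. nn_cond_exp M F (\<lambda>p. ennreal \<bar>x p * y p\<bar>) p < \<infinity>"
    using fin
  proof eventually_elim
    case (elim p)
    have "ennreal (\<xi> p) * nn_cond_exp M F (\<lambda>p. ennreal \<bar>y p\<bar>) p < \<infinity>"
      using elim(3) by (simp add: ennreal_mult_less_top)
    with elim show ?case by (metis le_less_trans)
  qed
  then show ?thesis by (simp add: LF1_iff)
qed

abbreviation pairing :: "('a \<Rightarrow> real) \<Rightarrow> ('a \<Rightarrow> real) \<Rightarrow> 'a \<Rightarrow> real" where
  "pairing \<equiv> cond_pairing M F"

lemma cond_pairing_diff:
  assumes "x \<in> LFinf M F" "x' \<in> LFinf M F" "y \<in> LF1 M F"
  shows "AE p in M. pairing (\<lambda>p. x p - x' p) y p = pairing x y p - pairing x' y p"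
  using real_cond_exp_diff_LF1[OF LFinf_times_LF1[OF assms(1,3)] LFinf_times_LF1[OF assms(2,3)]]
  by (simp add: cond_pairing_def left_diff_distrib)

lemma cond_pairing_local:
  assumes A: "A \<in> sets F" and [measurable]: "x \<in> borel_measurable M" "x' \<in> borel_measurable M" "y \<in> borel_measurable M"
    and eq: "AE p in M. p \<in> A \<longrightarrow> x p = x' p"
  shows "AE p in M. p \<in> A \<longrightarrow> pairing x y p = pairing x' y p"
  unfolding cond_pairing_def
  by (rule real_cond_exp_local[OF A]) (use eq in \<open>auto elim!: eventually_mono\<close>)

lemma cond_pairing_measurable [measurable]: "pairing x y \<in> borel_measurable F"
  by (simp add: cond_pairing_def)

text \<open>The conditional expectations \<open>h n\<close> decrease along the sequence, hence
  converge a.e. to their infimum. Ordinary dominated convergence on each \<open>A k\<close>, where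
  \<open>y\<close> is integrable, forces the integral of this infimum to be 0. Monotonicity is what
  turns convergence of the integrals into convergence a.e. of the whole sequence.\<close>

lemma cond_pairing_decseq_tendsto_0:
  assumes X: "\<And>n. X n \<in> borel_measurable M" and C: "\<And>n. AE p in M. \<bar>X n p\<bar> \<le> C" and y: "y \<in> LF1 M F"
    and dec: "AE p in M. decseq (\<lambda>n. X n p) \<and> (\<lambda>n. X n p) \<longlonglongrightarrow> 0"
  shows "AE p in M. (\<lambda>n. pairing (X n) y p) \<longlonglongrightarrow> 0"
proof -
  have [measurable]: "X n \<in> borel_measurable M" for n by (rule X)
  have [measurable]: "y \<in> borel_measurable M" using y by (simp add: LF1_iff)
  define d where "d n p = ennreal \<bar>X n p * y p\<bar>" for n p
  have [measurable]: "d n \<in> borel_measurable M" for n unfolding d_def by measurable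
  define h where "h n = nn_cond_exp M F (d n)" for n
  have [measurable]: "h n \<in> borel_measurable F" for n unfolding h_def by simp
  have [measurable]: "h n \<in> borel_measurable M" for n by (rule F_M) simp
  have nonneg: "AE p in M. \<forall>n. 0 \<le> X n p"
    using dec by eventually_elim (auto intro: decseq_ge)
  have "AE p in M. h (Suc n) p \<le> h n p" for n
    unfolding h_def
  proof (rule nn_cond_exp_mono)
    show "AE p in M. d (Suc n) p \<le> d n p"
      using dec nonneg
    proof eventually_elim
      case (elim p)
      then have "X (Suc n) p \<le> X n p" by (auto simp: decseq_Suc_iff)
      then show ?case using elim unfolding d_def abs_mult by (intro ennreal_leI mult_right_mono) auto
    qed
  qed auto
  then have hdec: "AE p in M. decseq (\<lambda>n. h n p)"
    unfolding decseq_Suc_iff by (simp add: AE_all_countable)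
  obtain A :: "nat \<Rightarrow> 'a set" where A: "\<forall>k. A k \<in> sets F" "\<forall>k. integrable M (\<lambda>p. indicator (A k) p * y p)"
    "AE p in M. \<exists>k. p \<in> A k" by (rule LF1_exhaust[OF y])
  have [measurable]: "A k \<in> sets F" "A k \<in> sets M" for k using A F_sets by auto
  have "AE p in M. p \<in> A k \<longrightarrow> (INF n. h n p) = 0" for k
  proof (rule indicator_nn_integral_0_AE)
    have iy: "integrable M (\<lambda>p. indicator (A k) p * y p)" using A by simp
    have "(\<lambda>n. \<integral>\<^sup>+p. indicator (A k) p * d n p \<partial>M) \<longlonglongrightarrow> (\<integral>\<^sup>+p. 0 \<partial>M)"
    proof (rule nn_integral_dominated_convergence[where w = "\<lambda>p. ennreal (norm (C * (indicator (A k) p * y p)))"])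
      have "integrable M (\<lambda>p. C * (indicator (A k) p * y p))" using iy by simp
      then show "(\<integral>\<^sup>+p. ennreal (norm (C * (indicator (A k) p * y p))) \<partial>M) < \<infinity>"
        by (rule integrable_iff_bounded[THEN iffD1, THEN conjunct2])
      show "AE p in M. indicator (A k) p * d n p \<le> ennreal (norm (C * (indicator (A k) p * y p)))" for n
        using C[of n]
      proof eventually_elim
        case (elim p)
        then have "\<bar>X n p * y p\<bar> \<le> norm (C * y p)" unfolding abs_mult real_norm_def by (intro mult_right_mono) auto
        then show ?case by (auto simp: d_def indicator_def intro!: ennreal_leI)
      qed
      show "AE p in M. (\<lambda>n. indicator (A k) p * d n p) \<longlonglongrightarrow> 0"
        using dec
      proof eventually_elim
        case (elim p)
        then have "(\<lambda>n. \<bar>X n p * y p\<bar>) \<longlonglongrightarrow> \<bar>0 * y p\<bar>" by (intro tendsto_intros) auto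
        then have "(\<lambda>n. d n p) \<longlonglongrightarrow> ennreal 0" unfolding d_def by (intro tendsto_ennrealI) simp
        then show ?case by (cases "p \<in> A k") auto
      qed
    qed auto
    moreover have "(\<integral>\<^sup>+p. indicator (A k) p * d n p \<partial>M) = (\<integral>\<^sup>+p. indicator (A k) p * h n p \<partial>M)" for n
      unfolding h_def by (rule nn_cond_exp_intg[symmetric]) auto
    ultimately have "(\<lambda>n. \<integral>\<^sup>+p. indicator (A k) p * h n p \<partial>M) \<longlonglongrightarrow> 0" by simp
    moreover have "(\<integral>\<^sup>+p. indicator (A k) p * (INF n. h n p) \<partial>M) \<le> (\<integral>\<^sup>+p. indicator (A k) p * h n p \<partial>M)" for n
      by (rule nn_integral_mono) (auto intro!: mult_left_mono INF_lower)
    ultimately have "(\<integral>\<^sup>+p. indicator (A k) p * (INF n. h n p) \<partial>M) \<le> 0"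
      by (intro LIMSEQ_le_const) auto
    then show "(\<integral>\<^sup>+p. indicator (A k) p * (INF n. h n p) \<partial>M) = 0" by simp
  qed auto
  then have "AE p in M. \<forall>k. p \<in> A k \<longrightarrow> (INF n. h n p) = 0"
    unfolding AE_all_countable by blast
  with A(3) hdec have h0: "AE p in M. (\<lambda>n. h n p) \<longlonglongrightarrow> 0"
  proof eventually_elim
    case (elim p)
    then have "(INF n. h n p) = 0" by auto
    with LIMSEQ_INF[OF elim(2)] show ?case by simp
  qed
  have "AE p in M. ennreal \<bar>pairing (X n) y p\<bar> \<le> h n p" for n
    unfolding cond_pairing_def h_def d_def by (rule real_cond_exp_abs) simp
  then have "AE p in M. \<forall>n. ennreal \<bar>pairing (X n) y p\<bar> \<le> h n p" by (simp add: AE_all_countable)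
  with h0 show ?thesis
  proof eventually_elim
    case (elim p)
    have "(\<lambda>n. ennreal \<bar>pairing (X n) y p\<bar>) \<longlonglongrightarrow> 0"
      by (rule tendsto_sandwich[OF _ _ tendsto_const elim(1)]) (use elim(2) in auto)
    then show ?case by (simp add: ennreal_tendsto_0_iff tendsto_rabs_zero_iff del: tendsto_ennreal_iff)
  qed
qed

end

section \<open>Conditional risk measures and their extensions\<close>

lemma Linf_iff: "x \<in> Linf M F \<longleftrightarrow> x \<in> borel_measurable F \<and> (\<exists>C. AE p in M. \<bar>x p\<bar> \<le> C)"
  by (simp add: Linf_def L0_def)

lemma Linf_const: "(\<lambda>_. c) \<in> Linf M F"
  by (auto simp: Linf_iff)

lemma Linf_add:
  assumes "x \<in> Linf M F" "y \<in> Linf M F"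
  shows "(\<lambda>p. x p + y p) \<in> Linf M F"
proof -
  obtain C D where "AE p in M. \<bar>x p\<bar> \<le> C" "AE p in M. \<bar>y p\<bar> \<le> D" using assms by (auto simp: Linf_iff)
  then have "AE p in M. \<bar>x p + y p\<bar> \<le> C + D" by eventually_elim auto
  then show ?thesis using assms by (auto simp: Linf_iff)
qed

lemma Linf_cmult:
  fixes c :: real
  assumes "x \<in> Linf M F"
  shows "(\<lambda>p. c * x p) \<in> Linf M F"
proof -
  obtain C where "AE p in M. \<bar>x p\<bar> \<le> C" using assms by (auto simp: Linf_iff)
  then have "AE p in M. \<bar>c * x p\<bar> \<le> \<bar>c\<bar> * C"
    by eventually_elim (auto simp: abs_mult intro: mult_left_mono)
  then show ?thesis using assms by (auto simp: Linf_iff)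
qed

lemma Linf_diff:
  assumes "x \<in> Linf M F" "y \<in> Linf M F"
  shows "(\<lambda>p. x p - y p) \<in> Linf M F"
  using Linf_add[OF assms(1) Linf_cmult[OF assms(2), of "-1"]] by simp

lemma Linf_If:
  assumes "x \<in> Linf M F" "y \<in> Linf M F" "A \<in> sets F"
  shows "(\<lambda>p. if p \<in> A then x p else y p) \<in> Linf M F"
proof -
  obtain C D where "AE p in M. \<bar>x p\<bar> \<le> C" "AE p in M. \<bar>y p\<bar> \<le> D" using assms by (auto simp: Linf_iff)
  then have "AE p in M. \<bar>if p \<in> A then x p else y p\<bar> \<le> max C D" by eventually_elim auto
  moreover have "(\<lambda>p. if p \<in> A then x p else y p) \<in> borel_measurable F"
    using assms by (intro measurable_If_set) (auto simp: Linf_iff)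
  ultimately show ?thesis unfolding Linf_iff by blast
qed

context prob_subalgebra
begin

lemma Linf_F_M: "x \<in> Linf M F \<Longrightarrow> x \<in> Linf M M"
  by (auto simp: Linf_iff intro: F_M)

lemma Linf_integrable: "x \<in> Linf M M \<Longrightarrow> integrable M x"
  by (auto simp: Linf_iff intro: integrable_AE_bounded)

definition densities :: "('a \<Rightarrow> real) set \<Rightarrow> ('a \<Rightarrow> real) set" where
  "densities Y = {y \<in> Y. (AE p in M. y p \<le> 0) \<and> (AE p in M. real_cond_exp M F y p = -1)}"

definition dual_family ::
  "('a \<Rightarrow> real) set \<Rightarrow> ('a \<Rightarrow> real) set \<Rightarrow> (('a \<Rightarrow> real) \<Rightarrow> 'a \<Rightarrow> real) \<Rightarrow> ('a \<Rightarrow> real) \<Rightarrow> ('a \<Rightarrow> ereal) set" where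
  "dual_family X Y g x =
    (\<lambda>y p. ereal (pairing x y p) - cond_conjugate M F X g y p) ` densities Y"

lemma dual_representation_alt:
  "dual_representation M F X Y g \<longleftrightarrow>
    (\<forall>x\<in>X. AE p in M. ereal (g x p) = cond_Sup M F (dual_family X Y g x) p)"
proof -
  have "{(\<lambda>p. ereal (pairing x y p) - cond_conjugate M F X g y p) | y.
      y \<in> Y \<and> (AE p in M. y p \<le> 0) \<and> (AE p in M. real_cond_exp M F y p = -1)} = dual_family X Y g x" for x
    unfolding dual_family_def densities_def by blast
  then show ?thesis unfolding dual_representation_def by simp
qed

text \<open>For nonpositive \<open>y\<close> the conditional mean -1 says that the conditional
  expectation of \<open>\<bar>y\<bar>\<close> is 1, so \<open>\<bar>y\<bar>\<close> has integral 1.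
  The representations over \<open>L1 M\<close> and \<open>LF1 M F\<close> thus range over the same
  densities.\<close>

lemma densities_LF1: "densities (LF1 M F) = densities (L1 M)"
proof -
  have "integrable M y" if y: "y \<in> LF1 M F" "AE p in M. y p \<le> 0" "AE p in M. real_cond_exp M F y p = -1" for y
  proof (rule integrableI_bounded)
    show [measurable]: "y \<in> borel_measurable M" using y(1) by (simp add: LF1_iff)
    have "AE p in M. nn_cond_exp M F (\<lambda>p. ennreal (y p)) p = nn_cond_exp M F (\<lambda>p. 0) p"
      by (rule nn_cond_exp_cong) (use y(2) in \<open>auto elim!: eventually_mono simp: ennreal_neg\<close>)
    moreover have "AE p in M. 0 = nn_cond_exp M F (\<lambda>p. 0) p"
      by (rule nn_cond_exp_F_meas) simp
    moreover have "AE p in M. nn_cond_exp M F (\<lambda>p. ennreal (- y p)) p = nn_cond_exp M F (\<lambda>p. ennreal \<bar>y p\<bar>) p"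
      by (rule nn_cond_exp_cong) (use y(2) in \<open>auto elim!: eventually_mono\<close>)
    moreover have "AE p in M. nn_cond_exp M F (\<lambda>p. ennreal \<bar>y p\<bar>) p < \<infinity>" using y(1) by (simp add: LF1_iff)
    ultimately have "AE p in M. nn_cond_exp M F (\<lambda>p. ennreal \<bar>y p\<bar>) p = 1"
      using y(3)
    proof eventually_elim
      case (elim p)
      then have "enn2real (nn_cond_exp M F (\<lambda>p. ennreal \<bar>y p\<bar>) p) = 1" by (simp add: real_cond_exp_def)
      then have "ennreal (enn2real (nn_cond_exp M F (\<lambda>p. ennreal \<bar>y p\<bar>) p)) = 1" by simp
      then show ?case using elim(4) by simp
    qed
    then have "(\<integral>\<^sup>+p. nn_cond_exp M F (\<lambda>p. ennreal \<bar>y p\<bar>) p \<partial>M) = (\<integral>\<^sup>+p. 1 \<partial>M)"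
      by (rule nn_integral_cong_AE)
    moreover have "(\<integral>\<^sup>+p. nn_cond_exp M F (\<lambda>p. ennreal \<bar>y p\<bar>) p \<partial>M) = (\<integral>\<^sup>+p. ennreal \<bar>y p\<bar> \<partial>M)"
      using nn_cond_exp_intg[of "\<lambda>_. 1" "\<lambda>p. ennreal \<bar>y p\<bar>"] by simp
    ultimately show "(\<integral>\<^sup>+p. ennreal (norm (y p)) \<partial>M) < \<infinity>" by (simp add: emeasure_space_1)
  qed
  then show ?thesis using L1_subset_LF1 by (auto simp: densities_def L1_def)
qed

lemma dual_representation_LF1_iff_L1:
  "dual_representation M F X (LF1 M F) g \<longleftrightarrow> dual_representation M F X (L1 M) g"
  by (simp add: dual_representation_alt dual_family_def densities_LF1)

context
  fixes X :: "('a \<Rightarrow> real) set" and g :: "('a \<Rightarrow> real) \<Rightarrow> 'a \<Rightarrow> real"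
  assumes g: "\<forall>x\<in>X. g x \<in> borel_measurable F"
begin

lemma conjugate_family_measurable:
  "{(\<lambda>p. ereal (pairing x y p - g x p)) | x. x \<in> X} \<subseteq> borel_measurable F"
proof safe
  fix x assume "x \<in> X"
  with g have "g x \<in> borel_measurable F" by blast
  then show "(\<lambda>p. ereal (pairing x y p - g x p)) \<in> borel_measurable F" by measurable
qed

lemma cond_conjugate_measurable: "cond_conjugate M F X g y \<in> borel_measurable F"
  unfolding cond_conjugate_def by (rule cond_Sup_measurable[OF conjugate_family_measurable])

lemma cond_conjugate_upper:
  "x \<in> X \<Longrightarrow> AE p in M. ereal (pairing x y p - g x p) \<le> cond_conjugate M F X g y p"
  unfolding cond_conjugate_def by (rule cond_Sup_upper[OF conjugate_family_measurable]) auto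

lemma cond_conjugate_least:
  assumes "t \<in> borel_measurable F"
    and "\<And>x. x \<in> X \<Longrightarrow> AE p in M. ereal (pairing x y p - g x p) \<le> t p"
  shows "AE p in M. cond_conjugate M F X g y p \<le> t p"
  unfolding cond_conjugate_def by (rule cond_Sup_least[OF conjugate_family_measurable assms(1)]) (use assms(2) in auto)

lemma dual_family_measurable: "dual_family X Y g x \<subseteq> borel_measurable F"
  unfolding dual_family_def using cond_conjugate_measurable by auto

lemma young_fenchel:
  assumes "x \<in> X"
  shows "AE p in M. ereal (pairing x y p) - cond_conjugate M F X g y p \<le> ereal (g x p)"
  using cond_conjugate_upper[OF assms, of y]
proof eventually_elim
  case (elim p)
  then show ?case by (cases "cond_conjugate M F X g y p") auto
qed

lemma dual_family_le:
  assumes "x \<in> X"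
  shows "AE p in M. cond_Sup M F (dual_family X Y g x) p \<le> ereal (g x p)"
  by (rule cond_Sup_least[OF dual_family_measurable]) (use young_fenchel[OF assms] bspec[OF g assms] in \<open>auto simp: dual_family_def\<close>)

text \<open>The Young-Fenchel inequality supplies the opposite estimate for every choice of
  \<open>Y\<close>.\<close>

lemma dual_representation_iff:
  "dual_representation M F X Y g \<longleftrightarrow>
    (\<forall>x\<in>X. AE p in M. ereal (g x p) \<le> cond_Sup M F (dual_family X Y g x) p)"
proof -
  have "(AE p in M. ereal (g x p) = cond_Sup M F (dual_family X Y g x) p) \<longleftrightarrow>
      (AE p in M. ereal (g x p) \<le> cond_Sup M F (dual_family X Y g x) p)" (is "?l \<longleftrightarrow> ?r") if "x \<in> X" for x
  proof
    assume ?l then show ?r by eventually_elim simp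
  next
    assume ?r with dual_family_le[OF that, of Y] show ?l by eventually_elim simp
  qed
  then show ?thesis by (simp add: dual_representation_alt)
qed

end

end

locale cond_risk_extension = prob_subalgebra M F for M F :: "'a measure" +
  fixes f fbar :: "('a \<Rightarrow> real) \<Rightarrow> ('a \<Rightarrow> real)"
  assumes f_risk: "Linf_cond_risk_measure M F f"
    and f_convex: "L0_convex M F f"
    and fbar_risk: "LFinf_cond_risk_measure M F fbar"
    and fbar_lipschitz: "\<And>x y. x \<in> LFinf M F \<Longrightarrow> y \<in> LFinf M F \<Longrightarrow>
      AE p in M. ereal \<bar>fbar x p - fbar y p\<bar> \<le> cond_norm_inf M F (\<lambda>p. x p - y p) p"
    and fbar_eq: "\<And>x. x \<in> Linf M M \<Longrightarrow> AE p in M. fbar x p = f x p"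
begin

abbreviation f_conj :: "('a \<Rightarrow> real) \<Rightarrow> 'a \<Rightarrow> ereal" where
  "f_conj \<equiv> cond_conjugate M F (Linf M M) f"

abbreviation fbar_conj :: "('a \<Rightarrow> real) \<Rightarrow> 'a \<Rightarrow> ereal" where
  "fbar_conj \<equiv> cond_conjugate M F (LFinf M F) fbar"

lemma f_Linf: "x \<in> Linf M M \<Longrightarrow> f x \<in> Linf M F"
  using f_risk by (simp add: Linf_cond_risk_measure_def cond_risk_measure_def)

lemma f_mono: "x \<in> Linf M M \<Longrightarrow> y \<in> Linf M M \<Longrightarrow> AE p in M. y p \<le> x p \<Longrightarrow> AE p in M. f x p \<le> f y p"
  using f_risk by (simp add: Linf_cond_risk_measure_def cond_risk_measure_def)

lemma f_cash: "x \<in> Linf M M \<Longrightarrow> y \<in> Linf M F \<Longrightarrow> AE p in M. f (\<lambda>p. x p + y p) p = f x p - y p"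
  using f_risk by (simp add: Linf_cond_risk_measure_def cond_risk_measure_def)

lemma f_measurable: "x \<in> Linf M M \<Longrightarrow> f x \<in> borel_measurable F"
  using f_Linf by (auto simp: Linf_iff)

lemma fbar_measurable: "x \<in> LFinf M F \<Longrightarrow> fbar x \<in> borel_measurable F"
  using fbar_risk by (simp add: LFinf_cond_risk_measure_def cond_risk_measure_def L0_def)

lemma f_meas: "\<forall>x\<in>Linf M M. f x \<in> borel_measurable F"
  and fbar_meas: "\<forall>x\<in>LFinf M F. fbar x \<in> borel_measurable F"
  using f_measurable fbar_measurable by auto

lemma Linf_LFinf: "x \<in> Linf M M \<Longrightarrow> x \<in> LFinf M F"
  using Linf_subset_LFinf by auto

lemma Linf_measurable: "x \<in> Linf M M \<Longrightarrow> x \<in> borel_measurable M"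
  by (simp add: Linf_iff)

lemma LFinf_measurable: "x \<in> LFinf M F \<Longrightarrow> x \<in> borel_measurable M"
  by (simp add: LFinf_iff)

text \<open>The function that is 0 on \<open>A\<close> and infinite elsewhere is an
  \<open>F\<close>-measurable majorant of \<open>\<bar>x - x'\<bar>\<close>. The conditional norm of
  the difference therefore vanishes on \<open>A\<close>, and the Lipschitz bound does the
  rest.\<close>

lemma fbar_local:
  assumes A: "A \<in> sets F" and x: "x \<in> LFinf M F" "x' \<in> LFinf M F"
    and eq: "AE p in M. p \<in> A \<longrightarrow> x p = x' p"
  shows "AE p in M. p \<in> A \<longrightarrow> fbar x p = fbar x' p"
proof -
  have "AE p in M. cond_norm_inf M F (\<lambda>p. x p - x' p) p \<le> (if p \<in> A then 0 else \<infinity>)"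
    by (rule cond_norm_inf_le) (use A eq in \<open>auto elim!: eventually_mono intro!: measurable_If_set\<close>)
  with fbar_lipschitz[OF x] show ?thesis
  proof eventually_elim
    case (elim p)
    show ?case
    proof
      assume "p \<in> A"
      with elim(2) have "cond_norm_inf M F (\<lambda>p. x p - x' p) p \<le> 0" by simp
      with elim(1) have "ereal \<bar>fbar x p - fbar x' p\<bar> \<le> 0" by (rule order_trans)
      then show "fbar x p = fbar x' p" by simp
    qed
  qed
qed

lemma f_local:
  assumes A: "A \<in> sets F" and x: "x \<in> Linf M M" "x' \<in> Linf M M"
    and eq: "AE p in M. p \<in> A \<longrightarrow> x p = x' p"
  shows "AE p in M. p \<in> A \<longrightarrow> f x p = f x' p"
  using fbar_local[OF A Linf_LFinf[OF x(1)] Linf_LFinf[OF x(2)] eq] fbar_eq[OF x(1)] fbar_eq[OF x(2)]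
  by eventually_elim auto

text \<open>By monotonicity and cash invariance \<open>f x\<close> lies between
  \<open>f (\<lambda>_. 0) - C\<close> and \<open>f (\<lambda>_. 0) + C\<close>. The bound depends
  on \<open>x\<close> only through \<open>C\<close>, so it dominates \<open>f\<close> along bounded
  sequences.\<close>

lemma f_bounded:
  assumes x: "x \<in> Linf M M" and C: "AE p in M. \<bar>x p\<bar> \<le> C"
  shows "AE p in M. \<bar>f x p\<bar> \<le> \<bar>f (\<lambda>_. 0) p\<bar> + C"
proof -
  have c: "(\<lambda>_. c) \<in> Linf M M" for c :: real by (rule Linf_const)
  have "AE p in M. f (\<lambda>p. 0 + C) p = f (\<lambda>_. 0) p - C" "AE p in M. f (\<lambda>p. 0 + - C) p = f (\<lambda>_. 0) p - - C"
    by (rule f_cash[OF Linf_const Linf_const])+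
  moreover have "AE p in M. f (\<lambda>_. 0 + C) p \<le> f x p"
    by (rule f_mono[OF c x]) (use C in eventually_elim, auto)
  moreover have "AE p in M. f x p \<le> f (\<lambda>_. 0 + - C) p"
    by (rule f_mono[OF x c]) (use C in eventually_elim, auto)
  ultimately show ?thesis by eventually_elim auto
qed

lemma LFinf_exhaust:
  assumes x: "x \<in> LFinf M F"
  obtains A :: "nat \<Rightarrow> 'a set" where "\<forall>k. A k \<in> sets F" "AE p in M. \<exists>k. p \<in> A k"
    "\<forall>k. (\<lambda>p. if p \<in> A k then x p else 0) \<in> Linf M M"
proof -
  obtain \<xi> where [measurable]: "x \<in> borel_measurable M" and \<xi>[measurable]: "\<xi> \<in> borel_measurable F"
    and le: "AE p in M. \<bar>x p\<bar> \<le> \<xi> p" using x by (auto simp: LFinf_iff)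
  define A where "A k = {p \<in> space F. \<xi> p \<le> real k}" for k
  have AF: "A k \<in> sets F" for k unfolding A_def by measurable
  have [measurable]: "A k \<in> sets M" for k by (rule F_sets[OF AF])
  have "(\<lambda>p. if p \<in> A k then x p else 0) \<in> Linf M M" for k
  proof -
    have "AE p in M. \<bar>if p \<in> A k then x p else 0\<bar> \<le> real k"
      using le by eventually_elim (auto simp: A_def)
    moreover have "(\<lambda>p. if p \<in> A k then x p else 0) \<in> borel_measurable M"
      by (rule measurable_If_set) auto
    ultimately show ?thesis unfolding Linf_iff by blast
  qed
  moreover have "AE p in M. \<exists>k. p \<in> A k"
    by (rule AE_I2) (use real_arch_simple in \<open>auto simp: A_def space_F\<close>)
  ultimately show ?thesis using AF by (intro that[of A]) auto
qed

text \<open>On each set of the exhaustion \<open>x\<close> agrees with a bounded position, where the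
  estimate is the definition of \<open>f_conj\<close>; locality glues the pieces. A smaller
  conjugate enlarges the members of the dual family, the direction in which the representation is
  carried over.\<close>

lemma fbar_conjugate_le:
  assumes y: "y \<in> borel_measurable M"
  shows "AE p in M. fbar_conj y p \<le> f_conj y p"
proof (rule cond_conjugate_least[OF fbar_meas])
  show "f_conj y \<in> borel_measurable F"
    by (rule cond_conjugate_measurable[OF f_meas])
  fix x assume x: "x \<in> LFinf M F"
  obtain A :: "nat \<Rightarrow> 'a set" where A: "\<forall>k. A k \<in> sets F" "AE p in M. \<exists>k. p \<in> A k"
    "\<forall>k. (\<lambda>p. if p \<in> A k then x p else 0) \<in> Linf M M" by (rule LFinf_exhaust[OF x])
  have "AE p in M. p \<in> A k \<longrightarrow> ereal (pairing x y p - fbar x p) \<le> f_conj y p" for k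
  proof -
    let ?x = "\<lambda>p. if p \<in> A k then x p else 0"
    have xk: "?x \<in> Linf M M" and Ak: "A k \<in> sets F" using A by auto
    have "AE p in M. p \<in> A k \<longrightarrow> pairing ?x y p = pairing x y p"
      by (rule cond_pairing_local[OF Ak Linf_measurable[OF xk] LFinf_measurable[OF x] y]) simp
    moreover have "AE p in M. p \<in> A k \<longrightarrow> fbar ?x p = fbar x p"
      by (rule fbar_local[OF Ak Linf_LFinf[OF xk] x]) simp
    ultimately show ?thesis using cond_conjugate_upper[OF f_meas xk, where y = y] fbar_eq[OF xk]
      by eventually_elim auto
  qed
  then have "AE p in M. \<forall>k. p \<in> A k \<longrightarrow> ereal (pairing x y p - fbar x p) \<le> f_conj y p"
    unfolding AE_all_countable by blast
  with A(2) show "AE p in M. ereal (pairing x y p - fbar x p) \<le> f_conj y p"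
    by eventually_elim auto
qed

lemma dual_representation_extension:
  assumes rep: "dual_representation M F (Linf M M) (LF1 M F) f"
  shows "dual_representation M F (LFinf M F) (LF1 M F) fbar"
  unfolding dual_representation_iff[OF fbar_meas]
proof
  fix x assume x: "x \<in> LFinf M F"
  define S where "S = cond_Sup M F (dual_family (LFinf M F) (LF1 M F) fbar x)"
  have S[measurable]: "S \<in> borel_measurable F"
    unfolding S_def by (rule cond_Sup_measurable[OF dual_family_measurable[OF fbar_meas]])
  obtain A :: "nat \<Rightarrow> 'a set" where A: "\<forall>k. A k \<in> sets F" "AE p in M. \<exists>k. p \<in> A k"
    "\<forall>k. (\<lambda>p. if p \<in> A k then x p else 0) \<in> Linf M M" by (rule LFinf_exhaust[OF x])
  have "AE p in M. p \<in> A k \<longrightarrow> ereal (fbar x p) \<le> S p" for k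
  proof -
    let ?x = "\<lambda>p. if p \<in> A k then x p else 0"
    have xk: "?x \<in> Linf M M" and Ak[measurable]: "A k \<in> sets F" using A by auto
    have "AE p in M. ereal (f ?x p) \<le> cond_Sup M F (dual_family (Linf M M) (LF1 M F) f ?x) p"
      using rep xk unfolding dual_representation_iff[OF f_meas] by blast
    \<comment> \<open>The truncated position agrees with \<open>x\<close> only on
      \<open>A k\<close>, so outside \<open>A k\<close> the bound has to be infinite.\<close>
    moreover have "AE p in M. cond_Sup M F (dual_family (Linf M M) (LF1 M F) f ?x) p \<le> (if p \<in> A k then S p else \<infinity>)"
    proof (rule cond_Sup_least[OF dual_family_measurable[OF f_meas]])
      show "(\<lambda>p. if p \<in> A k then S p else \<infinity>) \<in> borel_measurable F"
        by (rule measurable_If_set) auto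
      fix a assume "a \<in> dual_family (Linf M M) (LF1 M F) f ?x"
      then obtain y where y: "y \<in> densities (LF1 M F)"
        and a: "a = (\<lambda>p. ereal (pairing ?x y p) - f_conj y p)"
        by (auto simp: dual_family_def)
      have ym: "y \<in> borel_measurable M" using y by (auto simp: densities_def LF1_iff)
      have "AE p in M. ereal (pairing x y p) - fbar_conj y p \<le> S p"
        unfolding S_def by (rule cond_Sup_upper[OF dual_family_measurable[OF fbar_meas]]) (use y in \<open>auto simp: dual_family_def\<close>)
      moreover have "AE p in M. p \<in> A k \<longrightarrow> pairing ?x y p = pairing x y p"
        by (rule cond_pairing_local[OF Ak Linf_measurable[OF xk] LFinf_measurable[OF x] ym]) simp
      ultimately show "AE p in M. a p \<le> (if p \<in> A k then S p else \<infinity>)"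
        using fbar_conjugate_le[OF ym]
      proof eventually_elim
        case (elim p)
        have "ereal (pairing x y p) - f_conj y p
            \<le> ereal (pairing x y p) - fbar_conj y p"
          using elim(3) by (intro ereal_minus_mono) auto
        with elim(1,2) show ?case by (auto simp: a)
      qed
    qed
    moreover have "AE p in M. p \<in> A k \<longrightarrow> fbar ?x p = fbar x p"
      by (rule fbar_local[OF Ak Linf_LFinf[OF xk] x]) simp
    ultimately show ?thesis using fbar_eq[OF xk]
    proof eventually_elim
      case (elim p)
      show ?case
      proof
        assume "p \<in> A k"
        with elim have "ereal (f ?x p) \<le> S p" "f ?x p = fbar x p" by auto
        then show "ereal (fbar x p) \<le> S p" by simp
      qed
    qed
  qed
  then have "AE p in M. \<forall>k. p \<in> A k \<longrightarrow> ereal (fbar x p) \<le> S p"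
    unfolding AE_all_countable by blast
  with A(2) show "AE p in M. ereal (fbar x p) \<le> S p" by eventually_elim auto
qed

section \<open>Continuity from above and the Fatou property\<close>

lemma f_incseq:
  assumes "\<And>n. X n \<in> Linf M M" "AE p in M. decseq (\<lambda>n. X n p)"
  shows "AE p in M. incseq (\<lambda>n. f (X n) p)"
proof -
  have "AE p in M. f (X n) p \<le> f (X (Suc n)) p" for n
    by (rule f_mono[OF assms(1,1)]) (use assms(2) in eventually_elim, auto simp: decseq_Suc_iff)
  then show ?thesis unfolding incseq_Suc_iff by (simp add: AE_all_countable)
qed

lemma f_le_limit:
  assumes "\<And>n. X n \<in> Linf M M" "x \<in> Linf M M" "AE p in M. decseq (\<lambda>n. X n p) \<and> (\<lambda>n. X n p) \<longlonglongrightarrow> x p"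
  shows "AE p in M. \<forall>n. f (X n) p \<le> f x p"
proof -
  have "AE p in M. f (X n) p \<le> f x p" for n
    by (rule f_mono[OF assms(1,2)]) (use assms(3) in eventually_elim, auto intro: decseq_ge)
  then show ?thesis by (simp add: AE_all_countable)
qed

text \<open>Monotonicity gives half of continuity from above, so only one inequality is at stake.\<close>

lemma continuous_from_aboveI:
  assumes "\<And>X x. (\<And>n. X n \<in> Linf M M) \<Longrightarrow> x \<in> Linf M M \<Longrightarrow>
      AE p in M. decseq (\<lambda>n. X n p) \<and> (\<lambda>n. X n p) \<longlonglongrightarrow> x p \<Longrightarrow>
      AE p in M. ereal (f x p) \<le> liminf (\<lambda>n. ereal (f (X n) p))"
  shows "continuous_from_above M f"
  unfolding continuous_from_above_def
proof (intro allI impI)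
  fix X :: "nat \<Rightarrow> 'a \<Rightarrow> real" and x
  assume X: "\<forall>n. X n \<in> Linf M M" and x: "x \<in> Linf M M"
    and lim: "AE p in M. decseq (\<lambda>n. X n p) \<and> (\<lambda>n. X n p) \<longlonglongrightarrow> x p"
  have "AE p in M. incseq (\<lambda>n. f (X n) p)"
    by (rule f_incseq) (use X lim in \<open>auto elim: eventually_mono\<close>)
  moreover have "AE p in M. \<forall>n. f (X n) p \<le> f x p"
    by (rule f_le_limit[OF _ x lim]) (use X in auto)
  moreover have "AE p in M. ereal (f x p) \<le> liminf (\<lambda>n. ereal (f (X n) p))"
    by (rule assms[OF _ x lim]) (use X in auto)
  ultimately show "AE p in M. incseq (\<lambda>n. f (X n) p) \<and> (\<lambda>n. f (X n) p) \<longlonglongrightarrow> f x p"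
  proof eventually_elim
    case (elim p)
    obtain l where l: "(\<lambda>n. f (X n) p) \<longlonglongrightarrow> l"
      using incseq_convergent[OF elim(1), of "f x p"] elim(2) by metis
    have "l \<le> f x p" by (rule LIMSEQ_le_const2[OF l]) (use elim(2) in auto)
    moreover have "liminf (\<lambda>n. ereal (f (X n) p)) = ereal l"
      by (rule lim_imp_Liminf) (use l in auto)
    ultimately have "l = f x p" using elim(3) by simp
    with l elim(1) show ?case by simp
  qed
qed

lemma Fatou_imp_continuous_from_above:
  assumes "Fatou_property M f"
  shows "continuous_from_above M f"
proof (rule continuous_from_aboveI)
  fix X :: "nat \<Rightarrow> 'a \<Rightarrow> real" and x
  assume X: "\<And>n. X n \<in> Linf M M" and x: "x \<in> Linf M M"
    and lim: "AE p in M. decseq (\<lambda>n. X n p) \<and> (\<lambda>n. X n p) \<longlonglongrightarrow> x p"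
  obtain C D where CD: "AE p in M. \<bar>X 0 p\<bar> \<le> C" "AE p in M. \<bar>x p\<bar> \<le> D"
    using X[of 0] x by (auto simp: Linf_iff)
  \<comment> \<open>A decreasing sequence lies between its limit and its first term, which gives the
    common bound demanded by the Fatou property.\<close>
  have "AE p in M. \<bar>X n p\<bar> \<le> C + D" for n
    using CD lim
  proof eventually_elim
    case (elim p)
    then have "x p \<le> X n p" "X n p \<le> X 0 p" by (auto intro: decseq_ge decseqD)
    then show ?case using elim by auto
  qed
  moreover have "AE p in M. (\<lambda>n. X n p) \<longlonglongrightarrow> x p" using lim by eventually_elim simp
  ultimately show "AE p in M. ereal (f x p) \<le> liminf (\<lambda>n. ereal (f (X n) p))"
    using assms X x unfolding Fatou_property_def by blast
qed

text \<open>\<open>Y n\<close> is the supremum of the tail from \<open>n\<close> on, so its limit is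
  the limes superior, which is \<open>x\<close>. The lemma reduces bounded a.e. convergence to
  monotone convergence; the supremum is finite off a null set, so \<open>real_of_ereal\<close>
  changes it only there.\<close>

lemma decreasing_majorants:
  assumes X: "\<And>n. X n \<in> borel_measurable M" and bnd: "\<And>n. AE p in M. \<bar>X n p\<bar> \<le> C"
    and lim: "AE p in M. (\<lambda>n. X n p) \<longlonglongrightarrow> x p"
  obtains Y :: "nat \<Rightarrow> 'a \<Rightarrow> real" where "\<forall>n. Y n \<in> borel_measurable M" "\<forall>n. AE p in M. \<bar>Y n p\<bar> \<le> C"
    "\<forall>n. AE p in M. X n p \<le> Y n p" "AE p in M. decseq (\<lambda>n. Y n p) \<and> (\<lambda>n. Y n p) \<longlonglongrightarrow> x p"
proof -
  have [measurable]: "X n \<in> borel_measurable M" for n by (rule X)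
  define Y where "Y n p = real_of_ereal (SUP m\<in>{n..}. ereal (X m p))" for n p
  have "Y n \<in> borel_measurable M" for n unfolding Y_def by measurable
  moreover have all: "AE p in M. \<forall>n. \<bar>X n p\<bar> \<le> C" using bnd by (simp add: AE_all_countable)
  have sup: "AE p in M. \<forall>n. ereal (Y n p) = (SUP m\<in>{n..}. ereal (X m p)) \<and> \<bar>Y n p\<bar> \<le> C"
    using all
  proof eventually_elim
    case (elim p)
    show ?case
    proof
      fix n
      let ?S = "SUP m\<in>{n..}. ereal (X m p)"
      have "ereal (X n p) \<le> ?S" by (rule SUP_upper) simp
      moreover have "- C \<le> X n p" using elim[rule_format, of n] by linarith
      ultimately have "ereal (- C) \<le> ?S" by (meson ereal_less_eq(3) order_trans)
      moreover have "?S \<le> ereal C"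
        by (rule SUP_least) (use elim in \<open>auto simp: abs_le_iff\<close>)
      ultimately show "ereal (Y n p) = ?S \<and> \<bar>Y n p\<bar> \<le> C"
        unfolding Y_def by (cases ?S) (auto simp: abs_le_iff)
    qed
  qed
  have "AE p in M. \<bar>Y n p\<bar> \<le> C" for n using sup by eventually_elim simp
  moreover have "AE p in M. X n p \<le> Y n p" for n
    using sup
  proof eventually_elim
    case (elim p)
    have "ereal (X n p) \<le> (SUP m\<in>{n..}. ereal (X m p))" by (rule SUP_upper) simp
    then show ?case using elim by (metis ereal_less_eq(3))
  qed
  moreover have "AE p in M. decseq (\<lambda>n. Y n p) \<and> (\<lambda>n. Y n p) \<longlonglongrightarrow> x p"
    using sup lim
  proof eventually_elim
    case (elim p)
    have dec: "decseq (\<lambda>n. ereal (Y n p))"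
      unfolding decseq_def using elim(1) by (auto intro!: SUP_subset_mono)
    have "(\<lambda>n. ereal (X n p)) \<longlonglongrightarrow> ereal (x p)" using elim(2) by simp
    then have "limsup (\<lambda>n. ereal (X n p)) = ereal (x p)" by (intro lim_imp_Limsup) auto
    then have "(INF n. ereal (Y n p)) = ereal (x p)" using elim(1) by (simp add: limsup_INF_SUP)
    then have "(\<lambda>n. ereal (Y n p)) \<longlonglongrightarrow> ereal (x p)" using LIMSEQ_INF[OF dec] by simp
    then show ?case using dec by (auto simp: decseq_def)
  qed
  ultimately show ?thesis by (intro that[of Y]) auto
qed

lemma continuous_from_above_imp_Fatou:
  assumes cont: "continuous_from_above M f"
  shows "Fatou_property M f"
  unfolding Fatou_property_def
proof (intro allI impI)
  fix X :: "nat \<Rightarrow> 'a \<Rightarrow> real" and x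
  assume X: "\<forall>n. X n \<in> Linf M M" and "\<exists>C. \<forall>n. AE p in M. \<bar>X n p\<bar> \<le> C" and x: "x \<in> Linf M M"
    and lim: "AE p in M. (\<lambda>n. X n p) \<longlonglongrightarrow> x p"
  then obtain C where C: "\<And>n. AE p in M. \<bar>X n p\<bar> \<le> C" by auto
  have Xm: "\<And>n. X n \<in> borel_measurable M" using X by (auto simp: Linf_iff)
  obtain Y where Y: "\<forall>n. Y n \<in> borel_measurable M" "\<forall>n. AE p in M. \<bar>Y n p\<bar> \<le> C"
    "\<forall>n. AE p in M. X n p \<le> Y n p" "AE p in M. decseq (\<lambda>n. Y n p) \<and> (\<lambda>n. Y n p) \<longlonglongrightarrow> x p"
    by (rule decreasing_majorants[OF Xm C lim])
  have YL: "Y n \<in> Linf M M" for n using Y by (auto simp: Linf_iff)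
  have conv: "AE p in M. incseq (\<lambda>n. f (Y n) p) \<and> (\<lambda>n. f (Y n) p) \<longlonglongrightarrow> f x p"
    using cont YL x Y(4) unfolding continuous_from_above_def by blast
  have "AE p in M. f (Y n) p \<le> f (X n) p" for n
    by (rule f_mono) (use YL X Y(3) in auto)
  then have "AE p in M. \<forall>n. f (Y n) p \<le> f (X n) p" by (simp add: AE_all_countable)
  with conv show "AE p in M. ereal (f x p) \<le> liminf (\<lambda>n. ereal (f (X n) p))"
  proof eventually_elim
    case (elim p)
    have "(\<lambda>n. ereal (f (Y n) p)) \<longlonglongrightarrow> ereal (f x p)" using elim(1) by simp
    then have "ereal (f x p) = liminf (\<lambda>n. ereal (f (Y n) p))" by (intro lim_imp_Liminf[symmetric]) auto
    also have "\<dots> \<le> liminf (\<lambda>n. ereal (f (X n) p))"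
      by (rule Liminf_mono) (use elim(2) in auto)
    finally show ?case .
  qed
qed

end

section \<open>From continuity from above to the dual representation\<close>

context cond_risk_extension
begin

lemma Linf_times_integrable: "integrable M y \<Longrightarrow> x \<in> Linf M M \<Longrightarrow> integrable M (\<lambda>p. y p * x p)"
  by (auto simp: Linf_iff intro: integrable_times_AE_bounded)

lemma f_integrable: "x \<in> Linf M M \<Longrightarrow> integrable M (f x)"
  by (rule Linf_integrable[OF Linf_F_M[OF f_Linf]])

lemma f_integral_cash:
  assumes "x \<in> Linf M M" "\<eta> \<in> Linf M F"
  shows "expectation (f (\<lambda>p. x p + \<eta> p)) = expectation (f x) - expectation \<eta>"
proof -
  have \<eta>: "\<eta> \<in> Linf M M" by (rule Linf_F_M[OF assms(2)])
  have "expectation (f (\<lambda>p. x p + \<eta> p)) = (\<integral>p. f x p - \<eta> p \<partial>M)"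
    by (rule integral_cong_AE)
      (use f_integrable[OF Linf_add[OF assms(1) \<eta>]] f_integrable[OF assms(1)] Linf_integrable[OF \<eta>] f_cash[OF assms] in auto)
  also have "\<dots> = expectation (f x) - expectation \<eta>"
    using f_integrable[OF assms(1)] Linf_integrable[OF \<eta>] by simp
  finally show ?thesis .
qed

text \<open>Adding the constant \<open>\<epsilon>\<close> lowers the expectation by exactly
  \<open>\<epsilon>\<close>, so this constant just reaches the required level, while 0 misses it by
  \<open>\<epsilon>\<close>. For closedness a sequence is replaced by its decreasing majorants,
  which are accepted by monotonicity and to which continuity from above applies.\<close>

lemma acceptance_set_shifted:
  assumes cont: "continuous_from_above M f" and x0: "x0 \<in> Linf M M" and e: "0 < \<epsilon>"
  shows "acceptance_set M {z \<in> Linf M M. expectation (f (\<lambda>p. x0 p + z p)) \<le> expectation (f x0) - \<epsilon>} \<epsilon>"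
    (is "acceptance_set M ?Z \<epsilon>")
proof
  show "?Z \<subseteq> Linf M M" by auto
  have add: "(\<lambda>p. x0 p + z p) \<in> Linf M M" if "z \<in> Linf M M" for z by (rule Linf_add[OF x0 that])
  show "(\<lambda>_. \<epsilon>) \<in> ?Z"
    using f_integral_cash[OF x0 Linf_const] by (simp add: Linf_const prob_space)
  show "(\<lambda>_. 0) \<notin> ?Z" using e by simp
  show "y \<in> ?Z" if x: "x \<in> ?Z" and y: "y \<in> Linf M M" and le: "AE p in M. x p \<le> y p" for x y
  proof -
    have "expectation (f (\<lambda>p. x0 p + y p)) \<le> expectation (f (\<lambda>p. x0 p + x p))"
      by (intro integral_mono_AE f_integrable f_mono add) (use x y le in auto)
    then show ?thesis using x y by auto
  qed
  show "(\<lambda>p. (1 - t) * x p + t * y p) \<in> ?Z" if x: "x \<in> ?Z" and y: "y \<in> ?Z" and t: "0 \<le> t" "t \<le> 1" for x y t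
  proof -
    let ?c = "\<lambda>p. (1 - t) * x p + t * y p"
    have L: "x \<in> Linf M M" "y \<in> Linf M M" using x y by auto
    have c: "?c \<in> Linf M M" by (intro Linf_add Linf_cmult L)
    have eq: "(\<lambda>p. x0 p + ?c p) = (\<lambda>p. (1 - t) * (x0 p + x p) + (1 - (1 - t)) * (x0 p + y p))"
      by (auto simp: algebra_simps)
    have "\<forall>\<xi>\<in>L0 F. (AE p in M. 0 \<le> \<xi> p \<and> \<xi> p \<le> 1) \<longrightarrow>
        (AE p in M. f (\<lambda>p. \<xi> p * (x0 p + x p) + (1 - \<xi> p) * (x0 p + y p)) p
          \<le> \<xi> p * f (\<lambda>p. x0 p + x p) p + (1 - \<xi> p) * f (\<lambda>p. x0 p + y p) p)"
      by (rule bspec[OF bspec[OF f_convex[unfolded L0_convex_def] add[OF L(1)]] add[OF L(2)]])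
    from bspec[OF this, of "\<lambda>_. 1 - t"] have "AE p in M. f (\<lambda>p. x0 p + ?c p) p
        \<le> (1 - t) * f (\<lambda>p. x0 p + x p) p + (1 - (1 - t)) * f (\<lambda>p. x0 p + y p) p"
      unfolding eq using t by (simp add: L0_def)
    then have "expectation (f (\<lambda>p. x0 p + ?c p))
        \<le> (\<integral>p. (1 - t) * f (\<lambda>p. x0 p + x p) p + t * f (\<lambda>p. x0 p + y p) p \<partial>M)"
      by (intro integral_mono_AE) (use f_integrable[OF add[OF c]] f_integrable[OF add[OF L(1)]] f_integrable[OF add[OF L(2)]] in auto)
    also have "\<dots> = (1 - t) * expectation (f (\<lambda>p. x0 p + x p)) + t * expectation (f (\<lambda>p. x0 p + y p))"
      using f_integrable[OF add[OF L(1)]] f_integrable[OF add[OF L(2)]] by simp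
    also have "\<dots> \<le> (1 - t) * (expectation (f x0) - \<epsilon>) + t * (expectation (f x0) - \<epsilon>)"
      by (intro add_mono mult_left_mono) (use x y t in auto)
    also have "\<dots> = expectation (f x0) - \<epsilon>" by (simp add: algebra_simps)
    finally show ?thesis using c by simp
  qed
  show "x \<in> ?Z" if X: "\<And>k::nat. X k \<in> ?Z" and C: "\<And>k. AE p in M. \<bar>X k p\<bar> \<le> C"
    and x: "x \<in> borel_measurable M" and lim: "AE p in M. (\<lambda>k. X k p) \<longlonglongrightarrow> x p" for X C x
  proof -
    have XL: "X k \<in> Linf M M" for k using X by auto
    have Xm: "X k \<in> borel_measurable M" for k by (rule Linf_measurable[OF XL])
    have xL: "x \<in> Linf M M" using x AE_abs_le_limit[OF C lim] by (auto simp: Linf_iff)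
    obtain Y where Y: "\<forall>n. Y n \<in> borel_measurable M" "\<forall>n. AE p in M. \<bar>Y n p\<bar> \<le> C"
      "\<forall>n. AE p in M. X n p \<le> Y n p" "AE p in M. decseq (\<lambda>n. Y n p) \<and> (\<lambda>n. Y n p) \<longlonglongrightarrow> x p"
      by (rule decreasing_majorants[OF Xm C lim])
    have YL: "Y n \<in> Linf M M" for n using Y by (auto simp: Linf_iff)
    obtain D where D: "AE p in M. \<bar>x0 p\<bar> \<le> D" using x0 by (auto simp: Linf_iff)
    have "AE p in M. decseq (\<lambda>n. x0 p + Y n p) \<and> (\<lambda>n. x0 p + Y n p) \<longlonglongrightarrow> x0 p + x p"
      using Y(4) by eventually_elim (auto simp: decseq_def intro: tendsto_add)
    then have conv: "AE p in M. incseq (\<lambda>n. f (\<lambda>p. x0 p + Y n p) p) \<and> (\<lambda>n. f (\<lambda>p. x0 p + Y n p) p) \<longlonglongrightarrow> f (\<lambda>p. x0 p + x p) p"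
      using cont[unfolded continuous_from_above_def, rule_format, of "\<lambda>n p. x0 p + Y n p" "\<lambda>p. x0 p + x p"]
        add[OF YL] add[OF xL] by blast
    have "(\<lambda>n. \<integral>p. f (\<lambda>p. x0 p + Y n p) p \<partial>M) \<longlonglongrightarrow> expectation (f (\<lambda>p. x0 p + x p))"
    proof (rule integral_dominated_convergence[where w = "\<lambda>p. \<bar>f (\<lambda>_. 0) p\<bar> + (D + C)"])
      show "AE p in M. (\<lambda>n. f (\<lambda>p. x0 p + Y n p) p) \<longlonglongrightarrow> f (\<lambda>p. x0 p + x p) p"
        using conv by eventually_elim simp
      show "AE p in M. norm (f (\<lambda>p. x0 p + Y n p) p) \<le> \<bar>f (\<lambda>_. 0) p\<bar> + (D + C)" for n
      proof -
        have "AE p in M. \<bar>Y n p\<bar> \<le> C" using Y(2) by blast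
        with D have "AE p in M. \<bar>x0 p + Y n p\<bar> \<le> D + C" by eventually_elim auto
        from f_bounded[OF add[OF YL] this] show ?thesis by simp
      qed
    qed (use f_integrable[OF Linf_const, of 0] f_integrable[OF add[OF YL]] f_integrable[OF add[OF xL]] in auto)
    moreover have "expectation (f (\<lambda>p. x0 p + Y n p)) \<le> expectation (f x0) - \<epsilon>" for n
    proof -
      have "expectation (f (\<lambda>p. x0 p + Y n p)) \<le> expectation (f (\<lambda>p. x0 p + X n p))"
        by (intro integral_mono_AE f_integrable f_mono add XL YL) (use Y(3) in auto)
      then show ?thesis using X[of n] by auto
    qed
    ultimately have "expectation (f (\<lambda>p. x0 p + x p)) \<le> expectation (f x0) - \<epsilon>"
      by (intro LIMSEQ_le_const2) auto
    then show ?thesis using xL by simp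
  qed
qed

text \<open>Cash invariance makes the conditional expectation of a separating functional constant, so it can
  be normalised to a density.\<close>

lemma scalar_representation:
  assumes cont: "continuous_from_above M f" and x0: "x0 \<in> Linf M M" and e: "0 < \<epsilon>"
  shows "\<exists>y\<in>densities (L1 M). \<forall>x\<in>Linf M M. (\<integral>p. x p * y p \<partial>M) - expectation (f x)
      \<le> (\<integral>p. x0 p * y p \<partial>M) - expectation (f x0) + \<epsilon>"
proof -
  define e0 where "e0 = expectation (f x0)"
  define Z where "Z = {z \<in> Linf M M. expectation (f (\<lambda>p. x0 p + z p)) \<le> e0 - \<epsilon>}"
  interpret Z: acceptance_set M Z \<epsilon>
    unfolding Z_def e0_def by (rule acceptance_set_shifted[OF cont x0 e])
  obtain y0 \<delta> where y0: "integrable M y0" "\<forall>p. 0 \<le> y0 p" "0 < \<delta>" "\<forall>z\<in>Z. \<delta> \<le> (\<integral>p. y0 p * z p \<partial>M)"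
    by (rule Z.separation)
  have [measurable]: "y0 \<in> borel_measurable M" using y0(1) by auto
  define \<kappa> where "\<kappa> = expectation y0"
  have mean0: "(\<integral>p. y0 p * \<eta> p \<partial>M) = 0" if \<eta>: "\<eta> \<in> Linf M F" "expectation \<eta> = 0" for \<eta>
  proof -
    have i: "integrable M (\<lambda>p. y0 p * \<eta> p)" by (rule Linf_times_integrable[OF y0(1) Linf_F_M[OF \<eta>(1)]])
    \<comment> \<open>An \<open>F\<close>-measurable shift of mean 0 leaves the expectation of
      \<open>f\<close> unchanged, so the position stays accepted for every real \<open>s\<close>. An
      affine function of \<open>s\<close> that is bounded below has slope 0.\<close>
    have *: "\<delta> \<le> \<epsilon> * \<kappa> + s * (\<integral>p. y0 p * \<eta> p \<partial>M)" for s
    proof -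
      have L: "(\<lambda>p. \<epsilon> + s * \<eta> p) \<in> Linf M F" by (intro Linf_add Linf_const Linf_cmult \<eta>)
      have "(\<integral>p. f (\<lambda>p. x0 p + (\<epsilon> + s * \<eta> p)) p \<partial>M) = e0 - (\<integral>p. \<epsilon> + s * \<eta> p \<partial>M)"
        unfolding e0_def by (rule f_integral_cash[OF x0 L])
      also have "(\<integral>p. \<epsilon> + s * \<eta> p \<partial>M) = \<epsilon>"
        using Linf_integrable[OF Linf_F_M[OF \<eta>(1)]] \<eta>(2) by (simp add: prob_space)
      finally have "(\<lambda>p. \<epsilon> + s * \<eta> p) \<in> Z" using Linf_F_M[OF L] by (simp add: Z_def)
      from bspec[OF y0(4) this] have "\<delta> \<le> (\<integral>p. y0 p * (\<epsilon> + s * \<eta> p) \<partial>M)" by blast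
      also have "\<dots> = (\<integral>p. \<epsilon> * y0 p + s * (y0 p * \<eta> p) \<partial>M)" by (simp add: algebra_simps)
      also have "\<dots> = \<epsilon> * \<kappa> + s * (\<integral>p. y0 p * \<eta> p \<partial>M)" using y0(1) i by (simp add: \<kappa>_def)
      finally show ?thesis .
    qed
    show ?thesis
    proof (rule ccontr)
      assume ne: "(\<integral>p. y0 p * \<eta> p \<partial>M) \<noteq> 0"
      have "\<delta> \<le> \<epsilon> * \<kappa> + (- (\<epsilon> * \<kappa>) / (\<integral>p. y0 p * \<eta> p \<partial>M)) * (\<integral>p. y0 p * \<eta> p \<partial>M)" by (rule *)
      with ne y0(3) show False by simp
    qed
  qed
  have \<kappa>: "0 < \<kappa>"
  proof -
    have "\<delta> \<le> (\<integral>p. y0 p * \<epsilon> \<partial>M)" by (rule bspec[OF y0(4) Z.const])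
    also have "\<dots> = \<kappa> * \<epsilon>" by (simp add: \<kappa>_def)
    finally show ?thesis using y0(3) e by (metis less_le_trans zero_less_mult_pos2)
  qed
  have mean: "(\<integral>p. y0 p * \<eta> p \<partial>M) = \<kappa> * expectation \<eta>" if \<eta>: "\<eta> \<in> Linf M F" for \<eta>
  proof -
    define m where "m = expectation \<eta>"
    have i: "integrable M (\<lambda>p. y0 p * \<eta> p)" "integrable M \<eta>"
      using Linf_times_integrable[OF y0(1) Linf_F_M[OF \<eta>]] Linf_integrable[OF Linf_F_M[OF \<eta>]] by auto
    have "(\<integral>p. y0 p * (\<eta> p - m) \<partial>M) = 0"
      by (rule mean0) (use i(2) in \<open>auto simp: m_def prob_space intro: Linf_diff \<eta> Linf_const\<close>)
    moreover have "(\<integral>p. y0 p * (\<eta> p - m) \<partial>M) = (\<integral>p. y0 p * \<eta> p - y0 p * m \<partial>M)" by (simp add: algebra_simps)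
    ultimately show ?thesis using i(1) y0(1) by (simp add: \<kappa>_def m_def)
  qed
  define y where "y p = - (y0 p) / \<kappa>" for p
  have yi: "integrable M y" unfolding y_def[abs_def] using y0(1) by simp
  have [measurable]: "y \<in> borel_measurable M" using yi by auto
  have int_y: "(\<integral>p. x p * y p \<partial>M) = - (\<integral>p. y0 p * x p \<partial>M) / \<kappa>" for x
    by (simp add: y_def mult.commute)
  have "AE p in M. real_cond_exp M F y p = -1"
  proof (rule real_cond_exp_charact)
    fix A assume A: "A \<in> sets F"
    have [measurable]: "A \<in> sets M" by (rule F_sets[OF A])
    have "indicator A \<in> Linf M F" using A by (auto simp: Linf_iff intro!: exI[of _ 1] simp: indicator_def)
    from mean[OF this] show "(\<integral>p\<in>A. y p \<partial>M) = (\<integral>p\<in>A. -1 \<partial>M)"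
      using \<kappa> by (simp add: set_lebesgue_integral_def int_y)
  qed (use yi in auto)
  then have dens: "y \<in> densities (L1 M)"
    using y0(2) \<kappa> yi by (auto simp: densities_def L1_def y_def divide_nonpos_pos)
  moreover have "(\<integral>p. x p * y p \<partial>M) - expectation (f x) \<le> (\<integral>p. x0 p * y p \<partial>M) - e0 + \<epsilon>" if x: "x \<in> Linf M M" for x
  proof -
    \<comment> \<open>By cash invariance \<open>x + \<eta>\<close> has expected risk exactly
      \<open>e0 - \<epsilon>\<close>, so \<open>x - x0 + \<eta>\<close> belongs to \<open>Z\<close>.
      Separation at this point, with \<open>mean\<close> evaluating the integral against
      \<open>\<eta>\<close>, is the desired inequality.\<close>
    define \<eta> where "\<eta> p = f x p - (e0 - \<epsilon>)" for p
    have \<eta>: "\<eta> \<in> Linf M F" unfolding \<eta>_def[abs_def] by (intro Linf_diff f_Linf x Linf_const)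
    have \<eta>int: "expectation \<eta> = expectation (f x) - (e0 - \<epsilon>)"
      unfolding \<eta>_def using f_integrable[OF x] by (simp add: prob_space)
    define z where "z p = (x p - x0 p) + \<eta> p" for p
    have zL: "z \<in> Linf M M" unfolding z_def[abs_def] by (intro Linf_add Linf_diff x x0 Linf_F_M[OF \<eta>])
    have "(\<lambda>p. x0 p + z p) = (\<lambda>p. x p + \<eta> p)" by (auto simp: z_def)
    then have "z \<in> Z" using zL f_integral_cash[OF x \<eta>] \<eta>int by (simp add: Z_def)
    with y0(4) have "\<delta> \<le> (\<integral>p. y0 p * z p \<partial>M)" by (rule bspec)
    also have "\<dots> = (\<integral>p. y0 p * x p - y0 p * x0 p + y0 p * \<eta> p \<partial>M)" by (simp add: z_def algebra_simps)
    also have "\<dots> = (\<integral>p. y0 p * x p \<partial>M) - (\<integral>p. y0 p * x0 p \<partial>M) + \<kappa> * (expectation (f x) - (e0 - \<epsilon>))"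
      using Linf_times_integrable[OF y0(1) x] Linf_times_integrable[OF y0(1) x0]
        Linf_times_integrable[OF y0(1) Linf_F_M[OF \<eta>]] mean[OF \<eta>] \<eta>int by simp
    finally have "0 < (\<integral>p. y0 p * x p \<partial>M) - (\<integral>p. y0 p * x0 p \<partial>M) + \<kappa> * (expectation (f x) - (e0 - \<epsilon>))"
      using y0(3) by simp
    also have "\<dots> = \<kappa> * (- (\<integral>p. x p * y p \<partial>M) + (\<integral>p. x0 p * y p \<partial>M) + (expectation (f x) - (e0 - \<epsilon>)))"
      using \<kappa> unfolding int_y by (simp add: field_simps)
    finally show ?thesis using \<kappa> by (simp add: zero_less_mult_iff)
  qed
  ultimately show ?thesis unfolding e0_def by blast
qed

text \<open>The family defining the conjugate is directed upwards, because \<open>f\<close> and the pairing are local.\<close>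

lemma conjugate_family_directed:
  assumes y: "y \<in> borel_measurable M" and x: "x \<in> Linf M M" "x' \<in> Linf M M"
  obtains x'' where "x'' \<in> Linf M M" "AE p in M. pairing x'' y p - f x'' p =
    max (pairing x y p - f x p) (pairing x' y p - f x' p)"
proof -
  have [measurable]: "f x \<in> borel_measurable F" "f x' \<in> borel_measurable F" by (auto intro: f_measurable x)
  define A where "A = {p \<in> space F. pairing x' y p - f x' p \<le> pairing x y p - f x p}"
  have A: "A \<in> sets F" "space F - A \<in> sets F" unfolding A_def by measurable
  define u where "u p = (if p \<in> A then x p else x' p)" for p
  have u: "u \<in> Linf M M" unfolding u_def[abs_def] by (rule Linf_If[OF x F_sets[OF A(1)]])
  have "AE p in M. p \<in> A \<longrightarrow> pairing u y p = pairing x y p"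
    by (rule cond_pairing_local[OF A(1) Linf_measurable[OF u] Linf_measurable[OF x(1)] y]) (simp add: u_def)
  moreover have "AE p in M. p \<in> space F - A \<longrightarrow> pairing u y p = pairing x' y p"
    by (rule cond_pairing_local[OF A(2) Linf_measurable[OF u] Linf_measurable[OF x(2)] y]) (simp add: u_def)
  moreover have "AE p in M. p \<in> A \<longrightarrow> f u p = f x p"
    by (rule f_local[OF A(1) u x(1)]) (simp add: u_def)
  moreover have "AE p in M. p \<in> space F - A \<longrightarrow> f u p = f x' p"
    by (rule f_local[OF A(2) u x(2)]) (simp add: u_def)
  moreover have "AE p in M. p \<in> space F" by (simp add: space_F)
  ultimately have "AE p in M. pairing u y p - f u p =
      max (pairing x y p - f x p) (pairing x' y p - f x' p)"
    by eventually_elim (auto simp: A_def max_def)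
  with u show ?thesis by (rule that)
qed

text \<open>The gap between \<open>f x0\<close> and the dual supremum is measured by its
  expectation. For the density belonging to \<open>\<epsilon>\<close>, the scalar inequality bounds
  the expectation of the gap by \<open>\<epsilon>\<close>, provided that the expectation of the
  conjugate can be computed as a limit of expectations of single members; directedness makes this
  possible.\<close>

lemma continuous_imp_dual_representation:
  assumes cont: "continuous_from_above M f"
  shows "dual_representation M F (Linf M M) (L1 M) f"
  unfolding dual_representation_iff[OF f_meas]
proof
  fix x0 assume x0: "x0 \<in> Linf M M"
  define S where "S = cond_Sup M F (dual_family (Linf M M) (L1 M) f x0)"
  have SF: "S \<in> borel_measurable F"
    unfolding S_def by (rule cond_Sup_measurable[OF dual_family_measurable[OF f_meas]])
  have [measurable]: "S \<in> borel_measurable M" by (rule F_M[OF SF])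
  have [measurable]: "f x0 \<in> borel_measurable M" by (rule F_M[OF f_measurable[OF x0]])
  \<comment> \<open>\<open>e2ennreal\<close> cuts negative values off at 0, so that the integral of
    the gap is always defined.\<close>
  define T where "T p = e2ennreal (ereal (f x0 p) - S p)" for p
  have [measurable]: "T \<in> borel_measurable M" unfolding T_def by measurable
  have "(\<integral>\<^sup>+p. T p \<partial>M) \<le> ennreal \<epsilon>" if e: "0 < \<epsilon>" for \<epsilon>
  proof -
    obtain y where y: "y \<in> densities (L1 M)"
      and sc: "\<forall>x\<in>Linf M M. (\<integral>p. x p * y p \<partial>M) - expectation (f x)
        \<le> (\<integral>p. x0 p * y p \<partial>M) - expectation (f x0) + \<epsilon>"
      using scalar_representation[OF cont x0 e] by blast
    have yi: "integrable M y" and ym[measurable]: "y \<in> borel_measurable M" using y by (auto simp: densities_def L1_def)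
    let ?fam = "{(\<lambda>p. ereal (pairing x y p - f x p)) | x. x \<in> Linf M M}"
    let ?conj = "f_conj y"
    obtain B where B: "B \<subseteq> ?fam" "countable B" "AE p in M. ?conj p = (SUP b\<in>B. b p)"
      unfolding cond_conjugate_def by (rule cond_Sup_countable[OF conjugate_family_measurable[OF f_meas]])
    \<comment> \<open>The inserted member, belonging to \<open>x0\<close>, makes the family
      nonempty, so that \<open>from_nat_into\<close> enumerates it.\<close>
    define B0 where "B0 = insert (\<lambda>p. ereal (pairing x0 y p - f x0 p)) B"
    have B0: "countable B0" "B0 \<noteq> {}" "B0 \<subseteq> ?fam" "B \<subseteq> B0" using B x0 by (auto simp: B0_def)
    have "\<exists>x. x \<in> Linf M M \<and> from_nat_into B0 n = (\<lambda>p. ereal (pairing x y p - f x p))" for n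
      using B0(3) from_nat_into[OF B0(2), of n] by auto
    then obtain xs where xs: "\<And>n. xs n \<in> Linf M M"
      "\<And>n. from_nat_into B0 n = (\<lambda>p. ereal (pairing (xs n) y p - f (xs n) p))" by metis
    define a where "a n p = pairing (xs n) y p - f (xs n) p" for n p
    define a0 where "a0 p = pairing x0 y p - f x0 p" for p
    have a_int: "integrable M (\<lambda>p. pairing x y p - f x p)"
      "(\<integral>p. pairing x y p - f x p \<partial>M) = (\<integral>p. x p * y p \<partial>M) - expectation (f x)"
      if x: "x \<in> Linf M M" for x
    proof -
      have "integrable M (\<lambda>p. x p * y p)" using Linf_times_integrable[OF yi x] by (simp add: mult.commute)
      note real_cond_exp_int[OF this]
      then show "integrable M (\<lambda>p. pairing x y p - f x p)"
        "(\<integral>p. pairing x y p - f x p \<partial>M) = (\<integral>p. x p * y p \<partial>M) - expectation (f x)"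
        using f_integrable[OF x] by (auto simp: cond_pairing_def)
    qed
    \<comment> \<open>Running maxima of the enumeration, started at the value \<open>a0\<close> of
      \<open>x0\<close> so that the excess \<open>q\<close> over \<open>a0\<close> is nonnegative.
      Each maximum is attained a.e. by one position, to which the scalar inequality applies.\<close>
    define m where "m = rec_nat a0 (\<lambda>n u p. max (u p) (a n p))"
    have m0: "m 0 = a0" and mS: "m (Suc n) p = max (m n p) (a n p)" for n p by (simp_all add: m_def)
    have ex: "\<exists>x\<in>Linf M M. AE p in M. pairing x y p - f x p = m n p" for n
    proof (induction n)
      case 0
      then show ?case using x0 by (auto simp: m0 a0_def)
    next
      case (Suc n)
      then obtain x where x: "x \<in> Linf M M" "AE p in M. pairing x y p - f x p = m n p" by blast
      obtain x'' where x'': "x'' \<in> Linf M M" "AE p in M. pairing x'' y p - f x'' p =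
          max (pairing x y p - f x p) (pairing (xs n) y p - f (xs n) p)"
        by (rule conjugate_family_directed[OF ym x(1) xs(1)])
      have "AE p in M. pairing x'' y p - f x'' p = m (Suc n) p"
        using x(2) x''(2) by eventually_elim (simp add: mS a_def)
      with x''(1) show ?case by blast
    qed
    have fm[measurable]: "f x \<in> borel_measurable M" if "x \<in> Linf M M" for x by (rule F_M[OF f_measurable[OF that]])
    have [measurable]: "a0 \<in> borel_measurable M" "a n \<in> borel_measurable M" for n
      unfolding a0_def[abs_def] a_def[abs_def] using fm[OF x0] fm[OF xs(1)] F_M[OF cond_pairing_measurable] by measurable
    have [measurable]: "m n \<in> borel_measurable M" for n
      by (induction n) (simp_all add: m0 mS[abs_def])
    define q where "q n p = m n p - a0 p" for n p
    have q0: "0 \<le> q n p" for n p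
      by (induction n) (auto simp: q_def m0 mS max_def)
    have q_inc: "q n p \<le> q (Suc n) p" for n p by (simp add: q_def mS)
    have [measurable]: "q n \<in> borel_measurable M" for n unfolding q_def[abs_def] by measurable
    have q_int: "(\<integral>\<^sup>+p. ennreal (q n p) \<partial>M) \<le> ennreal \<epsilon>" for n
    proof -
      obtain x where x: "x \<in> Linf M M" "AE p in M. pairing x y p - f x p = m n p" using ex by blast
      have AEeq: "AE p in M. (pairing x y p - f x p) - a0 p = q n p"
        using x(2) by eventually_elim (simp add: q_def)
      have i: "integrable M (\<lambda>p. (pairing x y p - f x p) - a0 p)"
        using a_int(1)[OF x(1)] a_int(1)[OF x0] unfolding a0_def by (rule Bochner_Integration.integrable_diff)
      then have "integrable M (q n)"
        by (rule integrable_cong_AE_imp) (use AEeq in \<open>auto elim: eventually_mono\<close>)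
      moreover have "(\<integral>p. q n p \<partial>M) = (\<integral>p. (pairing x y p - f x p) - a0 p \<partial>M)"
        by (rule integral_cong_AE) (use AEeq borel_measurable_integrable[OF i] in \<open>auto elim: eventually_mono\<close>)
      moreover have "\<dots> = ((\<integral>p. x p * y p \<partial>M) - expectation (f x)) - ((\<integral>p. x0 p * y p \<partial>M) - expectation (f x0))"
        unfolding a0_def a_int(2)[OF x(1), symmetric] a_int(2)[OF x0, symmetric]
        by (rule Bochner_Integration.integral_diff[OF a_int(1)[OF x(1)] a_int(1)[OF x0]])
      moreover have "\<dots> \<le> \<epsilon>" using bspec[OF sc x(1)] by linarith
      ultimately show ?thesis using q0 by (simp add: nn_integral_eq_integral ennreal_leI)
    qed
    define Q where "Q p = (SUP n. ennreal (q n p))" for p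
    have "(\<integral>\<^sup>+p. Q p \<partial>M) = (SUP n. \<integral>\<^sup>+p. ennreal (q n p) \<partial>M)"
      unfolding Q_def
      by (rule nn_integral_monotone_convergence_SUP) (auto intro!: incseq_SucI le_funI ennreal_leI q_inc)
    also have "\<dots> \<le> ennreal \<epsilon>" by (rule SUP_least) (rule q_int)
    finally have Q_int: "(\<integral>\<^sup>+p. Q p \<partial>M) \<le> ennreal \<epsilon>" .
    have "AE p in M. ereal (pairing x0 y p) - ?conj p \<le> S p"
      unfolding S_def by (rule cond_Sup_upper[OF dual_family_measurable[OF f_meas]]) (use y in \<open>auto simp: dual_family_def\<close>)
    moreover have "AE p in M. ereal (a0 p) \<le> ?conj p"
      unfolding a0_def by (rule cond_conjugate_upper[OF f_meas x0])
    \<comment> \<open>\<open>S\<close> is at least \<open>pairing x0 y - f_conj y\<close>, and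
      \<open>f_conj y\<close> is at most \<open>a0 + Q\<close>. Since \<open>a0\<close> is
      \<open>pairing x0 y - f x0\<close>, the pairing cancels and the gap is at most
      \<open>Q\<close>.\<close>
    ultimately have "AE p in M. T p \<le> Q p"
      using B(3)
    proof eventually_elim
      case (elim p)
      show ?case
      proof (cases "Q p")
        case (real r)
        have "b p \<le> ereal (r + a0 p)" if "b \<in> B" for b
        proof -
          have "b \<in> B0" using that B0(4) by auto
          then obtain n where "from_nat_into B0 n = b"
            using from_nat_into_surj[OF B0(1)] by blast
          then have b: "b p = ereal (a n p)" using fun_cong[OF xs(2)[of n], of p] by (simp add: a_def)
          have 1: "a n p \<le> q (Suc n) p + a0 p" by (simp add: q_def mS)
          have "ennreal (q (Suc n) p) \<le> Q p" unfolding Q_def by (rule SUP_upper) simp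
          then have "q (Suc n) p \<le> r" using real q0[of "Suc n" p] by (simp add: ennreal_le_iff)
          with 1 show ?thesis by (simp add: b)
        qed
        then have "(SUP b\<in>B. b p) \<le> ereal (r + a0 p)"
          by (rule SUP_least)
        then have c: "?conj p \<le> ereal (r + a0 p)" using elim(3) by simp
        then obtain c where c': "?conj p = ereal c" "c \<le> r + a0 p"
          using elim(2) by (cases "?conj p") auto
        have "ereal (f x0 p) - S p \<le> ereal r"
        proof (cases "S p")
          case (real s)
          then show ?thesis using elim(1) c' by (simp add: a0_def)
        qed (use elim(1) c' in auto)
        then have "T p \<le> e2ennreal (ereal r)" unfolding T_def by (rule e2ennreal_mono)
        then show ?thesis using real by simp
      qed simp
    qed
    then have "(\<integral>\<^sup>+p. T p \<partial>M) \<le> (\<integral>\<^sup>+p. Q p \<partial>M)" by (rule nn_integral_mono_AE)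
    with Q_int show ?thesis by (rule order_trans[rotated])
  qed
  then have "(\<integral>\<^sup>+p. T p \<partial>M) \<le> 0 + ennreal e" if "0 < e" for e using that by (simp only: add_0)
  then have "(\<integral>\<^sup>+p. T p \<partial>M) = 0" using ennreal_le_epsilon[of 0] le_zero_eq by blast
  then have "AE p in M. T p = 0" using nn_integral_0_iff_AE[of T M] by simp
  then show "AE p in M. ereal (f x0 p) \<le> cond_Sup M F (dual_family (Linf M M) (L1 M) f x0) p"
    unfolding S_def[symmetric]
  proof eventually_elim
    case (elim p)
    have "ereal (f x0 p) - S p \<le> 0"
    proof (rule ccontr)
      assume "\<not> ?thesis"
      then have pos: "0 < ereal (f x0 p) - S p" by (simp add: not_le)
      then show False using enn2ereal_e2ennreal[OF less_imp_le[OF pos]] elim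
        by (simp add: T_def zero_ennreal.rep_eq)
    qed
    then show ?case by (cases "S p") auto
  qed
qed

end

section \<open>Lower semicontinuity\<close>

lemma topspace_local_base:
  assumes op: "\<And>U. openin T U \<longleftrightarrow> U \<subseteq> X \<and> (\<forall>x\<in>U. \<exists>N\<in>B. (\<lambda>v p. x p + v p) ` N \<subseteq> U)"
    and N: "N \<in> B" and add: "\<And>x v. x \<in> X \<Longrightarrow> v \<in> N \<Longrightarrow> (\<lambda>p. x p + v p) \<in> X"
  shows "topspace T = X"
proof
  show "topspace T \<subseteq> X" using op[of "topspace T"] by blast
  have "openin T X"
    unfolding op
  proof (intro conjI ballI bexI[OF _ N])
    fix x assume "x \<in> X"
    then show "(\<lambda>v p. x p + v p) ` N \<subseteq> X" using add by (auto simp: image_subset_iff)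
  qed simp
  then show "X \<subseteq> topspace T" by (rule openin_subset)
qed

text \<open>The strict inequality leaves room: the set where \<open>\<bar>h0\<bar> < e\<close> is
  the increasing union of the sets where \<open>\<bar>h0\<bar> < e - 1 / (n + 1)\<close>, and one of
  these already has probability above \<open>1 - d\<close>. This makes balls for convergence in
  probability open. The perturbed variable \<open>k\<close> is given only up to null sets because
  the pairing is additive only a.e.\<close>

lemma (in prob_space) prob_near_open:
  assumes h0[measurable]: "h0 \<in> borel_measurable M" and P: "measure M {p \<in> space M. \<bar>h0 p\<bar> < e} > 1 - d"
  obtains e' d' :: real where "0 < e'" "0 < d'" "d' < 1"
    "\<forall>h\<in>borel_measurable M. \<forall>k\<in>borel_measurable M. measure M {p \<in> space M. \<bar>h p\<bar> < e'} > 1 - d' \<longrightarrow>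
      (AE p in M. k p = h0 p + h p) \<longrightarrow> measure M {p \<in> space M. \<bar>k p\<bar> < e} > (1 - d :: real)"
proof -
  define D where "D n = {p \<in> space M. \<bar>h0 p\<bar> < e - 1 / (real n + 1)}" for n
  have [measurable]: "D n \<in> sets M" for n unfolding D_def by measurable
  have "incseq D"
  proof (rule incseq_SucI, rule subsetI)
    fix n p assume "p \<in> D n"
    moreover have "1 / (real (Suc n) + 1) \<le> 1 / (real n + 1)" by (simp add: frac_le)
    ultimately show "p \<in> D (Suc n)" by (auto simp: D_def)
  qed
  then have "(\<lambda>n. measure M (D n)) \<longlonglongrightarrow> measure M (\<Union>n. D n)"
    by (intro finite_Lim_measure_incseq) auto
  moreover have "(\<Union>n. D n) = {p \<in> space M. \<bar>h0 p\<bar> < e}"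
  proof safe
    fix p assume "p \<in> space M" "\<bar>h0 p\<bar> < e"
    then obtain n where "inverse (real (Suc n)) < e - \<bar>h0 p\<bar>" using reals_Archimedean[of "e - \<bar>h0 p\<bar>"] by auto
    then have "p \<in> D n" using \<open>p \<in> space M\<close> by (simp add: D_def inverse_eq_divide algebra_simps)
    then show "p \<in> (\<Union>n. D n)" by auto
  next
    fix p n assume D: "p \<in> D n"
    then show "p \<in> space M" by (simp add: D_def)
    have "\<bar>h0 p\<bar> < e - 1 / (real n + 1)" using D by (simp add: D_def)
    also have "\<dots> < e" by simp
    finally show "\<bar>h0 p\<bar> < e" .
  qed
  ultimately have "\<forall>\<^sub>F n in sequentially. 1 - d < measure M (D n)"
    using P by (intro order_tendstoD(1)[where y = "measure M {p \<in> space M. \<bar>h0 p\<bar> < e}"]) auto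
  then obtain n where n: "1 - d < measure M (D n)" by (auto simp: eventually_sequentially)
  \<comment> \<open>The surplus of probability may be spent on the exceptional set of
    \<open>h\<close>; the minimum with \<open>1/2\<close> keeps \<open>d'\<close> below 1.\<close>
  define d' where "d' = min (1/2) (measure M (D n) - (1 - d))"
  have "1 - d < measure M {p \<in> space M. \<bar>k p\<bar> < e}"
    if h[measurable]: "h \<in> borel_measurable M" and k[measurable]: "k \<in> borel_measurable M"
      and Ph: "1 - d' < measure M {p \<in> space M. \<bar>h p\<bar> < 1 / (real n + 1)}"
      and eq: "AE p in M. k p = h0 p + h p" for h k
  proof -
    let ?H = "{p \<in> space M. \<bar>h p\<bar> < 1 / (real n + 1)}"
    have [measurable]: "?H \<in> sets M" by measurable
    have "measure M (D n) = measure M (D n \<inter> ?H) + measure M (D n - ?H)"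
      using finite_measure_Union[of "D n \<inter> ?H" "D n - ?H"] by (simp add: Int_Diff_Un Int_Diff_disjoint)
    moreover have "measure M (D n - ?H) \<le> measure M (space M - ?H)"
      by (rule finite_measure_mono) (auto simp: D_def)
    moreover have "measure M (space M - ?H) = 1 - measure M ?H" by (rule prob_compl) simp
    moreover have "measure M (D n \<inter> ?H) \<le> measure M {p \<in> space M. \<bar>k p\<bar> < e}"
      by (rule finite_measure_mono_AE) (use eq in \<open>eventually_elim, auto simp: D_def\<close>, measurable)
    moreover have "d' \<le> measure M (D n) - (1 - d)" by (simp add: d'_def)
    ultimately show ?thesis using Ph by linarith
  qed
  then show ?thesis
    by (intro that[of "1 / (real n + 1)" d']) (use n in \<open>auto simp: d'_def\<close>)
qed

context prob_subalgebra
begin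

section \<open>Open sets of the three topologies\<close>

lemma LFinf_add:
  assumes "x \<in> LFinf M F" "y \<in> LFinf M F"
  shows "(\<lambda>p. x p + y p) \<in> LFinf M F"
proof -
  obtain \<xi> \<eta> where *: "\<xi> \<in> borel_measurable F" "\<eta> \<in> borel_measurable F" "AE p in M. \<bar>x p\<bar> \<le> \<xi> p" "AE p in M. \<bar>y p\<bar> \<le> \<eta> p"
    using assms by (auto simp: LFinf_iff)
  have "AE p in M. \<bar>x p + y p\<bar> \<le> \<xi> p + \<eta> p" using *(3,4) by eventually_elim auto
  with *(1,2) assms show ?thesis by (auto simp: LFinf_iff intro!: bexI[of _ "\<lambda>p. \<xi> p + \<eta> p"])
qed

lemma cond_pairing_add:
  assumes "x \<in> LFinf M F" "v \<in> LFinf M F" "y \<in> LF1 M F"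
  shows "AE p in M. pairing (\<lambda>p. x p + v p) y p = pairing x y p + pairing v y p"
  using cond_pairing_diff[OF LFinf_add[OF assms(1,2)] assms(1,3)] by eventually_elim simp

lemma L0_measurable: "u \<in> L0 F \<Longrightarrow> u \<in> borel_measurable M"
  by (auto simp: L0_def intro: F_M)

lemma zero_LF1: "(\<lambda>_. 0) \<in> LF1 M F"
  using L1_subset_LF1 by (auto simp: L1_def)

lemma openin_sigma_c:
  "openin (sigma_c_topology M F) U \<longleftrightarrow>
    U \<subseteq> LFinf M F \<and> (\<forall>x\<in>U. \<exists>N\<in>sigma_c_base M F. (\<lambda>v p. x p + v p) ` N \<subseteq> U)"
  unfolding sigma_c_topology_def
  by (rule openin_local_base_topology) (rule sigma_c_base_directed[OF subalg])

lemma openin_sigma_el: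
  "openin (sigma_el_topology M F) U \<longleftrightarrow>
    U \<subseteq> LFinf M F \<and> (\<forall>x\<in>U. \<exists>N\<in>sigma_el_base M F. (\<lambda>v p. x p + v p) ` N \<subseteq> U)"
  unfolding sigma_el_topology_def
  by (rule openin_local_base_topology) (rule sigma_el_base_directed[OF prob_space_axioms subalg])

lemma openin_prob_conv:
  "openin (prob_conv_topology M F) U \<longleftrightarrow>
    U \<subseteq> L0 F \<and> (\<forall>x\<in>U. \<exists>N\<in>prob_conv_base M F. (\<lambda>v p. x p + v p) ` N \<subseteq> U)"
  unfolding prob_conv_topology_def
  by (rule openin_local_base_topology) (rule prob_conv_base_directed[OF prob_space_axioms subalg])

lemma sigma_c_baseI:
  assumes "y \<in> LF1 M F" "0 < e"
  shows "{x \<in> LFinf M F. AE p in M. \<bar>pairing x y p\<bar> \<le> e} \<in> sigma_c_base M F"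
  unfolding sigma_c_base_def
  by (rule CollectI, rule exI[of _ "{y}"], rule exI[of _ "\<lambda>_. e"]) (use assms in \<open>auto simp: L0_def\<close>)

lemma sigma_el_baseI:
  assumes "y \<in> LF1 M F" "0 < e" "0 < d" "d < 1"
  shows "{x \<in> LFinf M F. measure M {p \<in> space M. \<bar>pairing x y p\<bar> < e} > 1 - d} \<in> sigma_el_base M F"
  unfolding sigma_el_base_def
  by (rule CollectI, rule exI[of _ "{y}"], rule exI[of _ e], rule exI[of _ d]) (use assms in auto)

lemma prob_conv_baseI:
  assumes "0 < e" "0 < d" "d < 1"
  shows "{r \<in> L0 F. measure M {p \<in> space M. \<bar>r p\<bar> < e} > 1 - d} \<in> prob_conv_base M F"
  using assms unfolding prob_conv_base_def by blast

lemma topspace_sigma_c: "topspace (sigma_c_topology M F) = LFinf M F"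
  by (rule topspace_local_base[OF openin_sigma_c sigma_c_baseI[OF zero_LF1 zero_less_one]])
    (auto intro: LFinf_add)

lemma topspace_sigma_el: "topspace (sigma_el_topology M F) = LFinf M F"
  by (rule topspace_local_base[OF openin_sigma_el sigma_el_baseI[OF zero_LF1, of 1 "1/2"]])
    (auto intro: LFinf_add)

lemma topspace_prob_conv: "topspace (prob_conv_topology M F) = L0 F"
  by (rule topspace_local_base[OF openin_prob_conv prob_conv_baseI[of 1 "1/2"]])
    (auto simp: L0_def)

lemma sigma_el_neighbourhood:
  assumes x: "x \<in> LFinf M F" and y: "y \<in> LF1 M F"
  shows "openin (sigma_el_topology M F)
    {u \<in> LFinf M F. measure M {p \<in> space M. \<bar>pairing u y p - pairing x y p\<bar> < e} > 1 - d}"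
    (is "openin _ ?U")
  unfolding openin_sigma_el
proof (intro conjI ballI)
  show "?U \<subseteq> LFinf M F" by auto
  fix u assume "u \<in> ?U"
  then have u: "u \<in> LFinf M F" and
    Pu: "measure M {p \<in> space M. \<bar>pairing u y p - pairing x y p\<bar> < e} > 1 - d" by auto
  have pm[measurable]: "pairing z y \<in> borel_measurable M" for z by (rule F_M) simp
  obtain e' d' :: real where ed: "0 < e'" "0 < d'" "d' < 1" and
    near: "\<forall>h\<in>borel_measurable M. \<forall>k\<in>borel_measurable M. measure M {p \<in> space M. \<bar>h p\<bar> < e'} > 1 - d' \<longrightarrow>
      (AE p in M. k p = (pairing u y p - pairing x y p) + h p) \<longrightarrow>
      measure M {p \<in> space M. \<bar>k p\<bar> < e} > 1 - d"
    by (rule prob_near_open[OF _ Pu]) auto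
  show "\<exists>N\<in>sigma_el_base M F. (\<lambda>v p. u p + v p) ` N \<subseteq> ?U"
  proof (rule bexI[OF _ sigma_el_baseI[OF y ed]], rule subsetI)
    fix w assume "w \<in> (\<lambda>v p. u p + v p) `
      {v \<in> LFinf M F. 1 - d' < measure M {p \<in> space M. \<bar>pairing v y p\<bar> < e'}}"
    then obtain v where w: "w = (\<lambda>p. u p + v p)" and v: "v \<in> LFinf M F"
      and Pv: "1 - d' < measure M {p \<in> space M. \<bar>pairing v y p\<bar> < e'}" by auto
    have "AE p in M. pairing w y p - pairing x y p =
        (pairing u y p - pairing x y p) + pairing v y p"
      using cond_pairing_add[OF u v y] unfolding w by eventually_elim simp
    with bspec[OF bspec[OF near pm], of "\<lambda>p. pairing w y p - pairing x y p" v] Pv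
    have "measure M {p \<in> space M. \<bar>pairing w y p - pairing x y p\<bar> < e} > 1 - d" by simp
    then show "w \<in> ?U" using LFinf_add[OF u v] unfolding w by simp
  qed
qed

lemma prob_conv_neighbourhood:
  assumes r: "r \<in> L0 F"
  shows "openin (prob_conv_topology M F) {s \<in> L0 F. measure M {p \<in> space M. \<bar>s p - r p\<bar> < e} > 1 - d}"
    (is "openin _ ?U")
  unfolding openin_prob_conv
proof (intro conjI ballI)
  show "?U \<subseteq> L0 F" by auto
  fix s assume "s \<in> ?U"
  then have s: "s \<in> L0 F" and Ps: "measure M {p \<in> space M. \<bar>s p - r p\<bar> < e} > 1 - d" by auto
  have [measurable]: "s \<in> borel_measurable M" "r \<in> borel_measurable M" using s r L0_measurable by auto
  obtain e' d' :: real where ed: "0 < e'" "0 < d'" "d' < 1" and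
    near: "\<forall>h\<in>borel_measurable M. \<forall>k\<in>borel_measurable M. measure M {p \<in> space M. \<bar>h p\<bar> < e'} > 1 - d' \<longrightarrow>
      (AE p in M. k p = (s p - r p) + h p) \<longrightarrow> measure M {p \<in> space M. \<bar>k p\<bar> < e} > 1 - d"
    by (rule prob_near_open[OF _ Ps]) auto
  show "\<exists>N\<in>prob_conv_base M F. (\<lambda>v p. s p + v p) ` N \<subseteq> ?U"
  proof (rule bexI[OF _ prob_conv_baseI[OF ed]], rule subsetI)
    fix w assume "w \<in> (\<lambda>v p. s p + v p) ` {v \<in> L0 F. 1 - d' < measure M {p \<in> space M. \<bar>v p\<bar> < e'}}"
    then obtain v where w: "w = (\<lambda>p. s p + v p)" and v: "v \<in> L0 F"
      and Pv: "1 - d' < measure M {p \<in> space M. \<bar>v p\<bar> < e'}" by auto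
    have [measurable]: "v \<in> borel_measurable M" by (rule L0_measurable[OF v])
    have "AE p in M. w p - r p = (s p - r p) + v p" unfolding w by simp
    with bspec[OF bspec[OF near, of v], of "\<lambda>p. w p - r p"] Pv
    have "measure M {p \<in> space M. \<bar>w p - r p\<bar> < e} > 1 - d" unfolding w by simp
    then show "w \<in> ?U" using s v unfolding w by (simp add: L0_def)
  qed
qed

end

context cond_risk_extension
begin

text \<open>If every density stayed below \<open>r + 2 * e\<close> for all \<open>e\<close>, then
  letting \<open>e\<close> tend to 0 would put the dual supremum, and with it \<open>fbar x\<close>,
  below \<open>r\<close>. The factor 2 leaves room for two errors of size \<open>e\<close>, one from
  moving the position and one from moving \<open>r\<close>.\<close>

lemma exceeding_density:
  assumes rep: "dual_representation M F (LFinf M F) (LF1 M F) fbar"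
    and x: "x \<in> LFinf M F" and r: "r \<in> L0 F" and not_le: "\<not> (AE p in M. fbar x p \<le> r p)"
  obtains y e where "y \<in> LF1 M F" "0 < e"
    "\<not> (AE p in M. ereal (pairing x y p) - fbar_conj y p \<le> ereal (r p + 2 * e))"
proof (rule ccontr)
  assume none: "\<not> thesis"
  let ?S = "cond_Sup M F (dual_family (LFinf M F) (LF1 M F) fbar x)"
  have [measurable]: "r \<in> borel_measurable F" using r by (simp add: L0_def)
  have "AE p in M. ?S p \<le> ereal (r p)"
  proof (rule cond_Sup_least[OF dual_family_measurable[OF fbar_meas]])
    fix a assume "a \<in> dual_family (LFinf M F) (LF1 M F) fbar x"
    then obtain y where y: "y \<in> LF1 M F"
      and a: "a = (\<lambda>p. ereal (pairing x y p) - fbar_conj y p)"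
      by (auto simp: dual_family_def densities_def)
    have "AE p in M. a p \<le> ereal (r p + 2 * (1 / (real n + 1)))" for n
      using none that[OF y, of "1 / (real n + 1)"] unfolding a by fastforce
    then have "AE p in M. \<forall>n. a p \<le> ereal (r p + 2 * (1 / (real n + 1)))" by (simp add: AE_all_countable)
    then show "AE p in M. a p \<le> ereal (r p)"
    proof eventually_elim
      case (elim p)
      have "(\<lambda>n. r p + 2 * (1 / (real n + 1))) \<longlonglongrightarrow> r p + 2 * 0"
        using LIMSEQ_inverse_real_of_nat by (intro tendsto_intros) (simp add: inverse_eq_divide add.commute)
      then have "(\<lambda>n. ereal (r p + 2 * (1 / (real n + 1)))) \<longlonglongrightarrow> ereal (r p)" by simp
      then show ?case by (rule LIMSEQ_le_const) (use elim in auto)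
    qed
  qed measurable
  moreover have "AE p in M. ereal (fbar x p) \<le> ?S p"
    using rep x unfolding dual_representation_iff[OF fbar_meas] by blast
  ultimately have "AE p in M. fbar x p \<le> r p"
  proof eventually_elim
    case (elim p)
    from order_trans[OF elim(2,1)] show ?case by simp
  qed
  with not_le show False by simp
qed

text \<open>One density that witnesses the excess at \<open>x\<close> also witnesses it at
  \<open>x + v\<close> when its pairing with \<open>v\<close> is at most \<open>e\<close>: otherwise
  the Young-Fenchel inequality at \<open>x + v\<close> would bound the excess at
  \<open>x\<close>.\<close>

lemma dual_imp_sigma_c_lsc:
  assumes rep: "dual_representation M F (LFinf M F) (LF1 M F) fbar"
  shows "sigma_c_lsc M F fbar"
  unfolding sigma_c_lsc_def closedin_def topspace_sigma_c
proof (intro ballI conjI)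
  fix r assume r: "r \<in> L0 F"
  show "{x \<in> LFinf M F. AE p in M. fbar x p \<le> r p} \<subseteq> LFinf M F" by auto
  show "openin (sigma_c_topology M F) (LFinf M F - {x \<in> LFinf M F. AE p in M. fbar x p \<le> r p})" (is "openin _ ?W")
    unfolding openin_sigma_c
  proof (intro conjI ballI)
    fix x assume "x \<in> ?W"
    then have x: "x \<in> LFinf M F" and nle: "\<not> (AE p in M. fbar x p \<le> r p)" by auto
    obtain y e where y: "y \<in> LF1 M F" and e: "0 < e" and ex:
      "\<not> (AE p in M. ereal (pairing x y p) - fbar_conj y p \<le> ereal (r p + 2 * e))"
      by (rule exceeding_density[OF rep x r nle])
    show "\<exists>N\<in>sigma_c_base M F. (\<lambda>v p. x p + v p) ` N \<subseteq> ?W"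
    proof (rule bexI[OF _ sigma_c_baseI[OF y e]], rule subsetI)
      fix w assume "w \<in> (\<lambda>v p. x p + v p) ` {v \<in> LFinf M F. AE p in M. \<bar>pairing v y p\<bar> \<le> e}"
      then obtain v where w: "w = (\<lambda>p. x p + v p)" and v: "v \<in> LFinf M F"
        and ve: "AE p in M. \<bar>pairing v y p\<bar> \<le> e" by auto
      have wL: "w \<in> LFinf M F" unfolding w by (rule LFinf_add[OF x v])
      have False if "AE p in M. fbar w p \<le> r p"
      proof -
        have "AE p in M. ereal (pairing x y p) - fbar_conj y p \<le> ereal (r p + 2 * e)"
          using that young_fenchel[OF fbar_meas wL, of y] cond_pairing_add[OF x v y, folded w] ve
        proof eventually_elim
          case (elim p)
          then show ?case using e by (cases "fbar_conj y p") auto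
        qed
        with ex show False by simp
      qed
      with wL show "w \<in> ?W" by auto
    qed
  qed auto
qed

lemma dual_imp_sigma_el_lsc:
  assumes rep: "dual_representation M F (LFinf M F) (LF1 M F) fbar"
  shows "sigma_el_lsc M F fbar"
  unfolding sigma_el_lsc_def closedin_def topspace_prod_topology topspace_sigma_el topspace_prob_conv
proof (intro conjI)
  let ?E = "{(x, r). x \<in> LFinf M F \<and> r \<in> L0 F \<and> (AE p in M. fbar x p \<le> r p)}"
  show "?E \<subseteq> LFinf M F \<times> L0 F" by auto
  show "openin (prod_topology (sigma_el_topology M F) (prob_conv_topology M F)) (LFinf M F \<times> L0 F - ?E)"
    unfolding openin_prod_topology_alt
  proof (intro allI impI)
    fix x r assume "(x, r) \<in> LFinf M F \<times> L0 F - ?E"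
    then have x: "x \<in> LFinf M F" and r: "r \<in> L0 F" and nle: "\<not> (AE p in M. fbar x p \<le> r p)" by auto
    obtain y e where y: "y \<in> LF1 M F" and e: "0 < e" and ex:
      "\<not> (AE p in M. ereal (pairing x y p) - fbar_conj y p \<le> ereal (r p + 2 * e))"
      by (rule exceeding_density[OF rep x r nle])
    let ?c = "fbar_conj y"
    have [measurable]: "?c \<in> borel_measurable M" "pairing z y \<in> borel_measurable M" for z
      by (auto intro!: F_M cond_conjugate_measurable[OF fbar_meas])
    have [measurable]: "r \<in> borel_measurable M" by (rule L0_measurable[OF r])
    define G where "G = {p \<in> space M. \<not> (ereal (pairing x y p) - ?c p \<le> ereal (r p + 2 * e))}"
    have [measurable]: "G \<in> sets M" unfolding G_def by measurable
    define g where "g = measure M G"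
    have "g \<noteq> 0" using ex AE_iff_measurable[of G M] unfolding g_def G_def by (auto simp: emeasure_eq_measure)
    then have g: "0 < g" by (simp add: g_def zero_less_measure_iff)
    \<comment> \<open>Each of the two estimates fails with probability below \<open>g / 2\<close>,
      so the exceptional sets together cannot cover \<open>G\<close>, on which the excess
      occurs.\<close>
    let ?U = "{u \<in> LFinf M F. measure M {p \<in> space M. \<bar>pairing u y p - pairing x y p\<bar> < e} > 1 - g / 2}"
    let ?V = "{s \<in> L0 F. measure M {p \<in> space M. \<bar>s p - r p\<bar> < e} > 1 - g / 2}"
    have "x \<in> ?U" "r \<in> ?V" using x r g e by (auto simp: prob_space)
    moreover have "?U \<times> ?V \<subseteq> LFinf M F \<times> L0 F - ?E"
    proof safe
      fix u s assume u: "u \<in> LFinf M F" and s: "s \<in> L0 F" and le: "AE p in M. fbar u p \<le> s p"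
        and Pu: "1 - g / 2 < measure M {p \<in> space M. \<bar>pairing u y p - pairing x y p\<bar> < e}"
        and Ps: "1 - g / 2 < measure M {p \<in> space M. \<bar>s p - r p\<bar> < e}"
      have [measurable]: "s \<in> borel_measurable M" by (rule L0_measurable[OF s])
      let ?A = "{p \<in> space M. \<bar>pairing u y p - pairing x y p\<bar> < e}"
        and ?B = "{p \<in> space M. \<bar>s p - r p\<bar> < e}"
      have "AE p in M. p \<in> G \<longrightarrow> p \<in> (space M - ?A) \<union> (space M - ?B)"
        using le young_fenchel[OF fbar_meas u, of y]
      proof eventually_elim
        case (elim p)
        show ?case
        proof (rule impI, rule ccontr)
          assume "p \<in> G" "p \<notin> (space M - ?A) \<union> (space M - ?B)"
          then show False using elim by (cases "?c p") (auto simp: G_def)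
        qed
      qed
      then have "g \<le> measure M ((space M - ?A) \<union> (space M - ?B))"
        unfolding g_def by (intro finite_measure_mono_AE) auto
      also have "\<dots> \<le> measure M (space M - ?A) + measure M (space M - ?B)"
        by (rule measure_Un_le) auto
      also have "\<dots> = (1 - measure M ?A) + (1 - measure M ?B)"
        by (intro arg_cong2[where f = "(+)"] prob_compl) auto
      finally show False using Pu Ps by simp
    qed
    ultimately show "\<exists>U V. openin (sigma_el_topology M F) U \<and> openin (prob_conv_topology M F) V \<and>
        x \<in> U \<and> r \<in> V \<and> U \<times> V \<subseteq> LFinf M F \<times> L0 F - ?E"
      by (intro exI[of _ ?U] exI[of _ ?V] conjI sigma_el_neighbourhood[OF x y] prob_conv_neighbourhood[OF r])
  qed
qed

text \<open>Waiting for the sequence to enter a neighbourhood at a random \<open>F\<close>-measurable time replaces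
  almost sure convergence by convergence in the finer topology.\<close>

lemma stopped_sequence_near_limit:
  assumes X: "\<And>n. X n \<in> Linf M M" and x: "x \<in> Linf M M"
    and lim: "AE p in M. decseq (\<lambda>n. X n p) \<and> (\<lambda>n. X n p) \<longlonglongrightarrow> x p"
    and le: "AE p in M. \<forall>n. f (X n) p \<le> r p"
    and Y: "finite Y" "Y \<subseteq> LF1 M F" and e: "\<epsilon> \<in> borel_measurable F" "AE p in M. 0 < \<epsilon> p"
  obtains v where "v \<in> LFinf M F" "\<forall>y\<in>Y. AE p in M. \<bar>pairing v y p\<bar> \<le> \<epsilon> p"
    "AE p in M. fbar (\<lambda>p. x p + v p) p \<le> r p"
proof -
  have [measurable]: "\<epsilon> \<in> borel_measurable F" by (rule e)
  have Xm[measurable]: "X n \<in> borel_measurable M" for n by (rule Linf_measurable[OF X])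
  have [measurable]: "x \<in> borel_measurable M" by (rule Linf_measurable[OF x])
  define d where "d n p = X n p - x p" for n p
  have [measurable]: "d n \<in> borel_measurable M" for n unfolding d_def[abs_def] by measurable
  obtain C D where CD: "AE p in M. \<bar>X 0 p\<bar> \<le> C" "AE p in M. \<bar>x p\<bar> \<le> D"
    using X[of 0] x by (auto simp: Linf_iff)
  have d_all: "AE p in M. \<forall>n. \<bar>d n p\<bar> \<le> C + D"
    using CD lim
  proof eventually_elim
    case (elim p)
    show ?case
    proof
      fix n
      have "x p \<le> X n p" "X n p \<le> X 0 p" using elim(3) by (auto intro: decseq_ge decseqD)
      then show "\<bar>d n p\<bar> \<le> C + D" using elim(1,2) by (auto simp: d_def)
    qed
  qed
  have d_bnd: "AE p in M. \<bar>d n p\<bar> \<le> C + D" for n using d_all by eventually_elim simp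
  have d_dec: "AE p in M. decseq (\<lambda>n. d n p) \<and> (\<lambda>n. d n p) \<longlonglongrightarrow> 0"
    using lim by eventually_elim (auto simp: d_def decseq_def LIM_zero)
  define P where "P n p \<longleftrightarrow> (\<forall>y\<in>Y. \<bar>pairing (d n) y p\<bar> \<le> \<epsilon> p)" for n p
  \<comment> \<open>The condition involves only finitely many \<open>F\<close>-measurable pairings
    and \<open>\<epsilon>\<close>, so \<open>T\<close> is \<open>F\<close>-measurable and locality
    applies on its level sets. The value of \<open>LEAST\<close> is arbitrary only on the null set
    where no index qualifies.\<close>
  define T where "T p = (LEAST n. P n p)" for p
  have [measurable]: "Measurable.pred F (P n)" for n
    unfolding P_def using Y(1) by measurable
  have T[measurable]: "T \<in> measurable F (count_space UNIV)" unfolding T_def by measurable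
  have TM[measurable]: "T \<in> measurable M (count_space UNIV)" by (rule F_M[OF T])
  define v where "v p = d (T p) p" for p
  have vm[measurable]: "v \<in> borel_measurable M"
    unfolding v_def[abs_def] by (rule measurable_compose_countable[OF _ TM]) simp
  have "AE p in M. \<bar>v p\<bar> \<le> C + D" using d_all by eventually_elim (simp add: v_def)
  then have vL: "v \<in> Linf M M" using vm by (auto simp: Linf_iff)
  let ?B = "\<lambda>n. {p \<in> space F. T p = n}"
  have Tset: "?B n \<in> sets F" for n by measurable
  have space: "AE p in M. p \<in> space F" by (simp add: space_F)
  have ex: "AE p in M. \<exists>n. P n p"
  proof -
    have "AE p in M. \<forall>y\<in>Y. (\<lambda>n. pairing (d n) y p) \<longlonglongrightarrow> 0"
      by (rule AE_finite_allI[OF Y(1)], rule cond_pairing_decseq_tendsto_0[OF _ d_bnd _ d_dec]) (use Y(2) in auto)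
    with e(2) show ?thesis
    proof eventually_elim
      case (elim p)
      have "\<forall>\<^sub>F n in sequentially. \<forall>y\<in>Y. \<bar>pairing (d n) y p\<bar> < \<epsilon> p"
      proof (rule eventually_ball_finite[OF Y(1)], rule ballI)
        fix y assume "y \<in> Y"
        with elim(2) have "(\<lambda>n. \<bar>pairing (d n) y p\<bar>) \<longlonglongrightarrow> 0" by (simp add: tendsto_rabs_zero)
        then show "\<forall>\<^sub>F n in sequentially. \<bar>pairing (d n) y p\<bar> < \<epsilon> p"
          by (rule order_tendstoD(2)) (rule elim(1))
      qed
      then show ?case by (auto simp: eventually_sequentially P_def intro: less_imp_le)
    qed
  qed
  have "AE p in M. \<bar>pairing v y p\<bar> \<le> \<epsilon> p" if y: "y \<in> Y" for y
  proof -
    have ym: "y \<in> borel_measurable M" using y Y(2) by (auto simp: LF1_iff)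
    have "AE p in M. p \<in> ?B n \<longrightarrow> pairing v y p = pairing (d n) y p" for n
      by (rule cond_pairing_local[OF Tset vm _ ym]) (auto simp: v_def)
    then have "AE p in M. \<forall>n. p \<in> ?B n \<longrightarrow> pairing v y p = pairing (d n) y p"
      unfolding AE_all_countable by blast
    with ex space show ?thesis
    proof eventually_elim
      case (elim p)
      have "P (T p) p" unfolding T_def by (rule LeastI_ex[OF elim(1)])
      then show ?case using elim y by (auto simp: P_def)
    qed
  qed
  moreover have "AE p in M. fbar (\<lambda>p. x p + v p) p \<le> r p"
  proof -
    \<comment> \<open>Where \<open>T\<close> equals \<open>n\<close>, the position
      \<open>x + v\<close> is \<open>X n\<close>; the bound \<open>r\<close>, valid for every term,
      passes to the stopped position by locality.\<close>
    have xv: "(\<lambda>p. x p + v p) \<in> Linf M M" by (rule Linf_add[OF x vL])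
    have "AE p in M. p \<in> ?B n \<longrightarrow> f (\<lambda>p. x p + v p) p = f (X n) p" for n
      by (rule f_local[OF Tset xv X]) (auto simp: v_def d_def)
    then have "AE p in M. \<forall>n. p \<in> ?B n \<longrightarrow> f (\<lambda>p. x p + v p) p = f (X n) p"
      unfolding AE_all_countable by blast
    with le space fbar_eq[OF xv] show ?thesis by eventually_elim auto
  qed
  ultimately show ?thesis using Linf_LFinf[OF vL] by (intro that[of v]) auto
qed

text \<open>The limit of the increasing sequence \<open>f (X n)\<close> is
  \<open>F\<close>-measurable and dominates every term, so it can be inserted for \<open>r\<close>;
  the conclusion then says that \<open>f x\<close> does not exceed this limit.\<close>

lemma continuous_from_above_if_closed:
  assumes closed: "\<And>X x r. (\<And>n. X n \<in> Linf M M) \<Longrightarrow> x \<in> Linf M M \<Longrightarrow> r \<in> L0 F \<Longrightarrow>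
      AE p in M. decseq (\<lambda>n. X n p) \<and> (\<lambda>n. X n p) \<longlonglongrightarrow> x p \<Longrightarrow>
      AE p in M. \<forall>n. f (X n) p \<le> r p \<Longrightarrow> AE p in M. fbar x p \<le> r p"
  shows "continuous_from_above M f"
proof (rule continuous_from_aboveI)
  fix X :: "nat \<Rightarrow> 'a \<Rightarrow> real" and x
  assume X: "\<And>n. X n \<in> Linf M M" and x: "x \<in> Linf M M"
    and lim: "AE p in M. decseq (\<lambda>n. X n p) \<and> (\<lambda>n. X n p) \<longlonglongrightarrow> x p"
  have "AE p in M. incseq (\<lambda>n. f (X n) p)"
    by (rule f_incseq[OF X]) (use lim in \<open>auto elim: eventually_mono\<close>)
  moreover have "AE p in M. \<forall>n. f (X n) p \<le> f x p" by (rule f_le_limit[OF X x lim])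
  ultimately have conv: "AE p in M. (\<lambda>n. f (X n) p) \<longlonglongrightarrow> lim (\<lambda>n. f (X n) p) \<and> (\<forall>n. f (X n) p \<le> lim (\<lambda>n. f (X n) p))"
  proof eventually_elim
    case (elim p)
    obtain l where l: "(\<lambda>n. f (X n) p) \<longlonglongrightarrow> l" "\<forall>n. f (X n) p \<le> l"
      using incseq_convergent[OF elim(1), of "f x p"] elim(2) by metis
    then show ?case by (simp add: limI)
  qed
  have [measurable]: "f (X n) \<in> borel_measurable F" for n by (rule f_measurable[OF X])
  have "(\<lambda>p. lim (\<lambda>n. f (X n) p)) \<in> L0 F" unfolding L0_def by measurable
  moreover have "AE p in M. \<forall>n. f (X n) p \<le> lim (\<lambda>n. f (X n) p)" using conv by eventually_elim blast
  ultimately have "AE p in M. fbar x p \<le> lim (\<lambda>n. f (X n) p)" by (rule closed[OF X x _ lim])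
  with conv fbar_eq[OF x] show "AE p in M. ereal (f x p) \<le> liminf (\<lambda>n. ereal (f (X n) p))"
  proof eventually_elim
    case (elim p)
    have "(\<lambda>n. ereal (f (X n) p)) \<longlonglongrightarrow> ereal (lim (\<lambda>n. f (X n) p))" using elim(1) by simp
    then have "liminf (\<lambda>n. ereal (f (X n) p)) = ereal (lim (\<lambda>n. f (X n) p))" by (intro lim_imp_Liminf) auto
    then show ?case using elim by simp
  qed
qed

lemma sigma_c_lsc_imp_continuous:
  assumes lsc: "sigma_c_lsc M F fbar"
  shows "continuous_from_above M f"
proof (rule continuous_from_above_if_closed, rule ccontr)
  fix X :: "nat \<Rightarrow> 'a \<Rightarrow> real" and x r
  assume X: "\<And>n. X n \<in> Linf M M" and x: "x \<in> Linf M M" and r: "r \<in> L0 F"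
    and lim: "AE p in M. decseq (\<lambda>n. X n p) \<and> (\<lambda>n. X n p) \<longlonglongrightarrow> x p"
    and le: "AE p in M. \<forall>n. f (X n) p \<le> r p" and nle: "\<not> (AE p in M. fbar x p \<le> r p)"
  let ?W = "LFinf M F - {x \<in> LFinf M F. AE p in M. fbar x p \<le> r p}"
  have "openin (sigma_c_topology M F) ?W"
    using lsc r unfolding sigma_c_lsc_def closedin_def topspace_sigma_c by blast
  moreover have "x \<in> ?W" using nle Linf_LFinf[OF x] by auto
  ultimately obtain N where N: "N \<in> sigma_c_base M F" and sub: "(\<lambda>v p. x p + v p) ` N \<subseteq> ?W"
    unfolding openin_sigma_c by blast
  obtain Y \<epsilon> where N_eq: "N = {v \<in> LFinf M F. \<forall>y\<in>Y. AE p in M. \<bar>pairing v y p\<bar> \<le> \<epsilon> p}"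
    and Y: "finite Y" "Y \<subseteq> LF1 M F" "\<epsilon> \<in> L0 F" "AE p in M. 0 < \<epsilon> p"
    using N unfolding sigma_c_base_def by blast
  obtain v where v: "v \<in> LFinf M F" "\<forall>y\<in>Y. AE p in M. \<bar>pairing v y p\<bar> \<le> \<epsilon> p"
    "AE p in M. fbar (\<lambda>p. x p + v p) p \<le> r p"
    by (rule stopped_sequence_near_limit[OF X x lim le Y(1,2) _ Y(4)]) (use Y(3) in \<open>auto simp: L0_def\<close>)
  have "v \<in> N" using v unfolding N_eq by simp
  then have "(\<lambda>p. x p + v p) \<in> ?W" using sub by (metis (no_types, lifting) image_subset_iff)
  with v(3) show False by auto
qed

text \<open>A product neighbourhood of \<open>(x, r)\<close> also contains \<open>(x + v, r)\<close>
  for the stopped perturbation \<open>v\<close>, so the second coordinate can be kept fixed.\<close>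

lemma sigma_el_lsc_imp_continuous:
  assumes lsc: "sigma_el_lsc M F fbar"
  shows "continuous_from_above M f"
proof (rule continuous_from_above_if_closed, rule ccontr)
  fix X :: "nat \<Rightarrow> 'a \<Rightarrow> real" and x r
  assume X: "\<And>n. X n \<in> Linf M M" and x: "x \<in> Linf M M" and r: "r \<in> L0 F"
    and lim: "AE p in M. decseq (\<lambda>n. X n p) \<and> (\<lambda>n. X n p) \<longlonglongrightarrow> x p"
    and le: "AE p in M. \<forall>n. f (X n) p \<le> r p" and nle: "\<not> (AE p in M. fbar x p \<le> r p)"
  let ?E = "{(x, r). x \<in> LFinf M F \<and> r \<in> L0 F \<and> (AE p in M. fbar x p \<le> r p)}"
  have "openin (prod_topology (sigma_el_topology M F) (prob_conv_topology M F)) (LFinf M F \<times> L0 F - ?E)"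
    using lsc unfolding sigma_el_lsc_def closedin_def topspace_prod_topology topspace_sigma_el topspace_prob_conv by blast
  moreover have "(x, r) \<in> LFinf M F \<times> L0 F - ?E" using nle Linf_LFinf[OF x] r by auto
  ultimately obtain U V where U: "openin (sigma_el_topology M F) U" "x \<in> U" and V: "r \<in> V"
    and UV: "U \<times> V \<subseteq> LFinf M F \<times> L0 F - ?E"
    unfolding openin_prod_topology_alt by blast
  obtain N where N: "N \<in> sigma_el_base M F" and sub: "(\<lambda>v p. x p + v p) ` N \<subseteq> U"
    using U unfolding openin_sigma_el by blast
  obtain Y \<epsilon> \<delta> where N_eq: "N = {v \<in> LFinf M F. measure M {p \<in> space M. Max ((\<lambda>y. \<bar>pairing v y p\<bar>) ` Y) < \<epsilon>} > 1 - \<delta>}"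
    and Y: "finite Y" "Y \<noteq> {}" "Y \<subseteq> LF1 M F" and ed: "0 < \<epsilon>" "0 < \<delta>"
    using N unfolding sigma_el_base_def by blast
  \<comment> \<open>Halving \<open>\<epsilon>\<close> makes the inequality strict almost surely, so
    the event in the definition of \<open>N\<close> has probability 1.\<close>
  obtain v where v: "v \<in> LFinf M F" "\<forall>y\<in>Y. AE p in M. \<bar>pairing v y p\<bar> \<le> \<epsilon> / 2"
    "AE p in M. fbar (\<lambda>p. x p + v p) p \<le> r p"
    by (rule stopped_sequence_near_limit[OF X x lim le Y(1,3), of "\<lambda>_. \<epsilon> / 2"]) (use ed in auto)
  have [measurable]: "pairing v y \<in> borel_measurable M" for y by (rule F_M) simp
  have "AE p in M. \<forall>y\<in>Y. \<bar>pairing v y p\<bar> < \<epsilon>"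
    by (rule AE_finite_allI[OF Y(1)]) (use v(2) ed in \<open>force elim: eventually_mono\<close>)
  moreover have "{p \<in> space M. \<forall>y\<in>Y. \<bar>pairing v y p\<bar> < \<epsilon>} \<in> sets M" using Y(1) by measurable
  ultimately have "measure M {p \<in> space M. \<forall>y\<in>Y. \<bar>pairing v y p\<bar> < \<epsilon>} = 1"
    by (subst prob_Collect_eq_1) auto
  moreover have "{p \<in> space M. Max ((\<lambda>y. \<bar>pairing v y p\<bar>) ` Y) < \<epsilon>} =
      {p \<in> space M. \<forall>y\<in>Y. \<bar>pairing v y p\<bar> < \<epsilon>}" using Y by auto
  ultimately have "v \<in> N" using v(1) ed unfolding N_eq by simp
  then have "(\<lambda>p. x p + v p) \<in> U" using sub by (metis (no_types, lifting) image_subset_iff)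
  with V have "((\<lambda>p. x p + v p), r) \<in> LFinf M F \<times> L0 F - ?E" using UV by blast
  with v(3) show False by auto
qed

end

theorem theorem4p25:
  fixes M F :: "'a measure"
    and f fbar :: "('a \<Rightarrow> real) \<Rightarrow> ('a \<Rightarrow> real)"
  assumes "prob_space M"
    and "subalgebra M F"
    and "Linf_cond_risk_measure M F f"
    and "L0_convex M F f"
    and "LFinf_cond_risk_measure M F fbar"
    and "\<And>x y. x \<in> LFinf M F \<Longrightarrow> y \<in> LFinf M F \<Longrightarrow>
      AE \<omega> in M. ereal \<bar>fbar x \<omega> - fbar y \<omega>\<bar> \<le> cond_norm_inf M F (\<lambda>\<omega>. x \<omega> - y \<omega>) \<omega>"
    and "\<And>x. x \<in> Linf M M \<Longrightarrow> AE \<omega> in M. fbar x \<omega> = f x \<omega>"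
  shows "(continuous_from_above M f \<longleftrightarrow> Fatou_property M f) \<and>
    (Fatou_property M f \<longleftrightarrow> dual_representation M F (Linf M M) (L1 M) f) \<and>
    (dual_representation M F (Linf M M) (L1 M) f \<longleftrightarrow>
      dual_representation M F (Linf M M) (LF1 M F) f) \<and>
    (dual_representation M F (Linf M M) (LF1 M F) f \<longleftrightarrow>
      dual_representation M F (LFinf M F) (LF1 M F) fbar) \<and>
    (dual_representation M F (LFinf M F) (LF1 M F) fbar \<longleftrightarrow> sigma_el_lsc M F fbar) \<and>
    (sigma_el_lsc M F fbar \<longleftrightarrow> sigma_c_lsc M F fbar)"
proof -
  interpret prob_space M by fact
  interpret cond_risk_extension M F f fbar
    by unfold_locales (use assms in auto)
  have "Fatou_property M f \<longleftrightarrow> continuous_from_above M f"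
    using Fatou_imp_continuous_from_above continuous_from_above_imp_Fatou by blast
  moreover have "dual_representation M F (Linf M M) (LF1 M F) f \<longleftrightarrow> dual_representation M F (Linf M M) (L1 M) f"
    by (rule dual_representation_LF1_iff_L1)
  \<comment> \<open>The implications close a cycle: continuity from above gives the representation
    of \<open>f\<close>, this gives that of \<open>fbar\<close>, which gives either kind of lower
    semicontinuity, and each kind leads back to continuity from above.\<close>
  ultimately show ?thesis
    using continuous_imp_dual_representation dual_representation_extension dual_imp_sigma_c_lsc
      dual_imp_sigma_el_lsc sigma_c_lsc_imp_continuous sigma_el_lsc_imp_continuous
    by blast
qed

end
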